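(* Let $(I,<)$ be a well-ordered set and let $S$ be a free pro-$2$ group on generators $x_i$, $i\in I$. Let $\mathcal{R}$ be a set of elements of $S_{(2)}$. Assume there exist $r\in\mathcal{R}$ and distinct indices $i<j$ in $I$ such that: (i) in the canonical decomposition modulo $S_{(4)}$ of $r$, $a_i=a_j=u_{ij}=u_{il}=u_{jl}=0$ for all $l\neq i,j$, and $c_{iji}\neq 0$ (respectively, $c_{ijj}\neq0$); and (ii) for every $s\in\mathcal{R}$ different from $r$, the factors $[x_i,x_j]$ and $x_i^2$ (respectively, $[x_i,x_j]$ and $x_j^2$) do not occur in the canonical decomposition modulo $S_{(4)}$ of $s$. Then $G=S/\langle\mathcal{R}\rangle$ is not isomorphic to $G_F(2)$ for any field $F$.
   Context: $[x,y]=x^{-1}y^{-1}xy$. The $2$-Zassenhaus filtration of $S$: $S_{(1)}=S$, $S_{(n)}=S_{(\lceil n/2\rceil)}^2\prod_{i+j=n}[S_{(i)},S_{(j)}]$. Every $r\in S_{(2)}$ can be written uniquely as $r=\prod_{i\in I}x_i^{2a_i}\prod_{i<j}[x_i,x_j]^{b_{ij}}\prod_{i<j,\,k\le j}[[x_i,x_j],x_k]^{c_{ijk}}\cdot r'$ with $a_i,b_{ij},c_{ijk}\in\{0,1\}$ and $r'\in S_{(4)}$ (products in a fixed order); this is the canonical decomposition modulo $S_{(4)}$ of $r$, and a factor "does not occur" if its exponent is $0$. Set $u_{ij}=b_{ij}$ if $i<j$ and $u_{ij}=b_{ji}$ if $j<i$. $\langle\mathcal{R}\rangle$ is the closed normal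 subgroup generated by $\mathcal{R}$; $G_F(2)$ is the maximal pro-$2$ quotient of the absolute Galois group of $F$. *)

theory Defs
  imports "HOL-Analysis.Analysis" "HOL-Algebra.Algebraic_Closure_Type"
begin

section \<open>Profinite groups\<close>

text \<open>A topological group is given by a group \<open>G\<close> and a topology \<open>T\<close> on its carrier.\<close>

definition topological_group :: "('a, 'm) monoid_scheme \<Rightarrow> 'a topology \<Rightarrow> bool" where
  "topological_group G T \<longleftrightarrow>
     group G \<and> topspace T = carrier G \<and>
     continuous_map (prod_topology T T) T (\<lambda>(x, y). x \<otimes>\<^bsub>G\<^esub> y) \<and>
     continuous_map T T (\<lambda>x. inv\<^bsub>G\<^esub> x)"

definition totally_disconnected_topology :: "'a topology \<Rightarrow> bool" where
  "totally_disconnected_topology T \<longleftrightarrow>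
     (\<forall>x\<in>topspace T. connected_component_of_set T x = {x})"

definition profinite_group :: "('a, 'm) monoid_scheme \<Rightarrow> 'a topology \<Rightarrow> bool" where
  "profinite_group G T \<longleftrightarrow>
     topological_group G T \<and> compact_space T \<and> Hausdorff_space T \<and>
     totally_disconnected_topology T"

definition pro_p_group :: "nat \<Rightarrow> ('a, 'm) monoid_scheme \<Rightarrow> 'a topology \<Rightarrow> bool" where
  "pro_p_group p G T \<longleftrightarrow>
     profinite_group G T \<and>
     (\<forall>N. N \<lhd> G \<and> openin T N \<longrightarrow> (\<exists>k. card (rcosets\<^bsub>G\<^esub> N) = p ^ k))"

definition topologically_isomorphic ::
    "('a, 'm) monoid_scheme \<Rightarrow> 'a topology \<Rightarrow> ('b, 'n) monoid_scheme \<Rightarrow> 'b topology \<Rightarrow> bool" where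
  "topologically_isomorphic G T H T' \<longleftrightarrow> (\<exists>h. h \<in> iso G H \<and> homeomorphic_map T T' h)"

text \<open>The quotient topology on \<open>G Mod N\<close>, whose elements are the cosets of \<open>N\<close>:
  the preimage in \<open>G\<close> of a set \<open>U\<close> of cosets is \<open>\<Union>U\<close>.\<close>

definition quotient_group_topology ::
    "('a, 'm) monoid_scheme \<Rightarrow> 'a topology \<Rightarrow> 'a set \<Rightarrow> 'a set topology" where
  "quotient_group_topology G T N =
     topology (\<lambda>U. U \<subseteq> carrier (G Mod N) \<and> openin T (\<Union>U))"

lemma openin_quotient_group_topology:
  assumes "group G" and "N \<lhd> G"
  shows "openin (quotient_group_topology G T N) U \<longleftrightarrow>
           U \<subseteq> carrier (G Mod N) \<and> openin T (\<Union>U)"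
proof -
  have disj: "A = B" if "A \<in> rcosets\<^bsub>G\<^esub> N" "B \<in> rcosets\<^bsub>G\<^esub> N" "z \<in> A" "z \<in> B" for A B z
    using group.rcos_disjoint[OF assms(1) normal_imp_subgroup[OF assms(2)]] that
    by (auto simp: pairwise_def disjnt_def)
  have "istopology (\<lambda>U. U \<subseteq> carrier (G Mod N) \<and> openin T (\<Union>U))"
    unfolding istopology_def
  proof (intro conjI allI impI)
    fix U V
    assume U: "U \<subseteq> carrier (G Mod N) \<and> openin T (\<Union>U)"
      and V: "V \<subseteq> carrier (G Mod N) \<and> openin T (\<Union>V)"
    have "\<Union>(U \<inter> V) = \<Union>U \<inter> \<Union>V"
    proof (intro equalityI subsetI)
      fix z assume "z \<in> \<Union>U \<inter> \<Union>V"
      then obtain A B where AB: "A \<in> U" "B \<in> V" "z \<in> A" "z \<in> B" by blast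
      moreover from AB U V have "A \<in> rcosets\<^bsub>G\<^esub> N" "B \<in> rcosets\<^bsub>G\<^esub> N"
        by (auto simp: FactGroup_def)
      ultimately have "A = B" using disj by blast
      with AB show "z \<in> \<Union>(U \<inter> V)" by blast
    qed blast
    with U V show "openin T (\<Union>(U \<inter> V))" by auto
    show "U \<inter> V \<subseteq> carrier (G Mod N)" using U by auto
  next
    fix K
    assume K: "\<forall>U\<in>K. U \<subseteq> carrier (G Mod N) \<and> openin T (\<Union>U)"
    have "\<Union>(\<Union>K) = \<Union>(Union ` K)" by auto
    with K show "openin T (\<Union>(\<Union>K))" by auto
    show "\<Union>K \<subseteq> carrier (G Mod N)" using K by auto
  qed
  then show ?thesis
    by (simp add: quotient_group_topology_def topology_inverse')
qed

definition closed_subgroup_generated ::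
    "('a, 'm) monoid_scheme \<Rightarrow> 'a topology \<Rightarrow> 'a set \<Rightarrow> 'a set" where
  "closed_subgroup_generated G T A = \<Inter>{H. subgroup H G \<and> closedin T H \<and> A \<subseteq> H}"

definition closed_normal_subgroup_generated ::
    "('a, 'm) monoid_scheme \<Rightarrow> 'a topology \<Rightarrow> 'a set \<Rightarrow> 'a set" where
  "closed_normal_subgroup_generated G T A = \<Inter>{H. H \<lhd> G \<and> closedin T H \<and> A \<subseteq> H}"

text \<open>The maximal pro-\<open>p\<close> quotient of \<open>(G, T)\<close> is the quotient by the intersection of all open
  normal subgroups of \<open>p\<close>-power index.\<close>

definition pro_p_kernel :: "nat \<Rightarrow> ('a, 'm) monoid_scheme \<Rightarrow> 'a topology \<Rightarrow> 'a set" where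
  "pro_p_kernel p G T =
     \<Inter>{N. N \<lhd> G \<and> openin T N \<and> (\<exists>k. card (rcosets\<^bsub>G\<^esub> N) = p ^ k)}"

definition maximal_pro_p_quotient :: "nat \<Rightarrow> ('a, 'm) monoid_scheme \<Rightarrow> 'a topology \<Rightarrow> 'a set monoid" where
  "maximal_pro_p_quotient p G T = G Mod pro_p_kernel p G T"

definition maximal_pro_p_quotient_topology ::
    "nat \<Rightarrow> ('a, 'm) monoid_scheme \<Rightarrow> 'a topology \<Rightarrow> 'a set topology" where
  "maximal_pro_p_quotient_topology p G T = quotient_group_topology G T (pro_p_kernel p G T)"

section \<open>Free pro-p groups\<close>

definition family_converges_to_one ::
    "('a, 'm) monoid_scheme \<Rightarrow> 'a topology \<Rightarrow> ('i \<Rightarrow> 'a) \<Rightarrow> bool" where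
  "family_converges_to_one G T y \<longleftrightarrow>
     (\<forall>i. y i \<in> carrier G) \<and>
     (\<forall>U. openin T U \<and> \<one>\<^bsub>G\<^esub> \<in> U \<longrightarrow> finite {i. y i \<notin> U})"

text \<open>The universal property among pro-\<open>p\<close> groups. A definition cannot quantify over types, so the
  carriers of the test groups are subsets of the type \<open>('i + nat) set\<close>. This loses nothing: a
  pro-\<open>p\<close> group topologically generated by a family indexed by \<open>'i\<close> and converging to \<open>1\<close> has at
  most \<open>max |'i| \<aleph>\<^sub>0\<close> open normal subgroups, hence embeds into a product of that many finite groups,
  and so has an isomorphic copy carried by this type.\<close>

definition free_pro_p_group ::
    "nat \<Rightarrow> ('s, 'm) monoid_scheme \<Rightarrow> 's topology \<Rightarrow> ('i \<Rightarrow> 's) \<Rightarrow> bool" where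
  "free_pro_p_group p S T x \<longleftrightarrow>
     pro_p_group p S T \<and> family_converges_to_one S T x \<and>
     (\<forall>(H :: ('i + nat) set monoid) T' y.
        pro_p_group p H T' \<and> family_converges_to_one H T' y \<longrightarrow>
        (\<exists>!\<phi>. \<phi> \<in> extensional (carrier S) \<and> \<phi> \<in> hom S H \<and> continuous_map T T' \<phi> \<and>
              (\<forall>i. \<phi> (x i) = y i)))"

section \<open>The 2-Zassenhaus filtration\<close>

definition commutator :: "('a, 'm) monoid_scheme \<Rightarrow> 'a \<Rightarrow> 'a \<Rightarrow> 'a" where
  "commutator G x y = inv\<^bsub>G\<^esub> x \<otimes>\<^bsub>G\<^esub> inv\<^bsub>G\<^esub> y \<otimes>\<^bsub>G\<^esub> x \<otimes>\<^bsub>G\<^esub> y"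

text \<open>As usual for profinite groups, \<open>H\<^sup>2\<close> and \<open>[H, K]\<close> denote closed subgroups.\<close>

definition closed_square_subgroup ::
    "('a, 'm) monoid_scheme \<Rightarrow> 'a topology \<Rightarrow> 'a set \<Rightarrow> 'a set" where
  "closed_square_subgroup G T H = closed_subgroup_generated G T {h [^]\<^bsub>G\<^esub> (2::nat) | h. h \<in> H}"

definition closed_commutator_subgroup ::
    "('a, 'm) monoid_scheme \<Rightarrow> 'a topology \<Rightarrow> 'a set \<Rightarrow> 'a set \<Rightarrow> 'a set" where
  "closed_commutator_subgroup G T H K =
     closed_subgroup_generated G T {commutator G h k | h k. h \<in> H \<and> k \<in> K}"

text \<open>\<open>(n + 1) div 2\<close> is \<open>n / 2\<close> rounded up; the list runs over the pairs \<open>(i, n - i)\<close> with both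
  entries positive. The value at \<open>0\<close> is irrelevant.\<close>

function zassenhaus :: "('a, 'm) monoid_scheme \<Rightarrow> 'a topology \<Rightarrow> nat \<Rightarrow> 'a set" where
  "zassenhaus G T n =
     (if n \<le> 1 then carrier G
      else foldl (\<lambda>A B. A <#>\<^bsub>G\<^esub> B)
             (closed_square_subgroup G T (zassenhaus G T ((n + 1) div 2)))
             (map (\<lambda>i. closed_commutator_subgroup G T (zassenhaus G T i) (zassenhaus G T (n - i)))
                  [1..<n]))"
  by pat_completeness auto
termination
  by (relation "Wellfounded.measure (\<lambda>(G, T, n). n)") auto

declare zassenhaus.simps [simp del]

section \<open>Canonical decomposition modulo the fourth term\<close>

text \<open>Finite products are taken in increasing order with respect to a strict linear order \<open>L\<close>;
  a possibly infinite product is the limit of the net of its finite subproducts.\<close>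

definition ordered_finite_product ::
    "('a, 'm) monoid_scheme \<Rightarrow> ('j \<times> 'j) set \<Rightarrow> ('j \<Rightarrow> 'a) \<Rightarrow> 'j set \<Rightarrow> 'a" where
  "ordered_finite_product G L f F =
     foldr (\<lambda>j z. f j \<otimes>\<^bsub>G\<^esub> z)
       (THE js. set js = F \<and> sorted_wrt (\<lambda>u v. (u, v) \<in> L) js) \<one>\<^bsub>G\<^esub>"

definition has_ordered_product ::
    "('a, 'm) monoid_scheme \<Rightarrow> 'a topology \<Rightarrow> ('j \<times> 'j) set \<Rightarrow> ('j \<Rightarrow> 'a) \<Rightarrow> 'j set \<Rightarrow> 'a \<Rightarrow> bool" where
  "has_ordered_product G T L f A z \<longleftrightarrow>
     limitin T (ordered_finite_product G L f) z (finite_subsets_at_top A)"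

abbreviation less_rel :: "('i::ord \<times> 'i) set" where
  "less_rel \<equiv> {(i, j). i < j}"

text \<open>The exponents \<open>b i j\<close> and \<open>c i j k\<close> are meaningful only for \<open>i < j\<close> and for \<open>i < j\<close>, \<open>k \<le> j\<close>
  respectively. Index pairs and triples are ordered lexicographically.\<close>

definition canonical_decomposition ::
    "('s, 'm) monoid_scheme \<Rightarrow> 's topology \<Rightarrow> ('i::wellorder \<Rightarrow> 's) \<Rightarrow> 's \<Rightarrow>
     ('i \<Rightarrow> nat) \<Rightarrow> ('i \<Rightarrow> 'i \<Rightarrow> nat) \<Rightarrow> ('i \<Rightarrow> 'i \<Rightarrow> 'i \<Rightarrow> nat) \<Rightarrow> bool" where
  "canonical_decomposition S T x r a b c \<longleftrightarrow>
     (\<forall>i. a i \<in> {0, 1}) \<and>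
     (\<forall>i j. i < j \<longrightarrow> b i j \<in> {0, 1}) \<and>
     (\<forall>i j k. i < j \<and> k \<le> j \<longrightarrow> c i j k \<in> {0, 1}) \<and>
     (\<exists>z1 z2 z3 r'.
        has_ordered_product S T less_rel
          (\<lambda>i. x i [^]\<^bsub>S\<^esub> (2 * a i)) UNIV z1 \<and>
        has_ordered_product S T (less_rel <*lex*> less_rel)
          (\<lambda>(i, j). commutator S (x i) (x j) [^]\<^bsub>S\<^esub> b i j) {(i, j). i < j} z2 \<and>
        has_ordered_product S T (less_rel <*lex*> less_rel <*lex*> less_rel)
          (\<lambda>(i, j, k). commutator S (commutator S (x i) (x j)) (x k) [^]\<^bsub>S\<^esub> c i j k)
          {(i, j, k). i < j \<and> k \<le> j} z3 \<and>
        r' \<in> zassenhaus S T 4 \<and>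
        r = z1 \<otimes>\<^bsub>S\<^esub> z2 \<otimes>\<^bsub>S\<^esub> z3 \<otimes>\<^bsub>S\<^esub> r')"

definition sym_exponent :: "('i::linorder \<Rightarrow> 'i \<Rightarrow> nat) \<Rightarrow> 'i \<Rightarrow> 'i \<Rightarrow> nat" where
  "sym_exponent b i j = (if i < j then b i j else b j i)"

section \<open>The absolute Galois group\<close>

text \<open>The separable closure of the field \<open>'f\<close> inside its algebraic closure: the elements whose
  minimal polynomial over \<open>'f\<close> has only simple roots.\<close>

definition separable_closure :: "'f::field alg_closure set" where
  "separable_closure =
     {z. \<exists>p :: 'f poly. Factorial_Ring.irreducible p \<and> rsquarefree (map_poly to_ac p) \<and>
                        poly (map_poly to_ac p) z = 0}"

definition absolute_galois_group ::
    "'f::field itself \<Rightarrow> ('f alg_closure \<Rightarrow> 'f alg_closure) monoid" where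
  "absolute_galois_group _ =
     \<lparr>carrier = {\<sigma>. \<sigma> \<in> extensional separable_closure \<and>
                    bij_betw \<sigma> separable_closure separable_closure \<and>
                    (\<forall>y\<in>separable_closure. \<forall>z\<in>separable_closure.
                       \<sigma> (y + z) = \<sigma> y + \<sigma> z \<and> \<sigma> (y * z) = \<sigma> y * \<sigma> z) \<and>
                    (\<forall>c::'f. \<sigma> (to_ac c) = to_ac c)},
      monoid.mult = (\<lambda>\<sigma> \<tau>. compose separable_closure \<sigma> \<tau>),
      one = restrict (\<lambda>z. z) separable_closure\<rparr>"

text \<open>The Krull topology: a neighbourhood base of \<open>\<sigma>\<close> is given by the sets of all \<open>\<tau>\<close> that agree
  with \<open>\<sigma>\<close> on a finite subset \<open>A\<close> of the separable closure, i.e. by the cosets of the subgroups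
  fixing the finite extension generated by \<open>A\<close>.\<close>

definition krull_topology :: "'f::field itself \<Rightarrow> ('f alg_closure \<Rightarrow> 'f alg_closure) topology" where
  "krull_topology F =
     subtopology
       (product_topology (\<lambda>_. discrete_topology separable_closure) separable_closure)
       (carrier (absolute_galois_group F))"

definition galois_group_maximal_pro_p ::
    "nat \<Rightarrow> 'f::field itself \<Rightarrow> ('f alg_closure \<Rightarrow> 'f alg_closure) set monoid" where
  "galois_group_maximal_pro_p p F =
     maximal_pro_p_quotient p (absolute_galois_group F) (krull_topology F)"

definition galois_group_maximal_pro_p_topology ::
    "nat \<Rightarrow> 'f::field itself \<Rightarrow> ('f alg_closure \<Rightarrow> 'f alg_closure) set topology" where
  "galois_group_maximal_pro_p_topology p F =
     maximal_pro_p_quotient_topology p (absolute_galois_group F) (krull_topology F)"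

end

theory Submission
  imports Defs
begin

text \<open>
  Let \<open>p\<close> be the index with \<open>c\<^sub>i\<^sub>j\<^sub>p \<noteq> 0\<close>, let \<open>q\<close> be the other element of \<open>{i, j}\<close>, and let \<open>\<alpha>, \<beta>\<close> be the
  characters dual to \<open>x\<^sub>p, x\<^sub>q\<close>. The hypotheses on squares and simple commutators say that
  \<open>\<alpha> \<union> \<alpha> = 0\<close> and \<open>\<alpha> \<union> \<beta> = 0\<close> in \<open>S/\<langle>R\<rangle>\<close>, while the triple commutator in \<open>r\<close> prevents the triple
  Massey product \<open>\<langle>\<alpha>, \<alpha>, \<beta>\<rangle>\<close> from vanishing. Over a field this Massey product always vanishes. In
  characteristic other than \<open>2\<close>, Hilbert 90 turns the two cup products into elements
  \<open>\<theta> \<in> F(\<surd>a)\<close> and \<open>w \<in> F(\<surd>b)\<close> with the same norm \<open>\<nu>\<^sup>2\<close>, where \<open>\<nu>\<close> is a multiple of \<open>\<surd>a\<close>. Then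
  \<open>(\<theta> + w) (\<theta> + w') = \<theta> (tr \<theta> + tr w)\<close>, so the square roots of the four conjugates of \<open>\<theta> + w\<close> have
  product \<open>\<plusminus> \<nu> (tr \<theta> + tr w)\<close>, and the Galois action on them is a homomorphism to signed
  permutations of the Klein four-group that solves the embedding problem. In characteristic \<open>2\<close>
  the four roots of \<open>y\<^sup>2 + y = a (u + k) (v + l)\<close> with \<open>k, l \<in> {0, 1}\<close> play the same role, where
  \<open>u, v\<close> are Artin-Schreier generators for \<open>\<alpha>, \<beta>\<close> and \<open>a = u\<^sup>2 + u\<close>.
\<close>

section \<open>The separable closure\<close>

text \<open>The canonical decomposition controls images only under homomorphisms killing
  \<open>zassenhaus S T 4\<close>. This holds for both test groups: \<open>heis\<close> still sees
  the square of \<open>x p\<close> and \<open>[x i, x j]\<close>, and \<open>signed_V4\<close>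
  moreover sees one triple commutator. The assumed isomorphism is crossed twice. A homomorphism from
  \<open>S\<close> to \<open>heis\<close> that kills \<open>R\<close> passes to the Galois group, is
  lifted there to \<open>signed_V4\<close>, and the lift returns to \<open>S\<close>, since a group
  of order 32 does not see the pro-2 kernel. The lift kills \<open>R\<close> by construction. Hence
  the relations other than \<open>r\<close> are tested in \<open>heis\<close> only, and
  \<open>r\<close> alone is evaluated in \<open>signed_V4\<close>. The lift is known on generators
  only up to its sign function, but the decisive triple commutator does not depend on that function.

  Signed permutations replace unitriangular matrices because they are read off directly from the
  action on roots. The field-theoretic obstacle is that the separable closure is given by
  polynomials with simple roots; that it is a field containing the required quadratic roots is
  proved by dimension counts with Frobenius.\<close>

definition ac_eval :: "'f::field poly \<Rightarrow> 'f alg_closure \<Rightarrow> 'f alg_closure" where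
  "ac_eval p z = poly (map_poly to_ac p) z"

lemma ac_eval_0 [simp]: "ac_eval 0 z = 0"
  by (simp add: ac_eval_def)

lemma ac_eval_pCons [simp]: "ac_eval (pCons a p) z = to_ac a + z * ac_eval p z"
  by (simp add: ac_eval_def map_poly_pCons)

lemma ac_eval_add [simp]: "ac_eval (p + q) z = ac_eval p z + ac_eval q z"
  by (induction p q rule: poly_induct2) (simp_all add: algebra_simps)

lemma ac_eval_smult [simp]: "ac_eval (Polynomial.smult c p) z = to_ac c * ac_eval p z"
  by (induction p) (simp_all add: algebra_simps)

lemma ac_eval_mult [simp]: "ac_eval (p * q) z = ac_eval p z * ac_eval q z"
  by (induction p) (simp_all add: algebra_simps)

lemma ac_eval_diff [simp]: "ac_eval (p - q) z = ac_eval p z - ac_eval q z"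
proof -
  have "p - q = p + Polynomial.smult (-1) q" by simp
  then show ?thesis by (simp only: ac_eval_add ac_eval_smult) simp
qed

lemma ac_eval_monom [simp]: "ac_eval (Polynomial.monom c n) z = to_ac c * z ^ n"
  by (simp add: ac_eval_def map_poly_monom poly_monom)

lemma ac_eval_pcompose [simp]: "ac_eval (pcompose p q) z = ac_eval p (ac_eval q z)"
  by (induction p) (simp_all add: pcompose_pCons)

lemma ac_eval_altdef:
  "ac_eval p z = (\<Sum>k\<le>Polynomial.degree p. to_ac (Polynomial.coeff p k) * z ^ k)"
  by (simp add: ac_eval_def poly_altdef degree_map_poly coeff_map_poly)

text \<open>A minimal polynomial up to a scalar. Without a monic normalization, the irreducible
  polynomials in the definition of \<open>separable_closure\<close> qualify directly.\<close>

definition has_min_degree :: "'f::field poly \<Rightarrow> 'f alg_closure \<Rightarrow> bool" where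
  "has_min_degree m z \<longleftrightarrow> m \<noteq> 0 \<and> ac_eval m z = 0 \<and>
     (\<forall>q. q \<noteq> 0 \<and> ac_eval q z = 0 \<longrightarrow> Polynomial.degree m \<le> Polynomial.degree q)"

lemma has_min_degreeD:
  assumes "has_min_degree m z"
  shows "m \<noteq> 0" "ac_eval m z = 0"
    "\<And>q. ac_eval q z = 0 \<Longrightarrow> Polynomial.degree q < Polynomial.degree m \<Longrightarrow> q = 0"
  using assms by (force simp: has_min_degree_def)+

lemma ex_has_min_degree: "\<exists>m. has_min_degree m z"
proof -
  obtain p where p: "p \<noteq> 0 \<and> ac_eval p z = 0"
    using alg_closure_algebraic[of z] by (metis ac_eval_def)
  from ex_has_least_nat[where P = "\<lambda>p. p \<noteq> 0 \<and> ac_eval p z = 0" and m = Polynomial.degree, OF p]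
  show ?thesis
    unfolding has_min_degree_def by blast
qed

lemma has_min_degree_dvd:
  assumes "has_min_degree m z" and "ac_eval q z = 0"
  shows "m dvd q"
proof -
  have "ac_eval (q div m * m + q mod m) z = 0"
    using assms(2) by simp
  then have "ac_eval (q mod m) z = 0"
    using has_min_degreeD(2)[OF assms(1)] by (simp only: ac_eval_add ac_eval_mult) simp
  moreover have "q mod m = 0 \<or> Polynomial.degree (q mod m) < Polynomial.degree m"
    using degree_mod_less has_min_degreeD(1)[OF assms(1)] by blast
  ultimately have "q mod m = 0"
    using has_min_degreeD(3)[OF assms(1)] by blast
  then show ?thesis by auto
qed

lemma has_min_degree_not_unit:
  assumes "has_min_degree m z"
  shows "\<not> is_unit m"
proof
  assume "is_unit m"
  then obtain k where "1 = m * k" by (auto elim: dvdE)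
  then have "ac_eval 1 z = 0"
    using has_min_degreeD(2)[OF assms] by (metis ac_eval_mult mult_zero_left)
  then show False by (simp add: ac_eval_def)
qed

lemma has_min_degree_irreducible:
  assumes m: "has_min_degree m z"
  shows "Factorial_Ring.irreducible m"
proof (rule Factorial_Ring.irreducibleI)
  fix a b assume ab: "m = a * b"
  then have nz: "a \<noteq> 0" "b \<noteq> 0" using has_min_degreeD(1)[OF m] by auto
  have "ac_eval a z = 0 \<or> ac_eval b z = 0"
    using has_min_degreeD(2)[OF m] ab by simp
  then have "Polynomial.degree m \<le> Polynomial.degree a \<or> Polynomial.degree m \<le> Polynomial.degree b"
    using m nz unfolding has_min_degree_def by blast
  then have "Polynomial.degree a = 0 \<or> Polynomial.degree b = 0"
    using nz by (auto simp: ab degree_mult_eq)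
  then show "is_unit a \<or> is_unit b"
    using nz by (auto simp: is_unit_iff_degree)
qed (use has_min_degreeD(1)[OF m] has_min_degree_not_unit[OF m] in auto)

lemma irreducible_has_min_degree:
  assumes f: "Factorial_Ring.irreducible f" and z: "ac_eval f z = 0"
  shows "has_min_degree f z"
proof -
  obtain m where m: "has_min_degree m z" using ex_has_min_degree by blast
  obtain k where k: "f = m * k" using has_min_degree_dvd[OF m z] by blast
  with f have "is_unit k" "k \<noteq> 0"
    using has_min_degree_not_unit[OF m] by (auto simp: Factorial_Ring.irreducible_def)
  then have "Polynomial.degree f = Polynomial.degree m"
    using k has_min_degreeD(1)[OF m] by (auto simp: is_unit_iff_degree degree_mult_eq)
  then show ?thesis
    using m z f unfolding has_min_degree_def by auto
qed

text \<open>A multiple root \<open>y\<close> annihilates both \<open>f\<close> and its derivative.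
  As \<open>f\<close> has minimal degree for \<open>y\<close> and the derivative has smaller degree,
  the derivative is zero.\<close>

lemma irreducible_inseparable_imp_pderiv_0:
  fixes f :: "'f::field poly"
  assumes f: "Factorial_Ring.irreducible f" and ns: "\<not> rsquarefree (map_poly to_ac f)"
  shows "pderiv f = 0"
proof -
  let ?F = "map_poly to_ac f"
  have nz: "?F \<noteq> 0" using f by (auto simp: map_poly_eq_0_iff)
  with ns obtain y where "Polynomial.order y ?F \<noteq> 0" "Polynomial.order y ?F \<noteq> 1"
    by (auto simp: rsquarefree_def)
  then have "2 \<le> Polynomial.order y ?F" by linarith
  then have "[:-y, 1:] ^ 2 dvd ?F" by (rule dvd_trans[OF le_imp_power_dvd order_1])
  then obtain k where k: "?F = [:-y, 1:] ^ 2 * k" by blast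
  have y0: "ac_eval f y = 0" by (simp add: ac_eval_def k)
  have "map_poly to_ac (pderiv f) = pderiv ?F"
    by (intro poly_eqI) (simp add: coeff_map_poly coeff_pderiv)
  also have "poly (pderiv ?F) y = 0"
    unfolding k power2_eq_square pderiv_mult by simp
  finally have "ac_eval (pderiv f) y = 0" by (simp add: ac_eval_def)
  moreover have m: "has_min_degree f y"
    by (rule irreducible_has_min_degree[OF f y0])
  moreover have d: "Polynomial.degree f \<noteq> 0"
    using has_min_degree_not_unit[OF m] has_min_degreeD(1)[OF m] by (simp add: is_unit_iff_degree)
  have "Polynomial.degree (pderiv f) \<le> Polynomial.degree f - 1"
    by (rule degree_le) (simp add: coeff_pderiv coeff_eq_0)
  with d have "Polynomial.degree (pderiv f) < Polynomial.degree f" by linarith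
  ultimately show ?thesis
    using has_min_degreeD(3) by blast
qed

text \<open>The derivative of the minimal polynomial vanishes, so in characteristic \<open>p\<close>
  only exponents divisible by \<open>p\<close> occur in it.\<close>

lemma not_separable_imp_coeff_0:
  fixes w :: "'f::field alg_closure"
  assumes "w \<notin> separable_closure" and m: "has_min_degree m w"
    and k: "Polynomial.coeff m k \<noteq> 0"
  shows "(of_nat k :: 'f) = 0"
proof (cases k)
  case (Suc l)
  have "pderiv m = 0"
  proof (rule irreducible_inseparable_imp_pderiv_0)
    show irr: "Factorial_Ring.irreducible m" by (rule has_min_degree_irreducible[OF m])
    show "\<not> rsquarefree (map_poly to_ac m)"
      using assms(1) irr has_min_degreeD(2)[OF m]
      by (auto simp: separable_closure_def ac_eval_def)
  qed
  then have "Polynomial.coeff (pderiv m) l = 0" by simp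
  then show ?thesis using k Suc by (simp add: coeff_pderiv)
qed simp

lemma separable_closure_char_0:
  assumes "CHAR('f::field) = 0"
  shows "separable_closure = (UNIV :: 'f alg_closure set)"
proof (rule ccontr)
  assume "separable_closure \<noteq> (UNIV :: 'f alg_closure set)"
  then obtain w :: "'f alg_closure" where w: "w \<notin> separable_closure" by blast
  obtain m where m: "has_min_degree m w" using ex_has_min_degree by blast
  have "(of_nat (Polynomial.degree m) :: 'f) = 0"
    by (rule not_separable_imp_coeff_0[OF w m]) (use has_min_degreeD(1)[OF m] in simp)
  then have "Polynomial.degree m = 0"
    using assms by (simp add: of_nat_eq_0_iff_char_dvd)
  then show False
    using has_min_degree_not_unit[OF m] has_min_degreeD(1)[OF m] by (simp add: is_unit_iff_degree)
qed

section \<open>Linear algebra over the base field: powers of an element and finitely generated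
  algebras\<close>

interpretation ac: vector_space "\<lambda>(c::'f::field) (z::'f alg_closure). to_ac c * z"
  by unfold_locales (simp_all add: algebra_simps)

lemma span_powers_subset:
  fixes z :: "'f::field alg_closure"
  shows "ac.span ((\<lambda>l. z ^ l) ` {..<k}) \<subseteq> {ac_eval q z | q. q = 0 \<or> Polynomial.degree q < k}"
proof (rule ac.span_minimal)
  show "(\<lambda>l. z ^ l) ` {..<k} \<subseteq> {ac_eval q z | q. q = 0 \<or> Polynomial.degree q < k}"
  proof safe
    fix l assume "l < k"
    then show "\<exists>q. z ^ l = ac_eval q z \<and> (q = 0 \<or> Polynomial.degree q < k)"
      by (intro exI[of _ "Polynomial.monom 1 l"]) (auto simp: degree_monom_eq)
  qed
  show "ac.subspace {ac_eval q z | q. q = 0 \<or> Polynomial.degree q < k}"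
  proof (rule ac.subspaceI)
    show "0 \<in> {ac_eval q z | q. q = 0 \<or> Polynomial.degree q < k}"
      by (rule CollectI, rule exI[of _ 0]) simp
  next
    fix x y assume "x \<in> {ac_eval q z | q. q = 0 \<or> Polynomial.degree q < k}"
      and "y \<in> {ac_eval q z | q. q = 0 \<or> Polynomial.degree q < k}"
    then obtain p q where "x = ac_eval p z" "y = ac_eval q z"
      "p = 0 \<or> Polynomial.degree p < k" "q = 0 \<or> Polynomial.degree q < k" by blast
    then show "x + y \<in> {ac_eval q z | q. q = 0 \<or> Polynomial.degree q < k}"
      by (intro CollectI exI[of _ "p + q"]) (auto simp: degree_add_less)
  next
    fix c x assume "x \<in> {ac_eval q z | q. q = 0 \<or> Polynomial.degree q < k}"
    then obtain p where "x = ac_eval p z" "p = 0 \<or> Polynomial.degree p < k" by blast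
    then show "to_ac c * x \<in> {ac_eval q z | q. q = 0 \<or> Polynomial.degree q < k}"
      by (intro CollectI exI[of _ "Polynomial.smult c p"]) (auto simp: le_less_trans[OF degree_smult_le])
  qed
qed

lemma power_notin_span_powers:
  fixes z :: "'f::field alg_closure"
  assumes "\<And>q. q \<noteq> 0 \<Longrightarrow> ac_eval q z = 0 \<Longrightarrow> k < Polynomial.degree q"
  shows "z ^ k \<notin> ac.span ((\<lambda>l. z ^ l) ` {..<k})"
proof
  assume "z ^ k \<in> ac.span ((\<lambda>l. z ^ l) ` {..<k})"
  then obtain q where q: "z ^ k = ac_eval q z" "q = 0 \<or> Polynomial.degree q < k"
    using span_powers_subset by blast
  let ?d = "Polynomial.monom 1 k - q"
  have c: "Polynomial.coeff ?d k = 1" using q(2) by (auto simp: coeff_eq_0)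
  have "Polynomial.degree ?d \<le> k"
    using q(2) by (intro degree_diff_le) (auto simp: degree_monom_eq)
  moreover have "?d \<noteq> 0" using c by (metis coeff_0 zero_neq_one)
  moreover have "ac_eval ?d z = 0" using q(1) by simp
  ultimately show False using assms[of ?d] by simp
qed

text \<open>Independence concerns the set of powers; the cardinality conjunct adds that these powers
  are pairwise distinct.\<close>

lemma independent_powers:
  fixes z :: "'f::field alg_closure"
  assumes "\<And>q. q \<noteq> 0 \<Longrightarrow> ac_eval q z = 0 \<Longrightarrow> n \<le> Polynomial.degree q"
  shows "ac.independent ((\<lambda>l. z ^ l) ` {..<n}) \<and> card ((\<lambda>l. z ^ l) ` {..<n}) = n"
  using assms
proof (induction n)
  case (Suc n)
  have nin: "z ^ n \<notin> ac.span ((\<lambda>l. z ^ l) ` {..<n})"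
    by (rule power_notin_span_powers) (use Suc.prems Suc_le_eq in blast)
  then have "z ^ n \<notin> (\<lambda>l. z ^ l) ` {..<n}" by (rule contrapos_nn) (rule ac.span_base)
  moreover have "ac.independent ((\<lambda>l. z ^ l) ` {..<n}) \<and> card ((\<lambda>l. z ^ l) ` {..<n}) = n"
    by (rule Suc.IH) (use Suc.prems Suc_leD in blast)
  ultimately show ?case
    using ac.independent_insertI[OF nin] by (simp add: lessThan_Suc)
qed (simp add: ac.independent_empty)

lemma power_in_span_powers:
  fixes z :: "'f::field alg_closure"
  assumes m: "has_min_degree m z"
  shows "z ^ k \<in> ac.span ((\<lambda>l. z ^ l) ` {..<Polynomial.degree m})"
proof (induction k rule: less_induct)
  case (less k)
  let ?n = "Polynomial.degree m" and ?c = "Polynomial.coeff m"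
  show ?case
  proof (cases "k < ?n")
    case False
    have lc: "?c ?n \<noteq> 0" using has_min_degreeD(1)[OF m] by simp
    have "(\<Sum>l<?n. to_ac (?c l) * z ^ l) + to_ac (?c ?n) * z ^ ?n = 0"
      using has_min_degreeD(2)[OF m] by (simp add: ac_eval_altdef lessThan_Suc_atMost[symmetric])
    then have "z ^ ?n = - (inverse (to_ac (?c ?n)) * (\<Sum>l<?n. to_ac (?c l) * z ^ l))"
      using lc by (simp add: field_simps eq_neg_iff_add_eq_0 add.commute)
    also have "\<dots> = (\<Sum>l<?n. to_ac (- ?c l / ?c ?n) * z ^ l)"
      by (simp add: sum_distrib_left sum_negf field_simps)
    finally have "z ^ k = (\<Sum>l<?n. to_ac (- ?c l / ?c ?n) * z ^ l) * z ^ (k - ?n)"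
      using False by (metis le_add_diff_inverse not_less power_add)
    also have "\<dots> = (\<Sum>l<?n. to_ac (- ?c l / ?c ?n) * z ^ (l + (k - ?n)))"
      by (simp add: sum_distrib_right power_add mult.assoc del: to_ac_divide to_ac_minus)
    also have "\<dots> \<in> ac.span ((\<lambda>l. z ^ l) ` {..<?n})"
      by (intro ac.span_sum ac.span_scale less.IH) (use False in auto)
    finally show ?thesis .
  qed (auto intro: ac.span_base)
qed

text \<open>The algebra generated over the base field. All its elements are algebraic, so inverses
  come for free, see \<open>inverse_in_ac_adjoin\<close>.\<close>

inductive_set ac_adjoin :: "'f::field alg_closure set \<Rightarrow> 'f alg_closure set" for G where
  const: "to_ac c \<in> ac_adjoin G"
| gen: "g \<in> G \<Longrightarrow> g \<in> ac_adjoin G"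
| add: "u \<in> ac_adjoin G \<Longrightarrow> v \<in> ac_adjoin G \<Longrightarrow> u + v \<in> ac_adjoin G"
| mult: "u \<in> ac_adjoin G \<Longrightarrow> v \<in> ac_adjoin G \<Longrightarrow> u * v \<in> ac_adjoin G"

lemma ac_adjoin_0: "0 \<in> ac_adjoin G" and ac_adjoin_1: "1 \<in> ac_adjoin G"
  using ac_adjoin.const[of 0 G] ac_adjoin.const[of 1 G] by simp_all

lemma ac_adjoin_minus: "u \<in> ac_adjoin G \<Longrightarrow> - u \<in> ac_adjoin G"
  using ac_adjoin.mult[OF ac_adjoin.const[of "-1"], of u G] by simp

lemma ac_adjoin_power: "u \<in> ac_adjoin G \<Longrightarrow> u ^ n \<in> ac_adjoin G"
  by (induction n) (auto intro: ac_adjoin_1 ac_adjoin.mult)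

lemma ac_adjoin_subset: 
  assumes "G \<subseteq> ac_adjoin H" shows "ac_adjoin G \<subseteq> ac_adjoin H"
proof
  fix u assume "u \<in> ac_adjoin G"
  then show "u \<in> ac_adjoin H"
    by induction (use assms in \<open>auto intro: ac_adjoin.intros\<close>)
qed

lemma ac_adjoin_mono: "G \<subseteq> H \<Longrightarrow> ac_adjoin G \<subseteq> ac_adjoin H"
  by (rule ac_adjoin_subset) (auto intro: ac_adjoin.gen)

lemma ac_eval_in_ac_adjoin: "z \<in> ac_adjoin G \<Longrightarrow> ac_eval q z \<in> ac_adjoin G"
  by (induction q) (auto intro: ac_adjoin.intros ac_adjoin_0)

lemma subspace_ac_adjoin: "ac.subspace (ac_adjoin G)"
  by (intro ac.subspaceI) (auto intro: ac_adjoin.const ac_adjoin.add ac_adjoin.mult ac_adjoin_0)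

lemma inverse_in_ac_adjoin: "inverse z \<in> ac_adjoin {z}"
proof (cases "z = 0")
  case False
  obtain m where m: "has_min_degree m z" using ex_has_min_degree by blast
  obtain c q where q: "m = pCons c q" by (cases m)
  have eq: "to_ac c + z * ac_eval q z = 0"
    using has_min_degreeD(2)[OF m] q by simp
  have "c \<noteq> 0"
  proof
    assume "c = 0"
    with eq False have "ac_eval q z = 0" by simp
    moreover have q0: "q \<noteq> 0"
    proof
      assume "q = 0"
      with q \<open>c = 0\<close> have "m = 0" by (simp only: pCons_0_0)
      with has_min_degreeD(1)[OF m] show False by contradiction
    qed
    then have "Polynomial.degree q < Polynomial.degree m"
      using degree_pCons_eq[OF q0, of c] unfolding q by linarith
    ultimately show False
      using has_min_degreeD(3)[OF m] q0 by blast
  qed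
  then have "inverse z = to_ac (- inverse c) * ac_eval q z"
    using eq False by (simp add: field_simps eq_neg_iff_add_eq_0)
  also have "\<dots> \<in> ac_adjoin {z}"
    by (intro ac_adjoin.mult ac_adjoin.const ac_eval_in_ac_adjoin ac_adjoin.gen) simp
  finally show ?thesis .
qed (simp add: ac_adjoin_0)

text \<open>It suffices to find a finite set containing 1 whose span is stable under each generator.
  Given such a \<open>B\<close>, a new generator \<open>g\<close> is absorbed by the products
  \<open>b * g ^ k\<close> with \<open>k\<close> below the degree of \<open>g\<close>.\<close>

lemma ac_adjoin_finite_dim:
  fixes G :: "'f::field alg_closure set"
  assumes "finite G"
  shows "\<exists>B. finite B \<and> ac_adjoin G \<subseteq> ac.span B"
proof -
  have "\<exists>B. finite B \<and> 1 \<in> B \<and> (\<forall>g\<in>G. \<forall>b\<in>B. g * b \<in> ac.span B)"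
    using assms
  proof (induction G)
    case empty
    then show ?case by (intro exI[of _ "{1}"]) auto
  next
    case (insert g G)
    then obtain B where B: "finite B" "1 \<in> B" "\<And>h b. h \<in> G \<Longrightarrow> b \<in> B \<Longrightarrow> h * b \<in> ac.span B"
      by blast
    obtain m where m: "has_min_degree m g" using ex_has_min_degree by blast
    let ?n = "Polynomial.degree m"
    let ?C = "(\<lambda>(b, k). b * g ^ k) ` (B \<times> {..<?n})"
    have n: "0 < ?n"
      using has_min_degree_not_unit[OF m] has_min_degreeD(1)[OF m] by (simp add: is_unit_iff_degree)
    have lin: "b * u \<in> ac.span (((*) b) ` V)" if "u \<in> ac.span V"
      for b u :: "'f alg_closure" and V
      using that
    proof (induction rule: ac.span_induct_alt)
      case (step c x y)
      then show ?case
        by (simp add: distrib_left mult.left_commute[of b]) (intro ac.span_add ac.span_scale ac.span_base[of "b * x"], auto)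
    qed (simp add: ac.span_zero)
    have "h * (b * g ^ k) \<in> ac.span ?C" if "h \<in> insert g G" "b \<in> B" "k < ?n" for h b k
    proof (cases "h = g")
      case True
      have "b * g ^ Suc k \<in> ac.span (((*) b) ` ((\<lambda>l. g ^ l) ` {..<?n}))"
        by (rule lin[OF power_in_span_powers[OF m]])
      also have "\<dots> \<subseteq> ac.span ?C" by (rule ac.span_mono) (use that in auto)
      finally show ?thesis using True by (simp add: mult_ac)
    next
      case False
      then have "h * b \<in> ac.span B" using that B(3) by blast
      then have "g ^ k * (h * b) \<in> ac.span (((*) (g ^ k)) ` B)" by (rule lin)
      also have "\<dots> \<subseteq> ac.span ?C"
      proof (rule ac.span_mono, safe)
        fix b' assume "b' \<in> B"
        then show "g ^ k * b' \<in> ?C"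
          using that(3) by (intro image_eqI[of _ _ "(b', k)"]) auto
      qed
      finally show ?thesis by (simp add: mult_ac)
    qed
    moreover have "1 \<in> ?C"
      using n B(2) by (intro image_eqI[of _ _ "(1, 0)"]) auto
    ultimately show ?case
      using B(1) by (intro exI[of _ ?C]) auto
  qed
  then obtain B where B: "finite B" "1 \<in> B" "\<And>g b. g \<in> G \<Longrightarrow> b \<in> B \<Longrightarrow> g * b \<in> ac.span B"
    by blast
  have gen: "g * v \<in> ac.span B" if "g \<in> G" "v \<in> ac.span B" for g v
    using that(2)
  proof (induction rule: ac.span_induct_alt)
    case (step c x y)
    then show ?case
      using B(3)[OF that(1)]
      by (simp add: distrib_left mult.left_commute[of g]) (intro ac.span_add ac.span_scale, auto)
  qed (simp add: ac.span_zero)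
  have "\<forall>v\<in>ac.span B. u * v \<in> ac.span B" if "u \<in> ac_adjoin G" for u
    using that
  proof induction
    case (mult u v)
    then show ?case by (simp add: mult.assoc)
  qed (auto intro: gen ac.span_scale ac.span_add simp: distrib_right)
  from this[THEN bspec[of _ _ 1]] show ?thesis
    using B(1,2) by (intro exI[of _ B]) (auto intro: ac.span_base)
qed

lemma CHAR_prime_field: "CHAR('f::field) > 0 \<Longrightarrow> Factorial_Ring.prime (CHAR('f))"
  by (rule prime_CHAR_semidom)

text \<open>If every generator lies in the algebra generated by the \<open>p\<close>-th powers, then the \<open>p\<close>-th powers
  of a basis are again a basis, which excludes a relation of the form \<open>\<Sum> a\<^sub>k (w\<^sup>k)\<^sup>p = 0\<close> of
  degree less than that of \<open>w\<close>.\<close>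

lemma ac_adjoin_subset_separable_closure:
  fixes G :: "'f::field alg_closure set"
  assumes p: "p = CHAR('f)" "p > 0" and G: "finite G"
    and gen: "G \<subseteq> ac_adjoin ((\<lambda>g. g ^ p) ` G)"
  shows "ac_adjoin G \<subseteq> separable_closure"
proof
  fix w assume w: "w \<in> ac_adjoin G"
  have add_pow: "(u + v) ^ p = u ^ p + v ^ p" for u v :: "'f alg_closure"
    by (rule freshmans_dream) (use p CHAR_prime_field[where 'f = 'f] in auto)
  \<comment> \<open>Frobenius is additive and sends scalars to scalars, so it maps the span of
    \<open>B\<close> into the span of the \<open>p\<close>-th powers of \<open>B\<close>.\<close>
  have sum_pow: "u ^ p \<in> ac.span ((\<lambda>b. b ^ p) ` B)" if "u \<in> ac.span B" for u :: "'f alg_closure" and B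
    using that
  proof (induction rule: ac.span_induct_alt)
    case base
    then show ?case using p(2) by (simp add: ac.span_zero zero_power)
  next
    case (step c x y)
    have "(to_ac c * x + y) ^ p = to_ac (c ^ p) * x ^ p + y ^ p"
      by (simp add: add_pow power_mult_distrib)
    then show ?case
      using step by (simp only:) (intro ac.span_add ac.span_scale ac.span_base[of "x ^ p"], auto)
  qed
  \<comment> \<open>Products of \<open>p\<close>-th powers are again \<open>p\<close>-th powers, so
    the linear span already contains the generated algebra.\<close>
  have pp: "ac_adjoin ((\<lambda>g. g ^ p) ` G) \<subseteq> ac.span ((\<lambda>u. u ^ p) ` ac_adjoin G)" (is "_ \<subseteq> ac.span ?P")
  proof
    fix u assume "u \<in> ac_adjoin ((\<lambda>g. g ^ p) ` G)"
    then show "u \<in> ac.span ?P"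
    proof induction
      case (const c)
      have "1 ^ p \<in> ac.span ?P" by (intro ac.span_base imageI ac_adjoin_1)
      from ac.span_scale[OF this, of c] show ?case by simp
    next
      case (gen g)
      then show ?case by (auto intro: ac.span_base ac_adjoin.gen)
    next
      case (mult u v)
      have 1: "x ^ p * v \<in> ac.span ?P" if "x \<in> ac_adjoin G" for x
        using mult.IH(2)
      proof (induction rule: ac.span_induct_alt)
        case (step c y v)
        have "x ^ p * (to_ac c * y + v) = to_ac c * (x ^ p * y) + x ^ p * v"
          by (simp add: algebra_simps)
        moreover have "x ^ p * y \<in> ?P"
          using step(1) that by (auto simp flip: power_mult_distrib intro: ac_adjoin.mult)
        ultimately show ?case
          using step(2) by (simp only:) (intro ac.span_add ac.span_scale ac.span_base[of "x ^ p * y"])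
      qed (simp add: ac.span_zero)
      show ?case
        using mult.IH(1)
      proof (induction rule: ac.span_induct_alt)
        case (step c x y)
        then show ?case
          by (auto simp: distrib_right mult.assoc intro!: ac.span_add ac.span_scale 1)
      qed (simp add: ac.span_zero)
    qed (auto intro: ac.span_add)
  qed
  show "w \<in> separable_closure"
  proof (rule ccontr)
    assume ns: "w \<notin> separable_closure"
    obtain m where m: "has_min_degree m w" using ex_has_min_degree by blast
    let ?n = "Polynomial.degree m" and ?c = "Polynomial.coeff m"
    have dv: "p dvd k" if "?c k \<noteq> 0" for k
      using not_separable_imp_coeff_0[OF ns m that] by (simp add: of_nat_eq_0_iff_char_dvd p)
    have lc: "?c ?n \<noteq> 0" using has_min_degreeD(1)[OF m] by simp
    obtain d where d: "?n = p * d" using dv[OF lc] by blast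
    have n0: "0 < ?n"
      using has_min_degree_not_unit[OF m] has_min_degreeD(1)[OF m] by (simp add: is_unit_iff_degree)
    have "p > 1" using prime_gt_1_nat[OF CHAR_prime_field[where 'f = 'f]] p by simp
    then have dn: "d < ?n" using n0 d by auto
    have min: "k < Polynomial.degree q" if "q \<noteq> 0" "ac_eval q w = 0" "k < ?n" for q k
      using m that unfolding has_min_degree_def by force
    \<comment> \<open>Inseparability gives degree \<open>p * d\<close> with \<open>d\<close> smaller
      than the degree, so the powers up to \<open>w ^ d\<close> are still independent and extend to
      a basis \<open>B\<close>.\<close>
    have ind: "ac.independent ((\<lambda>l. w ^ l) ` {..<Suc d})"
      using independent_powers[of w "Suc d"] min dn by (auto simp: Suc_le_eq)
    have "w ^ d \<notin> ac.span ((\<lambda>l. w ^ l) ` {..<d})"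
      by (rule power_notin_span_powers) (use min dn in blast)
    then have wd: "w ^ d \<notin> (\<lambda>l. w ^ l) ` {..<d}" by (rule contrapos_nn) (rule ac.span_base)
    have "(\<lambda>l. w ^ l) ` {..<Suc d} \<subseteq> ac_adjoin G"
      using w by (auto intro: ac_adjoin_power)
    then obtain B where B: "(\<lambda>l. w ^ l) ` {..<Suc d} \<subseteq> B" "B \<subseteq> ac_adjoin G"
      "ac.independent B" "ac_adjoin G \<subseteq> ac.span B"
      using ac.maximal_independent_subset_extend[OF _ ind] by blast
    obtain C where "finite C" "ac_adjoin G \<subseteq> ac.span C"
      using ac_adjoin_finite_dim[OF G] by blast
    then have fB: "finite B"
      using ac.independent_span_bound[of C B] B(2,3) by blast
    \<comment> \<open>Since \<open>m\<close> is a polynomial in the \<open>p\<close>-th power,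
      \<open>ac_eval m w = 0\<close> expresses \<open>(w ^ d) ^ p\<close> through
      \<open>p\<close>-th powers of lower powers of \<open>w\<close>. So \<open>?D\<close>, with
      fewer elements than \<open>B\<close>, still spans everything.\<close>
    let ?D = "(\<lambda>b. b ^ p) ` (B - {w ^ d})"
    have "ac_eval m w = (\<Sum>k\<le>d. to_ac (?c (p * k)) * (w ^ k) ^ p)"
    proof -
      have "ac_eval m w = (\<Sum>k\<in>{..?n}. to_ac (?c k) * w ^ k)" by (rule ac_eval_altdef)
      also have "\<dots> = (\<Sum>k\<in>(\<lambda>k. p * k) ` {..d}. to_ac (?c k) * w ^ k)"
      proof (rule sum.mono_neutral_right)
        show "\<forall>k\<in>{..?n} - (\<lambda>k. p * k) ` {..d}. to_ac (?c k) * w ^ k = 0"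
        proof
          fix k assume k: "k \<in> {..?n} - (\<lambda>k. p * k) ` {..d}"
          have "\<not> p dvd k"
          proof
            assume "p dvd k"
            then obtain l where "k = p * l" by blast
            with k d p(2) show False by auto
          qed
          then show "to_ac (?c k) * w ^ k = 0" using dv[of k] by auto
        qed
      qed (use d in auto)
      also have "\<dots> = (\<Sum>k\<le>d. to_ac (?c (p * k)) * w ^ (p * k))"
        by (subst sum.reindex) (use p(2) in \<open>auto simp: inj_on_def\<close>)
      finally show ?thesis by (simp add: power_mult[symmetric] mult.commute)
    qed
    then have eq: "(\<Sum>k<d. to_ac (?c (p * k)) * (w ^ k) ^ p) + to_ac (?c ?n) * (w ^ d) ^ p = 0"
      using has_min_degreeD(2)[OF m] d by (simp add: lessThan_Suc_atMost[symmetric])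
    let ?s = "\<Sum>k<d. to_ac (?c (p * k)) * (w ^ k) ^ p"
    have wd': "w ^ k \<noteq> w ^ d" if "k < d" for k
      using wd that by (metis image_eqI lessThan_iff)
    have "?s \<in> ac.span ?D"
      by (intro ac.span_sum ac.span_scale ac.span_base imageI) (use B(1) wd' in \<open>auto simp: lessThan_Suc\<close>)
    then have "to_ac (- inverse (?c ?n)) * ?s \<in> ac.span ?D" by (rule ac.span_scale)
    moreover have "to_ac (- inverse (?c ?n)) * ?s = (w ^ d) ^ p"
    proof -
      have "?s = - (to_ac (?c ?n) * (w ^ d) ^ p)" using eq by (simp only: eq_neg_iff_add_eq_0)
      then show ?thesis using lc by simp
    qed
    ultimately have "(w ^ d) ^ p \<in> ac.span ?D" by simp
    then have BD: "(\<lambda>b. b ^ p) ` B \<subseteq> ac.span ?D"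
      by (auto intro: ac.span_base)
    have "B \<subseteq> ac.span ?D"
    proof -
      have "B \<subseteq> ac.span ?P"
        using B(2) ac_adjoin_subset[OF gen] pp by blast
      also have "\<dots> \<subseteq> ac.span ((\<lambda>b. b ^ p) ` B)"
        by (rule ac.span_minimal) (use sum_pow B(4) in auto)
      also have "\<dots> \<subseteq> ac.span ?D"
        by (rule ac.span_minimal[OF BD ac.subspace_span])
      finally show ?thesis .
    qed
    then have "card B \<le> card ?D"
      using ac.independent_span_bound[of ?D B] B(3) fB by blast
    also have "\<dots> \<le> card (B - {w ^ d})" using fB by (intro card_image_le) auto
    also have "\<dots> < card B"
      using fB B(1) by (intro card_Diff1_less) auto
    finally show False by simp
  qed
qed

lemma rsquarefree_card_roots:
  fixes P :: "'a::alg_closed_field poly"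
  assumes "rsquarefree P"
  shows "card {y. poly P y = 0} = Polynomial.degree P"
proof -
  have nz: "P \<noteq> 0" using assms by (simp add: rsquarefree_def)
  obtain A where A: "size A = Polynomial.degree P"
    "P = Polynomial.smult (Polynomial.lead_coeff P) (\<Prod>x\<in>#A. [:-x, 1:])"
    using alg_closed_imp_factorization[OF nz] by blast
  have "proots P = proots (\<Prod>x\<in>#A. [:-x, 1:])"
    using nz by (subst A(2), subst proots_smult) auto
  also have "\<dots> = A"
  proof (induction A)
    case (add x A)
    have "(\<Prod>x\<in>#A. [:-x, 1:]) \<noteq> 0" by (auto simp: prod_mset_zero_iff)
    then have "proots ([:-x, 1:] * (\<Prod>x\<in>#A. [:-x, 1:])) = add_mset x A"
      by (subst proots_mult) (auto simp: add)
    then show ?case by simp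
  qed simp
  finally have PA: "proots P = A" .
  have "proots P = mset_set {y. poly P y = 0}"
    using nz poly_roots_finite[OF nz] rsquarefree_root_order[OF assms _ nz]
    by (intro multiset_eqI) (auto simp: count_mset_set' order_0I)
  then show ?thesis using A(1) PA by simp
qed

text \<open>If \<open>q\<close> annihilates \<open>z ^ p\<close>, then the minimal polynomial
  \<open>f\<close> of \<open>z\<close> divides \<open>q\<close> composed with the
  \<open>p\<close>-th power, so \<open>q\<close> vanishes at the \<open>p\<close>-th powers of all
  roots of \<open>f\<close>. These are distinct, because \<open>f\<close> has simple roots and
  Frobenius is injective. Hence \<open>z ^ p\<close> has degree at least that of \<open>z\<close>,
  and its powers fill the space spanned by the powers of \<open>z\<close>.\<close>

lemma separable_closure_imp_in_ac_adjoin_power: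
  fixes z :: "'f::field alg_closure"
  assumes p: "p = CHAR('f)" "p > 0" and z: "z \<in> separable_closure"
  shows "z \<in> ac_adjoin {z ^ p}"
proof -
  obtain f where f: "Factorial_Ring.irreducible f" "rsquarefree (map_poly to_ac f)" "ac_eval f z = 0"
    using z by (auto simp: separable_closure_def ac_eval_def)
  have m: "has_min_degree f z" by (rule irreducible_has_min_degree[OF f(1,3)])
  let ?n = "Polynomial.degree f"
  have inj: "u = v" if "u ^ p = v ^ p" for u v :: "'f alg_closure"
  proof -
    have "v ^ p + (u - v) ^ p = (v + (u - v)) ^ p"
      by (rule freshmans_dream[symmetric]) (use p CHAR_prime_field[where 'f = 'f] in auto)
    then show ?thesis using that by simp
  qed
  have min: "?n \<le> Polynomial.degree q" if q: "q \<noteq> 0" "ac_eval q (z ^ p) = 0" for q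
  proof -
    have "ac_eval (pcompose q (Polynomial.monom 1 p)) z = 0" using q(2) by simp
    then obtain k where k: "pcompose q (Polynomial.monom 1 p) = f * k"
      using has_min_degree_dvd[OF m] by blast
    have "ac_eval q (y ^ p) = 0" if "ac_eval f y = 0" for y
      using arg_cong[OF k, of "\<lambda>h. ac_eval h y"] that by simp
    then have "(\<lambda>y. y ^ p) ` {y. poly (map_poly to_ac f) y = 0} \<subseteq> {y. poly (map_poly to_ac q) y = 0}"
      by (auto simp: ac_eval_def)
    then have "card ((\<lambda>y. y ^ p) ` {y. poly (map_poly to_ac f) y = 0})
        \<le> card {y. poly (map_poly to_ac q) y = 0}"
      using q(1) by (intro card_mono poly_roots_finite) (auto simp: map_poly_eq_0_iff)
    also have "\<dots> \<le> Polynomial.degree (map_poly to_ac q)"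
      using q(1) by (intro card_poly_roots_bound) (auto simp: map_poly_eq_0_iff)
    finally show ?thesis
      using inj by (simp add: card_image inj_on_def rsquarefree_card_roots[OF f(2)] degree_map_poly)
  qed
  let ?P = "(\<lambda>l. (z ^ p) ^ l) ` {..<?n}"
  have ind: "ac.independent ?P" "card ?P = ?n"
    using independent_powers[of "z ^ p" ?n] min by auto
  have "z \<in> ac.span ?P"
  proof (rule ccontr)
    assume nin: "z \<notin> ac.span ?P"
    then have "ac.independent (insert z ?P)" using ind(1) ac.independent_insertI by blast
    moreover have "insert z ?P \<subseteq> ac.span ((\<lambda>l. z ^ l) ` {..<?n})"
      using power_in_span_powers[OF m] power_in_span_powers[OF m, of 1]
      by (auto simp flip: power_mult)
    ultimately have "card (insert z ?P) \<le> card ((\<lambda>l. z ^ l) ` {..<?n})"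
      using ac.independent_span_bound by blast
    also have "\<dots> \<le> ?n" using card_image_le[of "{..<?n}" "\<lambda>l. z ^ l"] by simp
    finally show False
      using ind(2) ac.span_base[of z ?P] nin by (subst (asm) card_insert_disjoint) auto
  qed
  also have "\<dots> \<subseteq> ac_adjoin {z ^ p}"
    by (rule ac.span_minimal[OF _ subspace_ac_adjoin]) (auto intro: ac_adjoin_power ac_adjoin.gen)
  finally show ?thesis .
qed

section \<open>Closure properties of the separable closure\<close>

lemma ac_adjoin_separable:
  fixes G :: "'f::field alg_closure set"
  assumes "finite G" "G \<subseteq> separable_closure"
  shows "ac_adjoin G \<subseteq> separable_closure"
proof (cases "CHAR('f) = 0")
  case False
  define p where "p = CHAR('f)"
  have p: "p = CHAR('f)" "p > 0" using False by (auto simp: p_def)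
  show ?thesis
  proof (rule ac_adjoin_subset_separable_closure[OF p assms(1)], rule subsetI)
    fix g assume g: "g \<in> G"
    then have "g \<in> ac_adjoin {g ^ p}"
      using separable_closure_imp_in_ac_adjoin_power[OF p] assms(2) by blast
    also have "\<dots> \<subseteq> ac_adjoin ((\<lambda>g. g ^ p) ` G)"
      using g by (intro ac_adjoin_mono) auto
    finally show "g \<in> ac_adjoin ((\<lambda>g. g ^ p) ` G)" .
  qed
qed (simp add: separable_closure_char_0)

lemma separable_closure_add:
  "u \<in> separable_closure \<Longrightarrow> v \<in> separable_closure \<Longrightarrow> u + v \<in> separable_closure"
  by (rule subsetD[OF ac_adjoin_separable[of "{u, v}"]]) (auto intro: ac_adjoin.intros)

lemma separable_closure_mult:
  "u \<in> separable_closure \<Longrightarrow> v \<in> separable_closure \<Longrightarrow> u * v \<in> separable_closure"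
  by (rule subsetD[OF ac_adjoin_separable[of "{u, v}"]]) (auto intro: ac_adjoin.intros)

lemma separable_closure_to_ac: "to_ac c \<in> separable_closure"
  by (rule subsetD[OF ac_adjoin_separable[of "{}"]]) (auto intro: ac_adjoin.intros)

lemma separable_closure_minus: "u \<in> separable_closure \<Longrightarrow> - u \<in> separable_closure"
  by (rule subsetD[OF ac_adjoin_separable[of "{u}"]]) (auto intro: ac_adjoin.intros ac_adjoin_minus)

lemma separable_closure_inverse: "u \<in> separable_closure \<Longrightarrow> inverse u \<in> separable_closure"
  by (rule subsetD[OF ac_adjoin_separable[of "{u}"]]) (auto intro: inverse_in_ac_adjoin)

text \<open>Recovering \<open>y\<close> from \<open>y ^ p\<close> and separable elements puts every
  generator of the enlarged algebra into the algebra of \<open>p\<close>-th powers, which is the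
  criterion for separability.\<close>

lemma separable_closure_extend:
  fixes y :: "'f::field alg_closure"
  assumes p: "p = CHAR('f)" "p > 0" and G: "finite G" "G \<subseteq> separable_closure"
    and y: "y \<in> ac_adjoin (insert (y ^ p) G)"
  shows "y \<in> separable_closure"
proof -
  have G': "G \<subseteq> ac_adjoin ((\<lambda>g. g ^ p) ` insert y G)"
  proof
    fix g assume g: "g \<in> G"
    then have "g \<in> ac_adjoin {g ^ p}"
      using separable_closure_imp_in_ac_adjoin_power[OF p] G(2) by blast
    also have "\<dots> \<subseteq> ac_adjoin ((\<lambda>g. g ^ p) ` insert y G)"
      using g by (intro ac_adjoin_mono) auto
    finally show "g \<in> ac_adjoin ((\<lambda>g. g ^ p) ` insert y G)" .
  qed
  then have "insert (y ^ p) G \<subseteq> ac_adjoin ((\<lambda>g. g ^ p) ` insert y G)"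
    by (auto intro: ac_adjoin.gen)
  then have "y \<in> ac_adjoin ((\<lambda>g. g ^ p) ` insert y G)"
    using ac_adjoin_subset y by blast
  with G' have "ac_adjoin (insert y G) \<subseteq> separable_closure"
    by (intro ac_adjoin_subset_separable_closure[OF p]) (use G(1) in auto)
  then show ?thesis by (auto intro: ac_adjoin.gen)
qed

text \<open>For odd \<open>p = 2 * k + 1\<close> one has \<open>y ^ p = y * (y ^ 2) ^ k\<close>,
  which recovers \<open>y\<close> from \<open>y ^ p\<close> and the inverse of
  \<open>y ^ 2\<close>.\<close>

lemma separable_closure_sqrt:
  fixes y :: "'f::field alg_closure"
  assumes "CHAR('f) \<noteq> 2" and y: "y ^ 2 \<in> separable_closure"
  shows "y \<in> separable_closure"
proof (cases "CHAR('f) = 0 \<or> y = 0")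
  case True
  then show ?thesis
    using separable_closure_char_0[where 'f = 'f] separable_closure_to_ac[of 0] by auto
next
  case False
  define p where "p = CHAR('f)"
  have p: "p = CHAR('f)" "p > 0" using False by (auto simp: p_def)
  have "Factorial_Ring.prime p" using CHAR_prime_field[where 'f = 'f] p by simp
  then have "odd p" using prime_odd_nat[of p] prime_ge_2_nat[of p] p(1) assms(1) by force
  then obtain k where k: "p = 2 * k + 1" by (auto elim: oddE)
  have "y ^ p = y * (y ^ 2) ^ k" by (simp add: k power_mult)
  then have "y = y ^ p * inverse (y ^ 2) ^ k"
    using False by (simp add: power_inverse)
  also have "\<dots> \<in> ac_adjoin (insert (y ^ p) {inverse (y ^ 2)})"
    by (intro ac_adjoin.mult ac_adjoin_power[of "inverse (y ^ 2)"] ac_adjoin.gen) auto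
  finally show ?thesis
    by (rule separable_closure_extend[OF p, rotated 2]) (auto intro: separable_closure_inverse y)
qed

text \<open>Here \<open>p = 2\<close>, and \<open>y\<close> is the difference of the separable
  element \<open>y ^ 2 + y\<close> and the \<open>p\<close>-th power \<open>y ^ 2\<close>.\<close>

lemma separable_closure_artin_schreier:
  fixes y :: "'f::field alg_closure"
  assumes "CHAR('f) = 2" and y: "y ^ 2 + y \<in> separable_closure"
  shows "y \<in> separable_closure"
proof -
  have "y = (y ^ 2 + y) + - (y ^ 2)" by simp
  also have "\<dots> \<in> ac_adjoin (insert (y ^ 2) {y ^ 2 + y})"
    by (intro ac_adjoin.add[of "y ^ 2 + y"] ac_adjoin_minus ac_adjoin.gen) auto
  finally show ?thesis
    using assms by (intro separable_closure_extend[of 2 "{y ^ 2 + y}" y]) auto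
qed

section \<open>Hilbert 90 and signed permutations of roots\<close>

lemma dedekind_independence:
  fixes \<xi> :: "'i \<Rightarrow> 'b \<Rightarrow> 'a::field"
  assumes "finite I"
    and "\<And>i. i \<in> I \<Longrightarrow> \<xi> i u = 1" and "u \<in> M"
    and "\<And>m n. m \<in> M \<Longrightarrow> n \<in> M \<Longrightarrow> mul m n \<in> M"
    and "\<And>i m n. i \<in> I \<Longrightarrow> m \<in> M \<Longrightarrow> n \<in> M \<Longrightarrow> \<xi> i (mul m n) = \<xi> i m * \<xi> i n"
    and "\<And>i j. i \<in> I \<Longrightarrow> j \<in> I \<Longrightarrow> i \<noteq> j \<Longrightarrow> \<exists>m\<in>M. \<xi> i m \<noteq> \<xi> j m"
    and "\<And>m. m \<in> M \<Longrightarrow> (\<Sum>i\<in>I. c i * \<xi> i m) = 0"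
  shows "\<forall>i\<in>I. c i = 0"
  using assms
proof (induction I arbitrary: c rule: finite_induct)
  case (insert j I)
  have "c k = 0" if k: "k \<in> I" for k
  proof -
    have "k \<noteq> j" using k insert.hyps by blast
    then obtain m0 where m0: "m0 \<in> M" "\<xi> k m0 \<noteq> \<xi> j m0"
      using insert.prems(5)[of k j] k by blast
    \<comment> \<open>Subtracting \<open>\<xi> j m0\<close> times the relation at \<open>m\<close>
      from the relation at \<open>mul m0 m\<close> removes the term of \<open>j\<close>, leaving a
      relation on \<open>I\<close> whose coefficient at \<open>k\<close> has a nonzero
      factor.\<close>
    have "\<forall>i\<in>I. c i * (\<xi> i m0 - \<xi> j m0) = 0"
    proof (rule insert.IH)
      fix m assume m: "m \<in> M"
      have "(\<Sum>i\<in>insert j I. c i * \<xi> i (mul m0 m)) - \<xi> j m0 * (\<Sum>i\<in>insert j I. c i * \<xi> i m) = 0"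
        using insert.prems(6)[OF m] insert.prems(6)[OF insert.prems(3)[OF m0(1) m]] by simp
      moreover have "(\<Sum>i\<in>insert j I. c i * \<xi> i (mul m0 m)) - \<xi> j m0 * (\<Sum>i\<in>insert j I. c i * \<xi> i m)
          = (\<Sum>i\<in>insert j I. c i * (\<xi> i m0 - \<xi> j m0) * \<xi> i m)"
        unfolding sum_distrib_left sum_subtractf[symmetric]
        by (rule sum.cong) (simp_all add: insert.prems(4)[OF _ m0(1) m] algebra_simps)
      ultimately show "(\<Sum>i\<in>I. c i * (\<xi> i m0 - \<xi> j m0) * \<xi> i m) = 0"
        using insert.hyps by simp
    qed (use insert.prems(1-5) in blast)+
    then show ?thesis using k m0(2) by auto
  qed
  moreover have "c j = 0"
    using insert.prems(6)[OF insert.prems(2)] insert.hyps insert.prems(1)[of j] calculation by simp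
  ultimately show ?case by blast
qed simp

text \<open>An abstract setting for the two characteristics. Group elements are functions that
  matter only on the subfield \<open>K\<close>; finite orbits supply the finite quotients over which
  sums are taken.\<close>

locale galois_action = group G for G :: "('a::field \<Rightarrow> 'a) monoid" (structure) +
  fixes K :: "'a set"
  assumes K_one: "1 \<in> K"
    and K_add: "\<And>u v. u \<in> K \<Longrightarrow> v \<in> K \<Longrightarrow> u + v \<in> K"
    and K_mult: "\<And>u v. u \<in> K \<Longrightarrow> v \<in> K \<Longrightarrow> u * v \<in> K"
    and K_minus: "\<And>u. u \<in> K \<Longrightarrow> - u \<in> K"
    and K_inverse: "\<And>u. u \<in> K \<Longrightarrow> inverse u \<in> K"
    and act_closed: "\<And>\<sigma> u. \<sigma> \<in> carrier G \<Longrightarrow> u \<in> K \<Longrightarrow> \<sigma> u \<in> K"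
    and act_add: "\<And>\<sigma> u v. \<sigma> \<in> carrier G \<Longrightarrow> u \<in> K \<Longrightarrow> v \<in> K \<Longrightarrow> \<sigma> (u + v) = \<sigma> u + \<sigma> v"
    and act_mult: "\<And>\<sigma> u v. \<sigma> \<in> carrier G \<Longrightarrow> u \<in> K \<Longrightarrow> v \<in> K \<Longrightarrow> \<sigma> (u * v) = \<sigma> u * \<sigma> v"
    and act_comp: "\<And>\<sigma> \<tau> u. \<sigma> \<in> carrier G \<Longrightarrow> \<tau> \<in> carrier G \<Longrightarrow> u \<in> K \<Longrightarrow> (\<sigma> \<otimes> \<tau>) u = \<sigma> (\<tau> u)"
    and act_one: "\<And>u. u \<in> K \<Longrightarrow> \<one> u = u"
    and finite_orbit: "\<And>u. u \<in> K \<Longrightarrow> finite ((\<lambda>\<sigma>. \<sigma> u) ` carrier G)"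
begin

text \<open>Continuity into a discrete set in uniform form: one finite set \<open>A\<close> serves
  all pairs of group elements.\<close>

definition locally_constant :: "(('a \<Rightarrow> 'a) \<Rightarrow> 'b) \<Rightarrow> bool" where
  "locally_constant f \<longleftrightarrow> (\<exists>A. finite A \<and> A \<subseteq> K \<and>
     (\<forall>\<sigma>\<in>carrier G. \<forall>\<tau>\<in>carrier G. (\<forall>z\<in>A. \<sigma> z = \<tau> z) \<longrightarrow> f \<sigma> = f \<tau>))"

lemma locally_constant_comp: "locally_constant f \<Longrightarrow> locally_constant (\<lambda>\<sigma>. g (f \<sigma>))"
  unfolding locally_constant_def by metis

lemma locally_constant_Pair:
  assumes "locally_constant f" "locally_constant g"
  shows "locally_constant (\<lambda>\<sigma>. (f \<sigma>, g \<sigma>))"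
proof -
  obtain A where A: "finite A" "A \<subseteq> K"
    "\<And>\<sigma> \<tau>. \<sigma> \<in> carrier G \<Longrightarrow> \<tau> \<in> carrier G \<Longrightarrow> (\<forall>z\<in>A. \<sigma> z = \<tau> z) \<Longrightarrow> f \<sigma> = f \<tau>"
    using assms(1) unfolding locally_constant_def by blast
  obtain B where B: "finite B" "B \<subseteq> K"
    "\<And>\<sigma> \<tau>. \<sigma> \<in> carrier G \<Longrightarrow> \<tau> \<in> carrier G \<Longrightarrow> (\<forall>z\<in>B. \<sigma> z = \<tau> z) \<Longrightarrow> g \<sigma> = g \<tau>"
    using assms(2) unfolding locally_constant_def by blast
  show ?thesis
    unfolding locally_constant_def
  proof (intro exI[of _ "A \<union> B"] conjI ballI impI)
    fix \<sigma> \<tau> assume s: "\<sigma> \<in> carrier G" "\<tau> \<in> carrier G" "\<forall>z\<in>A \<union> B. \<sigma> z = \<tau> z"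
    then have "f \<sigma> = f \<tau>" "g \<sigma> = g \<tau>" using A(3) B(3) by (meson UnI1, meson UnI2)
    then show "(f \<sigma>, g \<sigma>) = (f \<tau>, g \<tau>)" by simp
  qed (use A(1,2) B(1,2) in auto)
qed

lemma K_zero: "0 \<in> K"
  using K_add[OF K_one K_minus[OF K_one]] by simp

lemma act_zero: "\<sigma> \<in> carrier G \<Longrightarrow> \<sigma> 0 = 0"
  using act_add[OF _ K_zero K_zero] by (metis add_0 add_cancel_left_left)

lemma act_inv_cancel: "\<sigma> \<in> carrier G \<Longrightarrow> u \<in> K \<Longrightarrow> (inv \<sigma>) (\<sigma> u) = u"
  by (metis act_comp act_one inv_closed l_inv)

lemma act_eq_0_iff: "\<sigma> \<in> carrier G \<Longrightarrow> u \<in> K \<Longrightarrow> \<sigma> u = 0 \<longleftrightarrow> u = 0"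
  by (metis act_inv_cancel act_zero inv_closed)

lemma act_unit: "\<sigma> \<in> carrier G \<Longrightarrow> \<sigma> 1 = 1"
  using act_mult[OF _ K_one K_one, of \<sigma>] act_eq_0_iff[OF _ K_one, of \<sigma>] by simp

lemma act_minus: "\<sigma> \<in> carrier G \<Longrightarrow> u \<in> K \<Longrightarrow> \<sigma> (- u) = - \<sigma> u"
  using act_add[OF _ _ K_minus, of \<sigma> u u] act_zero[of \<sigma>]
  by (simp add: eq_neg_iff_add_eq_0 add.commute)

lemma act_inverse: "\<sigma> \<in> carrier G \<Longrightarrow> u \<in> K \<Longrightarrow> \<sigma> (inverse u) = inverse (\<sigma> u)"
  using act_mult[OF _ _ K_inverse, of \<sigma> u u] act_unit[of \<sigma>] act_zero[of \<sigma>]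
  by (cases "u = 0") (auto intro: inverse_unique[symmetric])

lemma K_sum: "(\<And>i. i \<in> I \<Longrightarrow> f i \<in> K) \<Longrightarrow> sum f I \<in> K"
  by (induction I rule: infinite_finite_induct) (auto intro: K_zero K_add)

lemma act_sum:
  "\<sigma> \<in> carrier G \<Longrightarrow> (\<And>i. i \<in> I \<Longrightarrow> f i \<in> K) \<Longrightarrow> \<sigma> (sum f I) = (\<Sum>i\<in>I. \<sigma> (f i))"
  by (induction I rule: infinite_finite_induct) (auto simp: act_zero act_add K_sum)

text \<open>\<open>H0\<close> replaces the finite quotient of \<open>H\<close> acting on the
  extension generated by \<open>A\<close>, and Dedekind independence provides \<open>t\<close>.
  Translation invariance is stated for arbitrary weights \<open>g\<close>, since the additive
  version sums with a weight different from \<open>\<psi>\<close>.\<close>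

lemma nonvanishing_orbit_sum:
  assumes H: "subgroup H G" and A: "finite A" "A \<subseteq> K"
    and nz: "\<And>\<sigma>. \<sigma> \<in> H \<Longrightarrow> \<psi> \<sigma> \<noteq> 0"
  shows "\<exists>H0 t. finite H0 \<and> H0 \<subseteq> H \<and> t \<in> K \<and> (\<Sum>\<sigma>\<in>H0. \<psi> \<sigma> * \<sigma> t) \<noteq> 0 \<and>
    (\<forall>g \<tau>. \<tau> \<in> H \<and> (\<forall>\<sigma>\<in>H. \<forall>\<sigma>'\<in>H. (\<forall>z\<in>A. \<sigma> z = \<sigma>' z) \<longrightarrow> g \<sigma> = g \<sigma>') \<longrightarrow>
       (\<Sum>\<sigma>\<in>H0. g (\<tau> \<otimes> \<sigma>) * \<tau> (\<sigma> t)) = (\<Sum>\<sigma>\<in>H0. g \<sigma> * \<sigma> t))"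
proof -
  have HG: "\<sigma> \<in> carrier G" if "\<sigma> \<in> H" for \<sigma> using that by (rule subgroup.mem_carrier[OF H])
  define agree where "agree \<sigma> \<sigma>' \<longleftrightarrow> (\<forall>z\<in>A. \<sigma> z = \<sigma>' z)" for \<sigma> \<sigma>' :: "'a \<Rightarrow> 'a"
  define rep where "rep \<sigma> = (SOME \<sigma>'. \<sigma>' \<in> H \<and> agree \<sigma>' \<sigma>)" for \<sigma>
  define H0 where "H0 = rep ` H"
  have rep: "rep \<sigma> \<in> H" "agree (rep \<sigma>) \<sigma>" if "\<sigma> \<in> H" for \<sigma>
    using someI[of "\<lambda>\<sigma>'. \<sigma>' \<in> H \<and> agree \<sigma>' \<sigma>" \<sigma>] that unfolding rep_def agree_def by auto
  have rep_eq: "rep \<sigma> = rep \<sigma>'" if "agree \<sigma> \<sigma>'" for \<sigma> \<sigma>'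
    using that unfolding rep_def agree_def by metis
  have H0: "H0 \<subseteq> H" using rep by (auto simp: H0_def)
  have rep0: "rep \<sigma> = \<sigma>" if "\<sigma> \<in> H0" for \<sigma>
    using that rep_eq rep(2) by (auto simp: H0_def)
  have inj0: "\<sigma> = \<sigma>'" if "\<sigma> \<in> H0" "\<sigma>' \<in> H0" "agree \<sigma> \<sigma>'" for \<sigma> \<sigma>'
    using that rep_eq rep0 by metis
  have fin: "finite H0"
  proof (rule inj_on_finite[of "\<lambda>\<sigma>. restrict \<sigma> A"])
    show "inj_on (\<lambda>\<sigma>. restrict \<sigma> A) H0"
      by (rule inj_onI, rule inj0) (auto simp: agree_def restrict_def fun_eq_iff, metis)
    show "(\<lambda>\<sigma>. restrict \<sigma> A) ` H0 \<subseteq> PiE A (\<lambda>z. (\<lambda>\<sigma>. \<sigma> z) ` carrier G)"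
      using H0 HG by (auto simp: PiE_def)
    show "finite (PiE A (\<lambda>z. (\<lambda>\<sigma>. \<sigma> z) ` carrier G))"
      using A by (intro finite_PiE) (auto intro: finite_orbit)
  qed
  \<comment> \<open>These are the elements on which agreement on \<open>A\<close> forces agreement.
    They contain \<open>A\<close> and are closed under multiplication, so distinct members of
    \<open>H0\<close> are distinct characters on \<open>M\<close>.\<close>
  define M where "M = {z\<in>K. \<forall>\<sigma>\<in>H. \<forall>\<sigma>'\<in>H. agree \<sigma> \<sigma>' \<longrightarrow> \<sigma> z = \<sigma>' z}"
  have AM: "A \<subseteq> M" using A by (auto simp: M_def agree_def)
  have ne: "\<one> \<in> H" by (rule subgroup.one_closed[OF H])
  have "\<exists>t\<in>M. (\<Sum>\<sigma>\<in>H0. \<psi> \<sigma> * \<sigma> t) \<noteq> 0"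
  proof (rule ccontr)
    assume "\<not> (\<exists>t\<in>M. (\<Sum>\<sigma>\<in>H0. \<psi> \<sigma> * \<sigma> t) \<noteq> 0)"
    then have *: "(\<Sum>\<sigma>\<in>H0. \<psi> \<sigma> * (\<lambda>\<sigma>. \<sigma>) \<sigma> t) = 0" if "t \<in> M" for t using that by blast
    have "\<forall>\<sigma>\<in>H0. \<psi> \<sigma> = 0"
    proof (rule dedekind_independence[where \<xi> = "\<lambda>\<sigma>. \<sigma>" and u = 1 and M = M and mul = "(*)"])
      show "1 \<in> M" using K_one by (simp add: M_def act_unit HG)
      show "\<And>\<sigma>. \<sigma> \<in> H0 \<Longrightarrow> \<sigma> 1 = 1" using act_unit HG H0 by blast
      show "\<And>m n. m \<in> M \<Longrightarrow> n \<in> M \<Longrightarrow> m * n \<in> M"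
        using HG by (auto simp: M_def K_mult act_mult)
      show "\<And>\<sigma> m n. \<sigma> \<in> H0 \<Longrightarrow> m \<in> M \<Longrightarrow> n \<in> M \<Longrightarrow> \<sigma> (m * n) = \<sigma> m * \<sigma> n"
        using HG H0 by (auto simp: M_def intro!: act_mult)
      show "\<And>i j. i \<in> H0 \<Longrightarrow> j \<in> H0 \<Longrightarrow> i \<noteq> j \<Longrightarrow> \<exists>m\<in>M. i m \<noteq> j m"
        using inj0 AM unfolding agree_def by blast
    qed (use fin * in auto)
    moreover have "rep \<one> \<in> H0" using ne by (simp add: H0_def)
    ultimately show False using nz H0 by blast
  qed
  then obtain t where t: "t \<in> M" "(\<Sum>\<sigma>\<in>H0. \<psi> \<sigma> * \<sigma> t) \<noteq> 0" by blast
  have tK: "t \<in> K" using t(1) by (simp add: M_def)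
  show ?thesis
  proof (intro exI[of _ H0] exI[of _ t] conjI fin H0 tK t(2) allI impI, elim conjE)
    fix g :: "('a \<Rightarrow> 'a) \<Rightarrow> 'a" and \<tau>
    assume \<tau>: "\<tau> \<in> H"
      and g: "\<forall>\<sigma>\<in>H. \<forall>\<sigma>'\<in>H. (\<forall>z\<in>A. \<sigma> z = \<sigma>' z) \<longrightarrow> g \<sigma> = g \<sigma>'"
    have mH: "\<sigma> \<otimes> \<sigma>' \<in> H" if "\<sigma> \<in> H" "\<sigma>' \<in> H" for \<sigma> \<sigma>'
      using that by (rule subgroup.m_closed[OF H])
    have ag: "agree (\<rho> \<otimes> \<sigma>) (\<rho> \<otimes> \<sigma>')" if "agree \<sigma> \<sigma>'" "\<rho> \<in> H" "\<sigma> \<in> H" "\<sigma>' \<in> H" for \<rho> \<sigma> \<sigma>'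
      using that A(2) HG by (auto simp: agree_def act_comp subsetD)
    \<comment> \<open>Translation by \<open>\<tau>\<close> may leave the chosen representatives, so
      it is followed by a return to \<open>H0\<close>; weights and the value at \<open>t\<close> do
      not notice this correction.\<close>
    let ?f = "\<lambda>\<sigma>. rep (\<tau> \<otimes> \<sigma>)"
    have bij: "bij_betw ?f H0 H0"
    proof -
      have "inj_on ?f H0"
      proof (rule inj_onI)
        fix \<sigma> \<sigma>' assume s: "\<sigma> \<in> H0" "\<sigma>' \<in> H0" and eq: "rep (\<tau> \<otimes> \<sigma>) = rep (\<tau> \<otimes> \<sigma>')"
        then have sH: "\<sigma> \<in> H" "\<sigma>' \<in> H" using H0 by auto
        have "agree (\<tau> \<otimes> \<sigma>) (\<tau> \<otimes> \<sigma>')"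
          using rep(2)[OF mH[OF \<tau> sH(1)]] rep(2)[OF mH[OF \<tau> sH(2)]] eq unfolding agree_def by metis
        moreover have iH: "inv \<tau> \<in> H" using \<tau> by (rule subgroup.m_inv_closed[OF H])
        ultimately have "agree (inv \<tau> \<otimes> (\<tau> \<otimes> \<sigma>)) (inv \<tau> \<otimes> (\<tau> \<otimes> \<sigma>'))"
          using ag mH \<tau> sH by blast
        then show "\<sigma> = \<sigma>'"
          using inj0 s HG[OF \<tau>] HG[OF sH(1)] HG[OF sH(2)] by (simp add: m_assoc[symmetric])
      qed
      moreover have "?f ` H0 \<subseteq> H0" using mH[OF \<tau>] H0 by (auto simp: H0_def)
      ultimately show ?thesis
        using fin by (metis bij_betw_def endo_inj_surj)
    qed
    have "g (\<tau> \<otimes> \<sigma>) * \<tau> (\<sigma> t) = g (?f \<sigma>) * ?f \<sigma> t" if "\<sigma> \<in> H0" for \<sigma>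
    proof -
      have s: "\<sigma> \<in> H" "\<tau> \<otimes> \<sigma> \<in> H" using that H0 mH \<tau> by auto
      have "g (?f \<sigma>) = g (\<tau> \<otimes> \<sigma>)"
        using rep[OF s(2)] s by (intro g[rule_format]) (auto simp: agree_def)
      moreover have "?f \<sigma> t = (\<tau> \<otimes> \<sigma>) t"
        using t(1) rep[OF s(2)] s by (auto simp: M_def)
      ultimately show ?thesis using act_comp HG \<tau> s tK by simp
    qed
    then have "(\<Sum>\<sigma>\<in>H0. g (\<tau> \<otimes> \<sigma>) * \<tau> (\<sigma> t)) = (\<Sum>\<sigma>\<in>H0. g (?f \<sigma>) * ?f \<sigma> t)" by simp
    also have "\<dots> = (\<Sum>\<sigma>\<in>H0. g \<sigma> * \<sigma> t)"
      by (rule sum.reindex_bij_betw[OF bij])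
    finally show "(\<Sum>\<sigma>\<in>H0. g (\<tau> \<otimes> \<sigma>) * \<tau> (\<sigma> t)) = (\<Sum>\<sigma>\<in>H0. g \<sigma> * \<sigma> t)" .
  qed
qed

definition bool_sign :: "bool \<Rightarrow> 'a" where
  "bool_sign b = (if b then - 1 else 1)"

lemma bool_sign_simps [simp]:
  "bool_sign b * bool_sign b = 1" "bool_sign b * (bool_sign b * z) = z" "bool_sign b \<noteq> 0"
  "bool_sign True = -1" "bool_sign False = 1"
  by (auto simp: bool_sign_def)

text \<open>The second form matches what simplification makes of a negated equality of truth
  values.\<close>

lemma bool_sign_xor: "bool_sign (b \<noteq> c) = bool_sign b * bool_sign c"
  and bool_sign_eq_Not: "bool_sign (b = (\<not> c)) = bool_sign b * bool_sign c"
  by (auto simp: bool_sign_def)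

lemma bool_sign_K: "bool_sign b \<in> K"
  by (auto simp: bool_sign_def K_one K_minus)

lemma act_bool_sign:
  "\<sigma> \<in> carrier G \<Longrightarrow> u \<in> K \<Longrightarrow> \<sigma> (bool_sign b * u) = bool_sign b * \<sigma> u"
  by (auto simp: bool_sign_def act_minus)

text \<open>The witness is the resolvent sum of
  \<open>bool_sign (\<psi> \<sigma>) * \<sigma> t\<close>. A subgroup is allowed because the corner
  entry of a Heisenberg homomorphism is a character only on the kernel of
  \<open>\<beta>\<close>.\<close>

lemma hilbert90:
  assumes H: "subgroup H G" and lc: "locally_constant \<psi>"
    and hom: "\<And>\<sigma> \<tau>. \<sigma> \<in> H \<Longrightarrow> \<tau> \<in> H \<Longrightarrow> \<psi> (\<sigma> \<otimes> \<tau>) = (\<psi> \<sigma> \<noteq> \<psi> \<tau>)"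
  shows "\<exists>y\<in>K. y \<noteq> 0 \<and> (\<forall>\<sigma>\<in>H. \<sigma> y = bool_sign (\<psi> \<sigma>) * y)"
proof -
  have HG: "\<sigma> \<in> carrier G" if "\<sigma> \<in> H" for \<sigma> using that by (rule subgroup.mem_carrier[OF H])
  obtain A where A: "finite A" "A \<subseteq> K"
    "\<And>\<sigma> \<tau>. \<sigma> \<in> carrier G \<Longrightarrow> \<tau> \<in> carrier G \<Longrightarrow> (\<forall>z\<in>A. \<sigma> z = \<tau> z) \<Longrightarrow> \<psi> \<sigma> = \<psi> \<tau>"
    using lc unfolding locally_constant_def by blast
  obtain H0 t where t: "finite H0" "H0 \<subseteq> H" "t \<in> K" "(\<Sum>\<sigma>\<in>H0. bool_sign (\<psi> \<sigma>) * \<sigma> t) \<noteq> 0"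
    and inv: "\<And>g \<tau>. \<tau> \<in> H \<Longrightarrow>
           \<forall>\<sigma>\<in>H. \<forall>\<sigma>'\<in>H. (\<forall>z\<in>A. \<sigma> z = \<sigma>' z) \<longrightarrow> g \<sigma> = g \<sigma>' \<Longrightarrow>
           (\<Sum>\<sigma>\<in>H0. g (\<tau> \<otimes> \<sigma>) * \<tau> (\<sigma> t)) = (\<Sum>\<sigma>\<in>H0. g \<sigma> * \<sigma> t)"
    using nonvanishing_orbit_sum[OF H A(1,2), of "\<lambda>\<sigma>. bool_sign (\<psi> \<sigma>)", OF bool_sign_simps(3)]
    by blast
  let ?y = "\<Sum>\<sigma>\<in>H0. bool_sign (\<psi> \<sigma>) * \<sigma> t"
  have mem: "\<sigma> t \<in> K" if "\<sigma> \<in> H0" for \<sigma> using that t HG act_closed by blast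
  have "?y \<in> K" by (intro K_sum K_mult bool_sign_K mem)
  moreover have "\<tau> ?y = bool_sign (\<psi> \<tau>) * ?y" if \<tau>: "\<tau> \<in> H" for \<tau>
  proof -
    have "\<tau> ?y = (\<Sum>\<sigma>\<in>H0. bool_sign (\<psi> \<sigma>) * \<tau> (\<sigma> t))"
      using act_sum[OF HG[OF \<tau>], of H0 "\<lambda>\<sigma>. bool_sign (\<psi> \<sigma>) * \<sigma> t"]
      by (simp add: K_mult bool_sign_K mem act_bool_sign HG[OF \<tau>])
    also have "\<dots> = (\<Sum>\<sigma>\<in>H0. bool_sign (\<psi> \<tau>) * (bool_sign (\<psi> (\<tau> \<otimes> \<sigma>)) * \<tau> (\<sigma> t)))"
      using hom[OF \<tau>] t(2) by (intro sum.cong) (auto simp: bool_sign_eq_Not mult.assoc subsetD)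
    also have "\<dots> = bool_sign (\<psi> \<tau>) * (\<Sum>\<sigma>\<in>H0. bool_sign (\<psi> (\<tau> \<otimes> \<sigma>)) * \<tau> (\<sigma> t))"
      by (simp add: sum_distrib_left)
    also have "(\<Sum>\<sigma>\<in>H0. bool_sign (\<psi> (\<tau> \<otimes> \<sigma>)) * \<tau> (\<sigma> t)) = ?y"
    proof (rule inv[OF \<tau>, of "\<lambda>\<sigma>. bool_sign (\<psi> \<sigma>)"], intro ballI impI)
      fix \<sigma> \<sigma>' assume "\<sigma> \<in> H" "\<sigma>' \<in> H" "\<forall>z\<in>A. \<sigma> z = \<sigma>' z"
      then have "\<psi> \<sigma> = \<psi> \<sigma>'" by (intro A(3) HG)
      then show "bool_sign (\<psi> \<sigma>) = bool_sign (\<psi> \<sigma>')" by simp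
    qed
    finally show ?thesis .
  qed
  ultimately show ?thesis using t(4) by blast
qed

text \<open>The witness is the trace of \<open>t\<close> weighted by \<open>\<psi>\<close>, divided
  by the trace of \<open>t\<close>. Independence of characters makes the latter nonzero.\<close>

lemma additive_hilbert90:
  assumes two: "(2::'a) = 0" and lc: "locally_constant \<psi>"
    and hom: "\<And>\<sigma> \<tau>. \<sigma> \<in> carrier G \<Longrightarrow> \<tau> \<in> carrier G \<Longrightarrow> \<psi> (\<sigma> \<otimes> \<tau>) = (\<psi> \<sigma> \<noteq> \<psi> \<tau>)"
  shows "\<exists>y\<in>K. \<forall>\<sigma>\<in>carrier G. \<sigma> y = y + of_bool (\<psi> \<sigma>)"
proof -
  obtain A where A: "finite A" "A \<subseteq> K"
    "\<And>\<sigma> \<tau>. \<sigma> \<in> carrier G \<Longrightarrow> \<tau> \<in> carrier G \<Longrightarrow> (\<forall>z\<in>A. \<sigma> z = \<tau> z) \<Longrightarrow> \<psi> \<sigma> = \<psi> \<tau>"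
    using lc unfolding locally_constant_def by blast
  have "\<exists>H0 t. finite H0 \<and> H0 \<subseteq> carrier G \<and> t \<in> K \<and> (\<Sum>\<sigma>\<in>H0. 1 * \<sigma> t) \<noteq> 0 \<and>
    (\<forall>g \<tau>. \<tau> \<in> carrier G \<and>
       (\<forall>\<sigma>\<in>carrier G. \<forall>\<sigma>'\<in>carrier G. (\<forall>z\<in>A. \<sigma> z = \<sigma>' z) \<longrightarrow> g \<sigma> = g \<sigma>') \<longrightarrow>
       (\<Sum>\<sigma>\<in>H0. g (\<tau> \<otimes> \<sigma>) * \<tau> (\<sigma> t)) = (\<Sum>\<sigma>\<in>H0. g \<sigma> * \<sigma> t))"
    by (rule nonvanishing_orbit_sum[OF subgroup_self A(1,2)]) simp
  then obtain H0 t where t: "finite H0" "H0 \<subseteq> carrier G" "t \<in> K" "(\<Sum>\<sigma>\<in>H0. 1 * \<sigma> t) \<noteq> 0"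
    and inv0: "\<forall>g \<tau>. \<tau> \<in> carrier G \<and>
       (\<forall>\<sigma>\<in>carrier G. \<forall>\<sigma>'\<in>carrier G. (\<forall>z\<in>A. \<sigma> z = \<sigma>' z) \<longrightarrow> g \<sigma> = g \<sigma>') \<longrightarrow>
       (\<Sum>\<sigma>\<in>H0. g (\<tau> \<otimes> \<sigma>) * \<tau> (\<sigma> t)) = (\<Sum>\<sigma>\<in>H0. g \<sigma> * \<sigma> t)"
    by (elim exE conjE) (rule that)
  have inv: "\<And>g \<tau>. \<tau> \<in> carrier G \<Longrightarrow>
      \<forall>\<sigma>\<in>carrier G. \<forall>\<sigma>'\<in>carrier G. (\<forall>z\<in>A. \<sigma> z = \<sigma>' z) \<longrightarrow> g \<sigma> = g \<sigma>' \<Longrightarrow>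
      (\<Sum>\<sigma>\<in>H0. g (\<tau> \<otimes> \<sigma>) * \<tau> (\<sigma> t)) = (\<Sum>\<sigma>\<in>H0. g \<sigma> * \<sigma> t)"
    by (intro inv0[THEN spec, THEN spec, THEN mp] conjI)
  let ?T = "\<Sum>\<sigma>\<in>H0. \<sigma> t"
  let ?Y = "\<Sum>\<sigma>\<in>H0. of_bool (\<psi> \<sigma>) * \<sigma> t"
  have mem: "\<sigma> t \<in> K" if "\<sigma> \<in> H0" for \<sigma> using that t act_closed by blast
  have K: "?T \<in> K" "?Y \<in> K" by (auto intro!: K_sum simp: mem K_zero of_bool_def)
  have dbl: "u + u = 0" for u :: 'a
    using two by (metis mult_2 mult_zero_left)
  have T: "\<tau> ?T = ?T" if \<tau>: "\<tau> \<in> carrier G" for \<tau>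
  proof -
    have "\<tau> ?T = (\<Sum>\<sigma>\<in>H0. 1 * \<tau> (\<sigma> t))"
      using act_sum[OF \<tau>, of H0 "\<lambda>\<sigma>. \<sigma> t"] mem by simp
    also have "\<dots> = (\<Sum>\<sigma>\<in>H0. 1 * \<sigma> t)" by (rule inv[OF \<tau>, of "\<lambda>_. 1"]) simp
    finally show ?thesis by simp
  qed
  \<comment> \<open>In characteristic 2 the weight of \<open>\<sigma>\<close> is the weight of the
    translate plus that of \<open>\<tau>\<close>; the second part contributes a multiple of the
    trace.\<close>
  have Y: "\<tau> ?Y = ?Y + of_bool (\<psi> \<tau>) * ?T" if \<tau>: "\<tau> \<in> carrier G" for \<tau>
  proof -
    have "\<tau> ?Y = (\<Sum>\<sigma>\<in>H0. of_bool (\<psi> \<sigma>) * \<tau> (\<sigma> t))"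
      using act_sum[OF \<tau>, of H0 "\<lambda>\<sigma>. of_bool (\<psi> \<sigma>) * \<sigma> t"]
      by (auto intro!: sum.cong simp: mem K_zero act_zero[OF \<tau>] of_bool_def)
    also have "\<dots> = (\<Sum>\<sigma>\<in>H0. of_bool (\<psi> (\<tau> \<otimes> \<sigma>)) * \<tau> (\<sigma> t) + of_bool (\<psi> \<tau>) * \<tau> (\<sigma> t))"
      using hom[OF \<tau>] t(2) by (intro sum.cong) (auto simp: dbl of_bool_def)
    also have "\<dots> = (\<Sum>\<sigma>\<in>H0. of_bool (\<psi> (\<tau> \<otimes> \<sigma>)) * \<tau> (\<sigma> t)) + of_bool (\<psi> \<tau>) * \<tau> ?T"
      using act_sum[OF \<tau>, of H0 "\<lambda>\<sigma>. \<sigma> t"] mem by (simp add: sum.distrib sum_distrib_left)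
    also have "(\<Sum>\<sigma>\<in>H0. of_bool (\<psi> (\<tau> \<otimes> \<sigma>)) * \<tau> (\<sigma> t)) = ?Y"
    proof (rule inv[OF \<tau>, of "\<lambda>\<sigma>. of_bool (\<psi> \<sigma>)"], intro ballI impI)
      fix \<sigma> \<sigma>' assume "\<sigma> \<in> carrier G" "\<sigma>' \<in> carrier G" "\<forall>z\<in>A. \<sigma> z = \<sigma>' z"
      then have "\<psi> \<sigma> = \<psi> \<sigma>'" by (rule A(3))
      then show "of_bool (\<psi> \<sigma>) = (of_bool (\<psi> \<sigma>') :: 'a)" by simp
    qed
    finally show ?thesis using T[OF \<tau>] by simp
  qed
  show ?thesis
  proof (intro bexI ballI)
    fix \<sigma> assume s: "\<sigma> \<in> carrier G"
    have "\<sigma> (?Y * inverse ?T) = (?Y + of_bool (\<psi> \<sigma>) * ?T) * inverse ?T"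
      using s K by (simp add: act_mult act_inverse K_inverse T Y)
    also have "\<dots> = ?Y * inverse ?T + of_bool (\<psi> \<sigma>)"
      using t(4) by (simp add: field_simps)
    finally show "\<sigma> (?Y * inverse ?T) = ?Y * inverse ?T + of_bool (\<psi> \<sigma>)" .
  qed (use K in \<open>auto intro: K_mult K_inverse\<close>)
qed

text \<open>On the kernel \<open>H\<close> of \<open>\<beta>\<close> the mixed term vanishes, so
  \<open>\<gamma>\<close> is a character there and Hilbert 90 yields \<open>y\<close>. Its square
  \<open>w\<close> lies in the extension cut out by \<open>\<beta>\<close>, \<open>w'\<close> is the
  conjugate of \<open>w\<close>, and \<open>\<nu>\<close>, the product of \<open>y\<close> with its
  conjugate, is a root of the norm on which the group acts through \<open>\<alpha>\<close>. The case
  \<open>\<beta> = \<alpha>\<close> is used as well.\<close>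

lemma heisenberg_norm:
  assumes \<alpha>: "\<And>\<sigma> \<tau>. \<sigma> \<in> carrier G \<Longrightarrow> \<tau> \<in> carrier G \<Longrightarrow> \<alpha> (\<sigma> \<otimes> \<tau>) = (\<alpha> \<sigma> \<noteq> \<alpha> \<tau>)"
    and \<beta>: "\<And>\<sigma> \<tau>. \<sigma> \<in> carrier G \<Longrightarrow> \<tau> \<in> carrier G \<Longrightarrow> \<beta> (\<sigma> \<otimes> \<tau>) = (\<beta> \<sigma> \<noteq> \<beta> \<tau>)"
    and \<gamma>: "\<And>\<sigma> \<tau>. \<sigma> \<in> carrier G \<Longrightarrow> \<tau> \<in> carrier G \<Longrightarrow>
               \<gamma> (\<sigma> \<otimes> \<tau>) = ((\<gamma> \<sigma> \<noteq> \<gamma> \<tau>) \<noteq> (\<alpha> \<sigma> \<and> \<beta> \<tau>))"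
    and lc: "locally_constant \<gamma>" and \<tau>0: "\<tau>0 \<in> carrier G" "\<beta> \<tau>0"
  obtains w w' \<nu> where "w \<in> K" "w' \<in> K" "\<nu> \<in> K" "\<nu> \<noteq> 0" "\<nu> * \<nu> = w * w'"
    "\<And>\<sigma>. \<sigma> \<in> carrier G \<Longrightarrow> \<sigma> \<nu> = bool_sign (\<alpha> \<sigma>) * \<nu>"
    "\<And>\<sigma>. \<sigma> \<in> carrier G \<Longrightarrow> \<sigma> w = (if \<beta> \<sigma> then w' else w)"
    "\<And>\<sigma>. \<sigma> \<in> carrier G \<Longrightarrow> \<sigma> w' = (if \<beta> \<sigma> then w else w')"
proof -
  define H where "H = {\<sigma>\<in>carrier G. \<not> \<beta> \<sigma>}"
  have \<beta>1: "\<not> \<beta> \<one>" using \<beta>[of \<one> \<one>] by auto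
  have \<beta>inv: "\<beta> (inv \<sigma>) = \<beta> \<sigma>" if "\<sigma> \<in> carrier G" for \<sigma>
    using \<beta>[of \<sigma> "inv \<sigma>"] \<beta>1 that by (auto simp: r_inv)
  have H: "subgroup H G"
    by (rule subgroupI) (use \<beta>1 \<beta> \<beta>inv in \<open>auto simp: H_def\<close>)
  obtain y where y: "y \<in> K" "y \<noteq> 0" "\<And>\<sigma>. \<sigma> \<in> H \<Longrightarrow> \<sigma> y = bool_sign (\<gamma> \<sigma>) * y"
    using hilbert90[OF H lc] \<gamma> by (auto simp: H_def)
  have y': "\<tau>0 y \<in> K" "\<tau>0 y \<noteq> 0" using y \<tau>0 by (auto simp: act_closed act_eq_0_iff)
  \<comment> \<open>Conjugation by \<open>\<tau>0\<close> changes \<open>\<gamma>\<close> on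
    \<open>H\<close> by \<open>\<alpha>\<close>: of the two products
    \<open>\<sigma> \<otimes> \<tau>0 = \<tau>0 \<otimes> \<sigma>'\<close>, only the first has a
    mixed term. This is where \<open>\<alpha>\<close> enters the action on
    \<open>\<nu>\<close>.\<close>
  have conj: "\<sigma> (\<tau>0 y) = bool_sign (\<gamma> \<sigma>) * (bool_sign (\<alpha> \<sigma>) * \<tau>0 y)" if "\<sigma> \<in> H" for \<sigma>
  proof -
    have s: "\<sigma> \<in> carrier G" "\<not> \<beta> \<sigma>" using that by (auto simp: H_def)
    define \<sigma>' where "\<sigma>' = inv \<tau>0 \<otimes> \<sigma> \<otimes> \<tau>0"
    have s': "\<sigma>' \<in> carrier G" using s \<tau>0 by (simp add: \<sigma>'_def)
    have eq: "\<tau>0 \<otimes> \<sigma>' = \<sigma> \<otimes> \<tau>0"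
      using s \<tau>0 by (simp add: \<sigma>'_def m_assoc[symmetric])
    have "\<beta> (\<tau>0 \<otimes> \<sigma>') = \<beta> (\<sigma> \<otimes> \<tau>0)" "\<gamma> (\<tau>0 \<otimes> \<sigma>') = \<gamma> (\<sigma> \<otimes> \<tau>0)" using eq by simp_all
    then have "\<not> \<beta> \<sigma>'" "\<gamma> \<sigma>' = (\<gamma> \<sigma> \<noteq> \<alpha> \<sigma>)"
      using s s' \<tau>0 by (auto simp: \<beta> \<gamma>)
    then have "\<sigma>' y = bool_sign (\<gamma> \<sigma>) * (bool_sign (\<alpha> \<sigma>) * y)"
      using y(3)[of \<sigma>'] s' by (simp add: H_def bool_sign_eq_Not mult.assoc)
    moreover have "\<sigma> (\<tau>0 y) = \<tau>0 (\<sigma>' y)"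
      using act_comp[OF s(1) \<tau>0(1) y(1)] act_comp[OF \<tau>0(1) s' y(1)] eq by simp
    ultimately show ?thesis
      using \<tau>0(1) y(1) by (simp add: act_bool_sign K_mult bool_sign_K)
  qed
  have sq: "\<tau>0 (\<tau>0 y) = bool_sign (\<alpha> \<tau>0) * y"
  proof -
    have "\<tau>0 \<otimes> \<tau>0 \<in> H" using \<tau>0 by (auto simp: H_def \<beta>)
    moreover have "\<gamma> (\<tau>0 \<otimes> \<tau>0) = \<alpha> \<tau>0" using \<tau>0 by (auto simp: \<gamma>)
    ultimately show ?thesis
      using y(3)[of "\<tau>0 \<otimes> \<tau>0"] act_comp[OF \<tau>0(1) \<tau>0(1) y(1)] by simp
  qed
  define w where "w = y * y"
  define w' where "w' = \<tau>0 y * \<tau>0 y"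
  define \<nu> where "\<nu> = y * \<tau>0 y"
  have K: "w \<in> K" "w' \<in> K" "\<nu> \<in> K" using y y' by (auto simp: w_def w'_def \<nu>_def K_mult)
  have ker: "\<sigma> w = w" "\<sigma> w' = w'" "\<sigma> \<nu> = bool_sign (\<alpha> \<sigma>) * \<nu>" if "\<sigma> \<in> H" for \<sigma>
  proof -
    have s: "\<sigma> \<in> carrier G" using that by (simp add: H_def)
    show "\<sigma> w = w" "\<sigma> w' = w'" "\<sigma> \<nu> = bool_sign (\<alpha> \<sigma>) * \<nu>"
      using y y' s that by (auto simp: w_def w'_def \<nu>_def act_mult y(3) conj bool_sign_def)
  qed
  have t0: "\<tau>0 w = w'" "\<tau>0 w' = w" "\<tau>0 \<nu> = bool_sign (\<alpha> \<tau>0) * \<nu>"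
    using y y' \<tau>0 by (auto simp: w_def w'_def \<nu>_def act_mult sq bool_sign_def)
  \<comment> \<open>Elements outside \<open>H\<close> form the coset of \<open>\<tau>0\<close>, so
    the action on \<open>w\<close>, \<open>w'\<close> and \<open>\<nu>\<close> follows from that of
    \<open>H\<close> and of \<open>\<tau>0\<close>.\<close>
  have dec: "\<sigma> u = \<tau>0 ((inv \<tau>0 \<otimes> \<sigma>) u)" "inv \<tau>0 \<otimes> \<sigma> \<in> H" "\<alpha> \<sigma> = (\<alpha> \<tau>0 \<noteq> \<alpha> (inv \<tau>0 \<otimes> \<sigma>))"
    if s: "\<sigma> \<in> carrier G" "\<beta> \<sigma>" and u: "u \<in> K" for \<sigma> u
  proof -
    have eq: "\<tau>0 \<otimes> (inv \<tau>0 \<otimes> \<sigma>) = \<sigma>" using s \<tau>0 by (simp add: m_assoc[symmetric])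
    show "\<sigma> u = \<tau>0 ((inv \<tau>0 \<otimes> \<sigma>) u)"
      using act_comp[OF \<tau>0(1) _ u, of "inv \<tau>0 \<otimes> \<sigma>"] eq s \<tau>0 by simp
    show "inv \<tau>0 \<otimes> \<sigma> \<in> H" using s \<tau>0 by (auto simp: H_def \<beta> \<beta>inv)
    show "\<alpha> \<sigma> = (\<alpha> \<tau>0 \<noteq> \<alpha> (inv \<tau>0 \<otimes> \<sigma>))"
      using \<alpha>[OF \<tau>0(1), of "inv \<tau>0 \<otimes> \<sigma>"] eq s \<tau>0 by simp
  qed
  show ?thesis
  proof (rule that[OF K])
    show "\<nu> \<noteq> 0" using y y' by (simp add: \<nu>_def)
    show "\<nu> * \<nu> = w * w'" by (simp add: \<nu>_def w_def w'_def)
    fix \<sigma> assume s: "\<sigma> \<in> carrier G"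
    show "\<sigma> w = (if \<beta> \<sigma> then w' else w)"
      using ker(1)[of \<sigma>] ker(1)[OF dec(2)[OF s _ K(1)]] dec(1)[OF s _ K(1)] t0 s by (auto simp: H_def)
    show "\<sigma> w' = (if \<beta> \<sigma> then w else w')"
      using ker(2)[of \<sigma>] ker(2)[OF dec(2)[OF s _ K(2)]] dec(1)[OF s _ K(2)] t0 s by (auto simp: H_def)
    show "\<sigma> \<nu> = bool_sign (\<alpha> \<sigma>) * \<nu>"
    proof (cases "\<beta> \<sigma>")
      case True
      have "\<sigma> \<nu> = \<tau>0 (bool_sign (\<alpha> (inv \<tau>0 \<otimes> \<sigma>)) * \<nu>)"
        using dec[OF s True K(3)] ker(3) by simp
      also have "\<dots> = bool_sign (\<alpha> (inv \<tau>0 \<otimes> \<sigma>)) * (bool_sign (\<alpha> \<tau>0) * \<nu>)"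
        using t0 \<tau>0 K by (simp add: act_bool_sign)
      also have "\<dots> = bool_sign (\<alpha> \<sigma>) * \<nu>"
        using dec(3)[OF s True K(3)] by (simp add: bool_sign_eq_Not mult_ac)
      finally show ?thesis .
    qed (use ker(3)[of \<sigma>] s in \<open>simp add: H_def\<close>)
  qed
qed

end

text \<open>The coefficient of the monomial \<open>p q\<close> when \<open>e\<close> is written as a
  polynomial on the plane over the field with two elements. For a signed permutation of four roots
  it is the sign acquired by their product.\<close>

definition parity4 :: "(bool \<Rightarrow> bool \<Rightarrow> bool) \<Rightarrow> bool" where
  "parity4 e \<longleftrightarrow> (((e False False \<noteq> e False True) \<noteq> e True False) \<noteq> e True True)"

section \<open>The embedding problem, solved by the action on four conjugate roots\<close>

context galois_action
begin

lemma root_function_locally_constant: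
  fixes Y :: "bool \<Rightarrow> bool \<Rightarrow> 'a"
  assumes "locally_constant \<alpha>" "locally_constant \<beta>" "\<And>p q. Y p q \<in> K"
  shows "locally_constant (\<lambda>\<sigma>. f (\<alpha> \<sigma>) (\<beta> \<sigma>) (\<lambda>p q. \<sigma> (Y p q)))"
proof -
  have "locally_constant (\<lambda>\<sigma> p q. \<sigma> (Y p q))"
    unfolding locally_constant_def
  proof (intro exI conjI ballI impI)
    show "finite (range (\<lambda>(p, q). Y p q))" by simp
    show "range (\<lambda>(p, q). Y p q) \<subseteq> K" using assms(3) by auto
  qed (auto simp: fun_eq_iff)
  from locally_constant_comp[OF locally_constant_Pair[OF assms(1) locally_constant_Pair[OF assms(2) this]],
      of "\<lambda>(a, b, h). f a b h"]
  show ?thesis by simp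
qed

text \<open>Any choice of square roots of the four conjugates gives signs \<open>e\<close> with the
  required multiplication rule. The content is the parity condition, and it comes from computing the
  product of the four roots independently.\<close>

lemma signed_permutation_lift_char_not_2:
  assumes two: "(2::'a) \<noteq> 0" and sqrt: "\<And>z. z \<in> K \<Longrightarrow> \<exists>y\<in>K. y * y = z"
    and \<alpha>: "\<And>\<sigma> \<tau>. \<sigma> \<in> carrier G \<Longrightarrow> \<tau> \<in> carrier G \<Longrightarrow> \<alpha> (\<sigma> \<otimes> \<tau>) = (\<alpha> \<sigma> \<noteq> \<alpha> \<tau>)"
    and \<beta>: "\<And>\<sigma> \<tau>. \<sigma> \<in> carrier G \<Longrightarrow> \<tau> \<in> carrier G \<Longrightarrow> \<beta> (\<sigma> \<otimes> \<tau>) = (\<beta> \<sigma> \<noteq> \<beta> \<tau>)"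
    and \<gamma>: "\<And>\<sigma> \<tau>. \<sigma> \<in> carrier G \<Longrightarrow> \<tau> \<in> carrier G \<Longrightarrow>
               \<gamma> (\<sigma> \<otimes> \<tau>) = ((\<gamma> \<sigma> \<noteq> \<gamma> \<tau>) \<noteq> (\<alpha> \<sigma> \<and> \<alpha> \<tau>))"
    and \<delta>: "\<And>\<sigma> \<tau>. \<sigma> \<in> carrier G \<Longrightarrow> \<tau> \<in> carrier G \<Longrightarrow>
               \<delta> (\<sigma> \<otimes> \<tau>) = ((\<delta> \<sigma> \<noteq> \<delta> \<tau>) \<noteq> (\<alpha> \<sigma> \<and> \<beta> \<tau>))"
    and lc: "locally_constant \<alpha>" "locally_constant \<beta>" "locally_constant \<gamma>" "locally_constant \<delta>"
    and \<sigma>0: "\<sigma>0 \<in> carrier G" "\<alpha> \<sigma>0" "\<not> \<beta> \<sigma>0" and \<tau>0: "\<tau>0 \<in> carrier G" "\<beta> \<tau>0"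
  shows "\<exists>e. locally_constant e \<and> (\<forall>\<sigma>\<in>carrier G. parity4 (e \<sigma>) = \<alpha> \<sigma>) \<and>
     (\<forall>\<sigma>\<in>carrier G. \<forall>\<tau>\<in>carrier G. \<forall>p q. e (\<sigma> \<otimes> \<tau>) p q = (e \<tau> p q \<noteq> e \<sigma> (p \<noteq> \<alpha> \<tau>) (q \<noteq> \<beta> \<tau>)))"
proof -
  obtain \<theta> \<theta>' \<nu> where \<theta>: "\<theta> \<in> K" "\<theta>' \<in> K" "\<nu> \<in> K" "\<nu> \<noteq> 0" "\<nu> * \<nu> = \<theta> * \<theta>'"
    "\<And>\<sigma>. \<sigma> \<in> carrier G \<Longrightarrow> \<sigma> \<nu> = bool_sign (\<alpha> \<sigma>) * \<nu>"
    "\<And>\<sigma>. \<sigma> \<in> carrier G \<Longrightarrow> \<sigma> \<theta> = (if \<alpha> \<sigma> then \<theta>' else \<theta>)"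
    "\<And>\<sigma>. \<sigma> \<in> carrier G \<Longrightarrow> \<sigma> \<theta>' = (if \<alpha> \<sigma> then \<theta> else \<theta>')"
    using heisenberg_norm[OF \<alpha> \<alpha> \<gamma> lc(3) \<sigma>0(1,2)] by blast
  obtain w1 w1' \<nu>1 where w1: "w1 \<in> K" "w1' \<in> K" "\<nu>1 \<in> K" "\<nu>1 \<noteq> 0" "\<nu>1 * \<nu>1 = w1 * w1'"
    "\<And>\<sigma>. \<sigma> \<in> carrier G \<Longrightarrow> \<sigma> \<nu>1 = bool_sign (\<alpha> \<sigma>) * \<nu>1"
    "\<And>\<sigma>. \<sigma> \<in> carrier G \<Longrightarrow> \<sigma> w1 = (if \<beta> \<sigma> then w1' else w1)"
    "\<And>\<sigma>. \<sigma> \<in> carrier G \<Longrightarrow> \<sigma> w1' = (if \<beta> \<sigma> then w1 else w1')"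
    using heisenberg_norm[OF \<alpha> \<beta> \<delta> lc(4) \<tau>0] by blast
  \<comment> \<open>Both \<open>\<nu>\<close> and \<open>\<nu>1\<close> change sign through the same
    character \<open>\<alpha>\<close>, so their quotient is fixed. Scaling \<open>w1\<close> by it,
    up to sign, turns the norm into that of \<open>\<theta>\<close>.\<close>
  define \<mu> where "\<mu> = \<nu> * inverse \<nu>1"
  have \<mu>: "\<mu> \<in> K" "\<mu> \<noteq> 0"
    using \<theta>(3,4) w1(3,4) by (auto simp: \<mu>_def K_mult K_inverse)
  have \<mu>_act: "\<sigma> \<mu> = \<mu>" if "\<sigma> \<in> carrier G" for \<sigma>
    using \<theta>(3) w1(3) \<theta>(6)[OF that] w1(6)[OF that] that
    by (auto simp: \<mu>_def K_inverse act_mult act_inverse bool_sign_def)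
  have nz: "\<theta> \<noteq> 0" "\<theta>' \<noteq> 0" using \<theta>(4,5) by auto
  \<comment> \<open>Both signs of the rescaling make the norms of \<open>\<theta>\<close> and \<open>w\<close> agree; at least one of them
    makes the sum of the traces nonzero.\<close>
  have "\<exists>\<epsilon>\<in>{1, -1}. \<theta> + \<theta>' + \<epsilon> * \<mu> * (w1 + w1') \<noteq> 0"
  proof (rule ccontr)
    assume "\<not> ?thesis"
    then have 1: "\<theta> + \<theta>' + \<mu> * (w1 + w1') = 0" "\<theta> + \<theta>' - \<mu> * (w1 + w1') = 0" by auto
    have "2 * (\<theta> + \<theta>') = (\<theta> + \<theta>' + \<mu> * (w1 + w1')) + (\<theta> + \<theta>' - \<mu> * (w1 + w1'))" by simp
    then have t: "\<theta> + \<theta>' = 0" using 1 two by simp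
    with 1 \<mu>(2) have "w1 + w1' = 0" by simp
    with t have eq: "\<theta>' = - \<theta>" "w1' = - w1" by (simp_all add: eq_neg_iff_add_eq_0 add.commute)
    have "\<nu> = \<mu> * \<nu>1" using w1(4) by (simp add: \<mu>_def)
    then have "\<theta> * \<theta>' = \<mu> * \<mu> * (w1 * w1')" using \<theta>(5) w1(5) by (simp add: mult_ac flip: \<theta>(5) w1(5))
    then have "\<theta> * \<theta> = (\<mu> * w1) * (\<mu> * w1)" using eq by (simp add: mult_ac)
    then have "\<theta> = \<mu> * w1 \<or> \<theta> = - (\<mu> * w1)" by (simp add: square_eq_iff)
    \<comment> \<open>\<open>\<sigma>0\<close> separates the two quadratic extensions: it fixes
      \<open>w1\<close> because \<open>\<beta> \<sigma>0\<close> is false, but sends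
      \<open>\<theta>\<close> to \<open>\<theta>' = - \<theta>\<close>.\<close>
    moreover have "\<sigma>0 (\<mu> * w1) = \<mu> * w1"
      using \<sigma>0 \<mu>(1) w1(1) w1(7)[OF \<sigma>0(1)] \<mu>_act[OF \<sigma>0(1)] by (simp add: act_mult)
    ultimately have "\<sigma>0 \<theta> = \<theta>"
      using \<sigma>0 \<mu>(1) w1(1) by (auto simp: act_minus K_mult)
    then have "2 * \<theta> = 0" using \<theta>(7)[OF \<sigma>0(1)] \<sigma>0(2) eq(1)
      by (metis add.left_inverse mult_2)
    then show False using two nz by simp
  qed
  then obtain \<epsilon> where \<epsilon>: "\<epsilon> = 1 \<or> \<epsilon> = -1" "\<theta> + \<theta>' + \<epsilon> * \<mu> * (w1 + w1') \<noteq> 0" by blast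
  define w where "w = \<epsilon> * \<mu> * w1"
  define w' where "w' = \<epsilon> * \<mu> * w1'"
  have w: "w \<in> K" "w' \<in> K" "w * w' = \<theta> * \<theta>'"
    "\<And>\<sigma>. \<sigma> \<in> carrier G \<Longrightarrow> \<sigma> w = (if \<beta> \<sigma> then w' else w)"
    "\<And>\<sigma>. \<sigma> \<in> carrier G \<Longrightarrow> \<sigma> w' = (if \<beta> \<sigma> then w else w')"
  proof -
    show "w \<in> K" "w' \<in> K" using \<epsilon>(1) \<mu> w1 by (auto simp: w_def w'_def K_mult K_minus)
    have "w * w' = (\<mu> * \<nu>1) * (\<mu> * \<nu>1)"
      using \<epsilon>(1) w1(5) by (auto simp: w_def w'_def mult_ac)
    also have "\<mu> * \<nu>1 = \<nu>" using w1(4) by (simp add: \<mu>_def)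
    finally show "w * w' = \<theta> * \<theta>'" using \<theta>(5) by simp
    show "\<sigma> w = (if \<beta> \<sigma> then w' else w)" "\<sigma> w' = (if \<beta> \<sigma> then w else w')" if "\<sigma> \<in> carrier G" for \<sigma>
      using \<epsilon>(1) \<mu>(1) w1(1,2) w1(7,8)[OF that] \<mu>_act[OF that] that
      by (auto simp: w_def w'_def act_mult act_minus K_mult)
  qed
  define f where "f = \<theta> + \<theta>' + w + w'"
  have f: "f \<in> K" "f \<noteq> 0"
    using \<epsilon>(2) \<theta>(1,2) w(1,2) by (auto simp: f_def w_def w'_def K_add algebra_simps)
  have f_act: "\<sigma> f = f" if "\<sigma> \<in> carrier G" for \<sigma>
    using \<theta>(1,2) w(1,2) \<theta>(7,8)[OF that] w(4,5)[OF that] that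
    by (auto simp: f_def K_add act_add)
  define \<eta> where "\<eta> p q = (if p then \<theta>' else \<theta>) + (if q then w' else w)" for p q
  have \<eta>K: "\<eta> p q \<in> K" for p q using \<theta> w by (auto simp: \<eta>_def K_add)
  have \<eta>act: "\<sigma> (\<eta> p q) = \<eta> (p \<noteq> \<alpha> \<sigma>) (q \<noteq> \<beta> \<sigma>)" if "\<sigma> \<in> carrier G" for \<sigma> p q
    using \<theta>(1,2) w(1,2) \<theta>(7,8)[OF that] w(4,5)[OF that] that
    by (auto simp: \<eta>_def act_add)
  have \<eta>prod: "\<eta> p False * \<eta> p True = (if p then \<theta>' else \<theta>) * f" for p
    using w(3) by (auto simp: \<eta>_def f_def algebra_simps)
  have \<eta>nz: "\<eta> p q \<noteq> 0" for p q
    using \<eta>prod[of p] nz f(2) by (cases q) (auto split: if_splits)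
  obtain Y where Y: "\<And>p q. Y p q \<in> K" "\<And>p q. Y p q * Y p q = \<eta> p q"
    using sqrt[OF \<eta>K] by metis
  have Ynz: "Y p q \<noteq> 0" for p q using Y(2)[of p q] \<eta>nz[of p q] by auto
  \<comment> \<open>\<open>e\<close> is true when the sign is negative; the two signs are
    distinguishable because 2 and the roots are nonzero.\<close>
  define e where "e \<sigma> p q \<longleftrightarrow> \<sigma> (Y p q) = - Y (p \<noteq> \<alpha> \<sigma>) (q \<noteq> \<beta> \<sigma>)" for \<sigma> p q
  have neg: "u \<noteq> - u" if "u \<noteq> 0" for u :: 'a
    using that two by (metis add.left_inverse mult_2 mult_eq_0_iff)
  have e: "\<sigma> (Y p q) = bool_sign (e \<sigma> p q) * Y (p \<noteq> \<alpha> \<sigma>) (q \<noteq> \<beta> \<sigma>)" if s: "\<sigma> \<in> carrier G" for \<sigma> p q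
  proof -
    have "\<sigma> (Y p q) * \<sigma> (Y p q) = Y (p \<noteq> \<alpha> \<sigma>) (q \<noteq> \<beta> \<sigma>) * Y (p \<noteq> \<alpha> \<sigma>) (q \<noteq> \<beta> \<sigma>)"
      using act_mult[OF s Y(1) Y(1), of p q p q] \<eta>act[OF s, of p q] Y(2) by simp
    then show ?thesis by (auto simp: e_def bool_sign_def square_eq_iff)
  qed
  have bs: "b = c" if "bool_sign b * u = bool_sign c * u" "u \<noteq> 0" for b c and u :: 'a
    using that neg[of u] by (auto simp: bool_sign_def split: if_splits)
  have xx: "((p \<noteq> a) \<noteq> b) = (p \<noteq> (b \<noteq> a))" for p a b :: bool by auto
  have mult: "e (\<sigma> \<otimes> \<tau>) p q = (e \<tau> p q \<noteq> e \<sigma> (p \<noteq> \<alpha> \<tau>) (q \<noteq> \<beta> \<tau>))"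
    if s: "\<sigma> \<in> carrier G" "\<tau> \<in> carrier G" for \<sigma> \<tau> p q
  proof -
    let ?u = "Y (p \<noteq> (\<alpha> \<sigma> \<noteq> \<alpha> \<tau>)) (q \<noteq> (\<beta> \<sigma> \<noteq> \<beta> \<tau>))"
    have "bool_sign (e (\<sigma> \<otimes> \<tau>) p q) * ?u = (\<sigma> \<otimes> \<tau>) (Y p q)"
      using e[of "\<sigma> \<otimes> \<tau>" p q] s by (simp only: \<alpha> \<beta> m_closed)
    also have "\<dots> = \<sigma> (bool_sign (e \<tau> p q) * Y (p \<noteq> \<alpha> \<tau>) (q \<noteq> \<beta> \<tau>))"
      using act_comp[OF s Y(1)] e[OF s(2), of p q] by simp
    also have "\<dots> = bool_sign (e \<tau> p q) *
        (bool_sign (e \<sigma> (p \<noteq> \<alpha> \<tau>) (q \<noteq> \<beta> \<tau>)) * Y ((p \<noteq> \<alpha> \<tau>) \<noteq> \<alpha> \<sigma>) ((q \<noteq> \<beta> \<tau>) \<noteq> \<beta> \<sigma>))"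
      unfolding act_bool_sign[OF s(1) Y(1)] e[OF s(1), symmetric] by simp
    also have "\<dots> = bool_sign (e \<tau> p q \<noteq> e \<sigma> (p \<noteq> \<alpha> \<tau>) (q \<noteq> \<beta> \<tau>)) * ?u"
      unfolding xx bool_sign_xor mult.assoc ..
    finally show ?thesis using bs Ynz by blast
  qed
  \<comment> \<open>The group acts on \<open>P\<close> in two ways: the signs of the four factors
    give \<open>parity4 (e \<sigma>)\<close>, and \<open>P = \<nu> * f\<close> up to sign, with
    \<open>f\<close> fixed, gives \<open>\<alpha> \<sigma>\<close>.\<close>
  define P where "P = Y False False * Y False True * (Y True False * Y True True)"
  have Pnz: "P \<noteq> 0" using Ynz by (simp add: P_def)
  have PK: "P \<in> K" using Y(1) by (simp add: P_def K_mult)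
  have "P * P = (\<eta> False False * \<eta> False True) * (\<eta> True False * \<eta> True True)"
    by (simp add: P_def mult_ac flip: Y(2))
  also have "\<dots> = (\<nu> * f) * (\<nu> * f)"
    unfolding \<eta>prod using \<theta>(5) by (simp add: mult_ac)
  finally have "P = \<nu> * f \<or> P = - (\<nu> * f)" by (simp add: square_eq_iff)
  then have P1: "\<sigma> P = bool_sign (\<alpha> \<sigma>) * P" if "\<sigma> \<in> carrier G" for \<sigma>
    using that \<theta>(3) \<theta>(6)[OF that] f(1) f_act[OF that] by (auto simp: act_minus act_mult K_mult)
  have P2: "\<sigma> P = bool_sign (parity4 (e \<sigma>)) * P" if s: "\<sigma> \<in> carrier G" for \<sigma>
  proof -
    have "\<sigma> P = \<sigma> (Y False False) * \<sigma> (Y False True) * (\<sigma> (Y True False) * \<sigma> (Y True True))"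
      using s Y(1) by (simp add: P_def act_mult K_mult)
    also have "\<dots> = bool_sign (parity4 (e \<sigma>)) * P"
      unfolding e[OF s] parity4_def bool_sign_xor P_def by (cases "\<alpha> \<sigma>"; cases "\<beta> \<sigma>") (simp_all add: mult_ac)
    finally show ?thesis .
  qed
  have "locally_constant e"
    using root_function_locally_constant[OF lc(1,2) Y(1),
        of "\<lambda>a b h p q. h p q = - Y (p \<noteq> a) (q \<noteq> b)"]
    by (simp add: e_def[abs_def])
  moreover have "parity4 (e \<sigma>) = \<alpha> \<sigma>" if "\<sigma> \<in> carrier G" for \<sigma>
    using bs[OF _ Pnz] P1[OF that] P2[OF that] by simp
  ultimately show ?thesis using mult by blast
qed

text \<open>Additive analogue: roots of Artin-Schreier equations replace square roots, and their sum
  replaces the product. The factor \<open>d\<close> on the right-hand sides is chosen so that this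
  sum satisfies the equation of \<open>u\<close>.\<close>

lemma signed_permutation_lift_char_2:
  assumes two: "(2::'a) = 0" and AS: "\<And>z. z \<in> K \<Longrightarrow> \<exists>y\<in>K. y * y + y = z"
    and \<alpha>: "\<And>\<sigma> \<tau>. \<sigma> \<in> carrier G \<Longrightarrow> \<tau> \<in> carrier G \<Longrightarrow> \<alpha> (\<sigma> \<otimes> \<tau>) = (\<alpha> \<sigma> \<noteq> \<alpha> \<tau>)"
    and \<beta>: "\<And>\<sigma> \<tau>. \<sigma> \<in> carrier G \<Longrightarrow> \<tau> \<in> carrier G \<Longrightarrow> \<beta> (\<sigma> \<otimes> \<tau>) = (\<beta> \<sigma> \<noteq> \<beta> \<tau>)"
    and lc: "locally_constant \<alpha>" "locally_constant \<beta>"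
  shows "\<exists>e. locally_constant e \<and> (\<forall>\<sigma>\<in>carrier G. parity4 (e \<sigma>) = \<alpha> \<sigma>) \<and>
     (\<forall>\<sigma>\<in>carrier G. \<forall>\<tau>\<in>carrier G. \<forall>p q. e (\<sigma> \<otimes> \<tau>) p q = (e \<tau> p q \<noteq> e \<sigma> (p \<noteq> \<alpha> \<tau>) (q \<noteq> \<beta> \<tau>)))"
proof -
  have dbl: "x + x = 0" for x :: 'a
    using two by (metis mult_2 mult_zero_left)
  have dbl': "x + (x + z) = z" for x z :: 'a
    using dbl[of x] by (simp add: add.assoc[symmetric])
  obtain u where u: "u \<in> K" "\<And>\<sigma>. \<sigma> \<in> carrier G \<Longrightarrow> \<sigma> u = u + of_bool (\<alpha> \<sigma>)"
    using additive_hilbert90[OF two lc(1) \<alpha>] by blast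
  obtain v where v: "v \<in> K" "\<And>\<sigma>. \<sigma> \<in> carrier G \<Longrightarrow> \<sigma> v = v + of_bool (\<beta> \<sigma>)"
    using additive_hilbert90[OF two lc(2) \<beta>] by blast
  have K_of_bool: "of_bool b \<in> K" for b by (simp add: of_bool_def K_zero K_one)
  have act_of_bool: "\<sigma> (of_bool b) = of_bool b" if "\<sigma> \<in> carrier G" for \<sigma> b
    using that by (simp add: of_bool_def act_zero act_unit)
  have of_bool_xor: "(of_bool (b \<noteq> c) :: 'a) = of_bool b + of_bool c" for b c
    by (cases b; cases c) (simp_all add: two dbl)
  define d where "d = u * u + u"
  have d: "d \<in> K" "\<And>\<sigma>. \<sigma> \<in> carrier G \<Longrightarrow> \<sigma> d = d"
  proof -
    show "d \<in> K" using u by (simp add: d_def K_add K_mult)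
    show "\<sigma> d = d" if s: "\<sigma> \<in> carrier G" for \<sigma>
      using u(1) u(2)[OF s] s
      by (cases "\<alpha> \<sigma>") (simp_all add: d_def act_add act_mult K_mult algebra_simps dbl dbl')
  qed
  define \<eta> where "\<eta> p q = d * ((u + of_bool p) * (v + of_bool q))" for p q
  have \<eta>K: "\<eta> p q \<in> K" for p q
    using u v d by (simp add: \<eta>_def K_add K_mult K_of_bool)
  have \<eta>act: "\<sigma> (\<eta> p q) = \<eta> (p \<noteq> \<alpha> \<sigma>) (q \<noteq> \<beta> \<sigma>)" if s: "\<sigma> \<in> carrier G" for \<sigma> p q
    unfolding \<eta>_def of_bool_xor using s u(1) u(2)[OF s] v(1) v(2)[OF s] d(1) d(2)[OF s]
    by (simp add: act_mult act_add K_add K_mult K_of_bool act_of_bool add_ac)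
  obtain Y where Y: "\<And>p q. Y p q \<in> K" "\<And>p q. Y p q * Y p q + Y p q = \<eta> p q"
    using AS[OF \<eta>K] by metis
  have AS_eq: "x = y \<or> x = y + 1" if "x * x + x = y * y + y" for x y :: 'a
  proof -
    have "(x + y) * (x + y + 1) = (x * x + x) + (y * y + y) + (x * y + x * y)"
      by (simp add: algebra_simps)
    also have "\<dots> = 0" unfolding that by (simp only: dbl add_0)
    finally have "x + y = 0 \<or> x + y + 1 = 0" by simp
    moreover have "x = y + (x + y)" using dbl'[of y x] by (simp add: add_ac)
    moreover have "x = y + 1 + (x + y + 1)"
      using dbl'[of y "x + (1 + 1)"] dbl[of 1] by (simp add: add_ac del: one_add_one)
    ultimately show ?thesis by (metis add_0_right)
  qed
  define e where "e \<sigma> p q \<longleftrightarrow> \<sigma> (Y p q) = Y (p \<noteq> \<alpha> \<sigma>) (q \<noteq> \<beta> \<sigma>) + 1" for \<sigma> p q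
  have e: "\<sigma> (Y p q) = Y (p \<noteq> \<alpha> \<sigma>) (q \<noteq> \<beta> \<sigma>) + of_bool (e \<sigma> p q)" if s: "\<sigma> \<in> carrier G" for \<sigma> p q
  proof -
    have "\<sigma> (Y p q) * \<sigma> (Y p q) + \<sigma> (Y p q) = \<sigma> (\<eta> p q)"
      using s Y(1) by (simp add: act_add act_mult K_mult flip: Y(2))
    also have "\<dots> = Y (p \<noteq> \<alpha> \<sigma>) (q \<noteq> \<beta> \<sigma>) * Y (p \<noteq> \<alpha> \<sigma>) (q \<noteq> \<beta> \<sigma>) + Y (p \<noteq> \<alpha> \<sigma>) (q \<noteq> \<beta> \<sigma>)"
      using \<eta>act[OF s] Y(2) by simp
    finally show ?thesis using AS_eq by (auto simp: e_def)
  qed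
  have bs: "b = c" if "x + of_bool b = x + of_bool c" for b c and x :: 'a
    using that by (cases b; cases c) auto
  have xx: "((p \<noteq> a) \<noteq> b) = (p \<noteq> (b \<noteq> a))" for p a b :: bool by auto
  have mult: "e (\<sigma> \<otimes> \<tau>) p q = (e \<tau> p q \<noteq> e \<sigma> (p \<noteq> \<alpha> \<tau>) (q \<noteq> \<beta> \<tau>))"
    if s: "\<sigma> \<in> carrier G" "\<tau> \<in> carrier G" for \<sigma> \<tau> p q
  proof -
    let ?u = "Y (p \<noteq> (\<alpha> \<sigma> \<noteq> \<alpha> \<tau>)) (q \<noteq> (\<beta> \<sigma> \<noteq> \<beta> \<tau>))"
    have "?u + of_bool (e (\<sigma> \<otimes> \<tau>) p q) = (\<sigma> \<otimes> \<tau>) (Y p q)"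
      using e[of "\<sigma> \<otimes> \<tau>" p q] s by (simp only: \<alpha> \<beta> m_closed)
    also have "\<dots> = \<sigma> (Y (p \<noteq> \<alpha> \<tau>) (q \<noteq> \<beta> \<tau>) + of_bool (e \<tau> p q))"
      using act_comp[OF s Y(1)] e[OF s(2), of p q] by simp
    also have "\<dots> = \<sigma> (Y (p \<noteq> \<alpha> \<tau>) (q \<noteq> \<beta> \<tau>)) + of_bool (e \<tau> p q)"
      using s(1) Y(1) by (simp add: act_add K_of_bool act_of_bool)
    also have "\<dots> = Y ((p \<noteq> \<alpha> \<tau>) \<noteq> \<alpha> \<sigma>) ((q \<noteq> \<beta> \<tau>) \<noteq> \<beta> \<sigma>)
        + of_bool (e \<sigma> (p \<noteq> \<alpha> \<tau>) (q \<noteq> \<beta> \<tau>)) + of_bool (e \<tau> p q)"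
      unfolding e[OF s(1), symmetric] by simp
    also have "\<dots> = ?u + of_bool (e \<tau> p q \<noteq> e \<sigma> (p \<noteq> \<alpha> \<tau>) (q \<noteq> \<beta> \<tau>))"
      unfolding xx of_bool_xor by (simp only: add_ac)
    finally show ?thesis by (rule bs)
  qed
  \<comment> \<open>Summed over \<open>p\<close> and \<open>q\<close>, each linear factor of
    \<open>\<eta>\<close> contributes \<open>u + (u + 1) = 1\<close> or
    \<open>v + (v + 1) = 1\<close>, so the total is \<open>d\<close> and \<open>P\<close> is
    \<open>u\<close> or \<open>u + 1\<close>.\<close>
  define P where "P = Y False False + Y False True + (Y True False + Y True True)"
  have "P * P + P = (Y False False * Y False False + Y False False)
      + (Y False True * Y False True + Y False True)
      + (Y True False * Y True False + Y True False)
      + (Y True True * Y True True + Y True True)"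
    by (simp add: P_def algebra_simps dbl dbl')
  also have "\<dots> = \<eta> False False + \<eta> False True + \<eta> True False + \<eta> True True"
    unfolding Y(2) ..
  also have "\<dots> = d" by (simp add: \<eta>_def algebra_simps dbl dbl')
  finally have "P = u \<or> P = u + 1" using AS_eq d_def by metis
  then have P1: "\<sigma> P = P + of_bool (\<alpha> \<sigma>)" if "\<sigma> \<in> carrier G" for \<sigma>
    using that u(1) u(2)[OF that] by (auto simp: act_add K_one act_unit add_ac)
  have P2: "\<sigma> P = P + of_bool (parity4 (e \<sigma>))" if s: "\<sigma> \<in> carrier G" for \<sigma>
  proof -
    have "\<sigma> P = \<sigma> (Y False False) + \<sigma> (Y False True) + (\<sigma> (Y True False) + \<sigma> (Y True True))"
      using s Y(1) by (simp add: P_def act_add K_add)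
    also have "\<dots> = P + of_bool (parity4 (e \<sigma>))"
      unfolding e[OF s] parity4_def of_bool_xor P_def
      by (cases "\<alpha> \<sigma>"; cases "\<beta> \<sigma>") (simp_all only: simp_thms add_ac)
    finally show ?thesis .
  qed
  have "locally_constant e"
    using root_function_locally_constant[OF lc Y(1),
        of "\<lambda>a b h p q. h p q = Y (p \<noteq> a) (q \<noteq> b) + 1"]
    by (simp add: e_def[abs_def])
  moreover have "parity4 (e \<sigma>) = \<alpha> \<sigma>" if "\<sigma> \<in> carrier G" for \<sigma>
    using bs P1[OF that] P2[OF that] by metis
  ultimately show ?thesis using mult by blast
qed

end

section \<open>Two finite groups\<close>

text \<open>An element \<open>(a, b, c, d)\<close> stands for the pair of upper unitriangular \<open>3 \<times> 3\<close> matrices over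
  \<open>F\<^sub>2\<close> with superdiagonals \<open>(a, a)\<close> and \<open>(a, b)\<close> and corner entries \<open>c\<close> and \<open>d\<close>: a homomorphism to this
  group is a pair of characters with trivializations of \<open>\<alpha> \<union> \<alpha>\<close> and \<open>\<alpha> \<union> \<beta>\<close>.\<close>

definition heis :: "(bool \<times> bool \<times> bool \<times> bool) monoid" where
  "heis = \<lparr>carrier = UNIV,
     monoid.mult = (\<lambda>(a, b, c, d) (a', b', c', d').
       (a \<noteq> a', b \<noteq> b', (c \<noteq> c') \<noteq> (a \<and> a'), (d \<noteq> d') \<noteq> (a \<and> b'))),
     one = (False, False, False, False)\<rparr>"

lemma carrier_heis [simp]: "carrier heis = UNIV"
  and one_heis [simp]: "\<one>\<^bsub>heis\<^esub> = (False, False, False, False)"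
  and mult_heis [simp]: "(a, b, c, d) \<otimes>\<^bsub>heis\<^esub> (a', b', c', d') =
      (a \<noteq> a', b \<noteq> b', (c \<noteq> c') \<noteq> (a \<and> a'), (d \<noteq> d') \<noteq> (a \<and> b'))"
  by (simp_all add: heis_def)

lemma group_heis: "group heis"
proof (rule groupI)
  fix g show "\<exists>h\<in>carrier heis. h \<otimes>\<^bsub>heis\<^esub> g = \<one>\<^bsub>heis\<^esub>"
    by (cases g) (rule bexI[of _ "case g of (a, b, c, d) \<Rightarrow> (a, b, c \<noteq> a, d \<noteq> (a \<and> b))"], auto)
qed (auto simp: split_paired_all)

lemma inv_heis [simp]: "inv\<^bsub>heis\<^esub> (a, b, c, d) = (a, b, c \<noteq> a, d \<noteq> (a \<and> b))"
  by (rule group.inv_equality[OF group_heis]) auto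

text \<open>An element \<open>(a, b, e)\<close> acts on signed symbols by \<open>y\<^sub>p\<^sub>q \<mapsto> (-1)\<^bsup>e p q\<^esup> y\<^sub>p\<^sub>+\<^sub>a\<^sub>,\<^sub>q\<^sub>+\<^sub>b\<close>. The group is
  isomorphic to the group of upper unitriangular \<open>4 \<times> 4\<close> matrices over \<open>F\<^sub>2\<close> with superdiagonal
  \<open>(a, a, b)\<close>; the subsets \<open>signed_V4_2\<close> and \<open>signed_V4_3\<close> correspond to the vanishing of the first,
  respectively the first and second, superdiagonals.\<close>

definition signed_V4 :: "(bool \<times> bool \<times> (bool \<Rightarrow> bool \<Rightarrow> bool)) monoid" where
  "signed_V4 = \<lparr>carrier = {(a, b, e). parity4 e = a},
     monoid.mult = (\<lambda>(a, b, e) (a', b', e').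
       (a \<noteq> a', b \<noteq> b', \<lambda>p q. e' p q \<noteq> e (p \<noteq> a') (q \<noteq> b'))),
     one = (False, False, \<lambda>_ _. False)\<rparr>"

lemma carrier_signed_V4 [simp]: "(a, b, e) \<in> carrier signed_V4 \<longleftrightarrow> parity4 e = a"
  and one_signed_V4 [simp]: "\<one>\<^bsub>signed_V4\<^esub> = (False, False, \<lambda>_ _. False)"
  and mult_signed_V4 [simp]:
    "(a, b, e) \<otimes>\<^bsub>signed_V4\<^esub> (a', b', e') =
       (a \<noteq> a', b \<noteq> b', \<lambda>p q. e' p q \<noteq> e (p \<noteq> a') (q \<noteq> b'))"
  by (simp_all add: signed_V4_def)

lemma parity4_shift: "parity4 (\<lambda>p q. e (p \<noteq> a) (q \<noteq> b)) = parity4 e"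
  and parity4_xor: "parity4 (\<lambda>p q. e p q \<noteq> e' p q) = (parity4 e \<noteq> parity4 e')"
  and parity4_const: "parity4 (\<lambda>_ _. k) = False"
  by (cases a; cases b; simp add: parity4_def; blast) (simp_all add: parity4_def, blast+)

lemma group_signed_V4: "group signed_V4"
proof (rule groupI)
  fix g assume "g \<in> carrier signed_V4"
  moreover obtain a b e where "g = (a, b, e)" by (cases g)
  ultimately show "\<exists>h\<in>carrier signed_V4. h \<otimes>\<^bsub>signed_V4\<^esub> g = \<one>\<^bsub>signed_V4\<^esub>"
    by (intro bexI[of _ "(a, b, \<lambda>p q. e (p \<noteq> a) (q \<noteq> b))"]; cases a; cases b)
      (auto simp: parity4_def fun_eq_iff)
next
  fix g h assume "g \<in> carrier signed_V4" "h \<in> carrier signed_V4"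
  then show "g \<otimes>\<^bsub>signed_V4\<^esub> h \<in> carrier signed_V4"
    by (cases g; cases h) (simp only: mult_signed_V4 carrier_signed_V4 parity4_xor parity4_shift, blast)
next
  fix g h k
  show "g \<otimes>\<^bsub>signed_V4\<^esub> h \<otimes>\<^bsub>signed_V4\<^esub> k = g \<otimes>\<^bsub>signed_V4\<^esub> (h \<otimes>\<^bsub>signed_V4\<^esub> k)"
  proof (cases g; cases h; cases k)
    fix a b e a' b' e' a'' b'' e''
    assume *: "g = (a, b, e)" "h = (a', b', e')" "k = (a'', b'', e'')"
    have "((p \<noteq> a'') \<noteq> a') = (p \<noteq> (a' \<noteq> a''))" for p a' a'' :: bool by auto
    then show ?thesis unfolding * mult_signed_V4 by (auto simp: fun_eq_iff)
  qed
qed (auto simp: parity4_const split_paired_all)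

lemma inv_signed_V4 [simp]:
  "parity4 e = a \<Longrightarrow> inv\<^bsub>signed_V4\<^esub> (a, b, e) = (a, b, \<lambda>p q. e (p \<noteq> a) (q \<noteq> b))"
  by (rule group.inv_equality[OF group_signed_V4]; cases a; cases b)
    (auto simp: parity4_def fun_eq_iff)

text \<open>The sign function and \<open>b\<close> are free, giving 16 times 2, and the parity
  condition determines \<open>a\<close>. Being a power of 2, the order lets homomorphisms factor
  through the maximal pro-2 quotient.\<close>

lemma card_signed_V4: "card (carrier signed_V4) = 32"
proof -
  let ?f = "\<lambda>(b::bool, w, x, y, z). ((((w \<noteq> x) \<noteq> y) \<noteq> z), b,
    \<lambda>p q. if p then (if q then z else y) else (if q then x else (w::bool)))"
  have inj: "inj ?f"
    by (rule injI) (auto simp: fun_eq_iff all_bool_eq split: prod.splits)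
  have "carrier signed_V4 = range ?f"
  proof (intro equalityI subsetI)
    fix g assume g: "g \<in> carrier signed_V4"
    obtain a b e where *: "g = (a, b, e)" by (cases g)
    have "e = (\<lambda>p q. if p then (if q then e True True else e True False)
        else (if q then e False True else e False False))"
      by (auto simp: fun_eq_iff all_bool_eq)
    then have "g = ?f (b, e False False, e False True, e True False, e True True)"
      using g by (auto simp: * parity4_def)
    then show "g \<in> range ?f" by blast
  qed (auto simp: parity4_def)
  then have "card (carrier signed_V4) = CARD(bool \<times> bool \<times> bool \<times> bool \<times> bool)"
    using card_image[OF inj] by (simp only:)
  then show ?thesis by simp
qed

definition signed_V4_2 :: "(bool \<times> bool \<times> (bool \<Rightarrow> bool \<Rightarrow> bool)) set" where
  "signed_V4_2 = {(a, b, e). \<not> a \<and> \<not> b \<and> \<not> parity4 e}"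

definition signed_V4_3 :: "(bool \<times> bool \<times> (bool \<Rightarrow> bool \<Rightarrow> bool)) set" where
  "signed_V4_3 = {(a, b, e). \<not> a \<and> \<not> b \<and> (\<exists>k. e = (\<lambda>_ _. k))}"

lemma mem_signed_V4_2 [simp]: "(a, b, e) \<in> signed_V4_2 \<longleftrightarrow> \<not> a \<and> \<not> b \<and> \<not> parity4 e"
  and mem_signed_V4_3 [simp]: "(a, b, e) \<in> signed_V4_3 \<longleftrightarrow> \<not> a \<and> \<not> b \<and> (\<exists>k. e = (\<lambda>_ _. k))"
  by (simp_all add: signed_V4_2_def signed_V4_3_def)

lemma commutator_signed_V4:
  assumes "parity4 e = a" "parity4 e' = a'"
  shows "commutator signed_V4 (a, b, e) (a', b', e') = (False, False,
    \<lambda>p q. (e' p q \<noteq> e' (p \<noteq> a) (q \<noteq> b)) \<noteq> (e p q \<noteq> e (p \<noteq> a') (q \<noteq> b')))"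
proof -
  have "(\<lambda>p q. e' p q \<noteq> (e (p \<noteq> a') (q \<noteq> b') \<noteq>
      (e' (((p \<noteq> a') \<noteq> a) \<noteq> a') (((q \<noteq> b') \<noteq> b) \<noteq> b') \<noteq>
       e ((((p \<noteq> a') \<noteq> a) \<noteq> a') \<noteq> a) ((((q \<noteq> b') \<noteq> b) \<noteq> b') \<noteq> b)))) =
    (\<lambda>p q. (e' p q \<noteq> e' (p \<noteq> a) (q \<noteq> b)) \<noteq> (e p q \<noteq> e (p \<noteq> a') (q \<noteq> b')))"
    by (cases a; cases a'; cases b; cases b') (auto simp: fun_eq_iff)
  then show ?thesis
    unfolding commutator_def inv_signed_V4[OF assms(1)] inv_signed_V4[OF assms(2)] mult_signed_V4
    by (auto simp: fun_eq_iff)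
qed

lemma signed_V4_2_square: "g \<in> signed_V4_2 \<Longrightarrow> g \<otimes>\<^bsub>signed_V4\<^esub> g = \<one>\<^bsub>signed_V4\<^esub>"
  by (cases g) auto

text \<open>Parity zero means that \<open>e'\<close> has no \<open>p q\<close> term. It is thus
  affine, and its difference along any translation is constant.\<close>

lemma commutator_signed_V4_2:
  assumes "g \<in> carrier signed_V4" "h \<in> signed_V4_2"
  shows "commutator signed_V4 g h \<in> signed_V4_3" "commutator signed_V4 h g \<in> signed_V4_3"
proof -
  obtain a b e e' where gh: "g = (a, b, e)" "h = (False, False, e')"
    by (cases g; cases h) (use assms in auto)
  have p: "parity4 e = a" "parity4 e' = False" using assms by (auto simp: gh)
  have c: "e' p q \<noteq> e' (p \<noteq> a) (q \<noteq> b) \<longleftrightarrow> e' False False \<noteq> e' a b" for p q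
    using p(2) by (cases a; cases b; cases p; cases q) (auto simp: parity4_def)
  show "commutator signed_V4 g h \<in> signed_V4_3" "commutator signed_V4 h g \<in> signed_V4_3"
    unfolding gh commutator_signed_V4[OF p] commutator_signed_V4[OF p(2,1)] mem_signed_V4_3 c
    by auto
qed

lemma commutator_signed_V4_2_2:
  assumes "g \<in> signed_V4_2" "h \<in> signed_V4_2"
  shows "commutator signed_V4 g h = \<one>\<^bsub>signed_V4\<^esub>"
  using assms by (cases g; cases h) (auto simp: commutator_signed_V4)

lemma commutator_signed_V4_3:
  assumes "g \<in> carrier signed_V4" "h \<in> signed_V4_3"
  shows "commutator signed_V4 g h = \<one>\<^bsub>signed_V4\<^esub>" "commutator signed_V4 h g = \<one>\<^bsub>signed_V4\<^esub>"
  using assms by (cases g; cases h; auto simp: commutator_signed_V4 parity4_const)+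

lemma signed_V4_2_3_subgroup:
  shows "subgroup signed_V4_2 signed_V4" "subgroup signed_V4_3 signed_V4"
proof -
  show "subgroup signed_V4_2 signed_V4"
  proof (rule group.subgroupI[OF group_signed_V4])
    show "signed_V4_2 \<noteq> {}"
      using parity4_const[of False] by (auto simp: signed_V4_2_def)
    show "inv\<^bsub>signed_V4\<^esub> g \<in> signed_V4_2" if "g \<in> signed_V4_2" for g
      using that by (cases g) auto
    show "g \<otimes>\<^bsub>signed_V4\<^esub> h \<in> signed_V4_2" if "g \<in> signed_V4_2" "h \<in> signed_V4_2" for g h
      using that parity4_xor by (cases g; cases h) auto
  qed (auto simp: split_paired_all)
  show "subgroup signed_V4_3 signed_V4"
    by (rule group.subgroupI[OF group_signed_V4]) (auto simp: signed_V4_3_def parity4_const)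
qed

text \<open>The sign function \<open>k\<close> of the inner commutator is the difference of
  \<open>e\<close> in the second variable plus that of \<open>e'\<close> in the first. As
  \<open>e\<close> has the term \<open>p q\<close> and \<open>e'\<close> does not, \<open>k\<close>
  is \<open>p\<close> plus a constant: its difference is 1 in the first direction and 0 in the
  second, whatever \<open>e\<close> and \<open>e'\<close> are.\<close>

lemma signed_V4_triple_commutator:
  assumes "(True, False, e) \<in> carrier signed_V4" "(False, True, e') \<in> carrier signed_V4"
    and "g = (True, False, e) \<and> h = (False, True, e') \<or> h = (True, False, e) \<and> g = (False, True, e')"
  shows "commutator signed_V4 (commutator signed_V4 g h) (True, False, e) = (False, False, \<lambda>_ _. True)"
    and "commutator signed_V4 (commutator signed_V4 g h) (False, True, e') = \<one>\<^bsub>signed_V4\<^esub>"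
proof -
  have p: "parity4 e = True" "parity4 e' = False" using assms by auto
  define k where "k = (\<lambda>p q. (e p q \<noteq> e p (\<not> q)) \<noteq> (e' p q \<noteq> e' (\<not> p) q))"
  have gh: "commutator signed_V4 g h = (False, False, k)"
    using assms(3) p by (auto simp: commutator_signed_V4 k_def fun_eq_iff)
  have pk: "parity4 k = False" unfolding k_def by (auto simp: parity4_def)
  have c1: "k p q \<noteq> k (\<not> p) q" for p q
    using p unfolding k_def parity4_def by (cases p; cases q) auto
  have "(\<lambda>p q. (e p q \<noteq> e (p \<noteq> False) (q \<noteq> False)) \<noteq> (k p q \<noteq> k (p \<noteq> True) (q \<noteq> False))) = (\<lambda>_ _. True)"
  proof (intro ext)
    fix p q
    show "((e p q \<noteq> e (p \<noteq> False) (q \<noteq> False)) \<noteq> (k p q \<noteq> k (p \<noteq> True) (q \<noteq> False))) = True"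
      using c1[of p q] by simp
  qed
  then show "commutator signed_V4 (commutator signed_V4 g h) (True, False, e) = (False, False, \<lambda>_ _. True)"
    unfolding gh commutator_signed_V4[OF pk p(1)] by simp
  have c2: "k p q = k p (\<not> q)" for p q
    using p unfolding k_def parity4_def by (cases p; cases q) auto
  have "(\<lambda>p q. (e' p q \<noteq> e' (p \<noteq> False) (q \<noteq> False)) \<noteq> (k p q \<noteq> k (p \<noteq> False) (q \<noteq> True))) = (\<lambda>_ _. False)"
  proof (intro ext)
    fix p q
    show "((e' p q \<noteq> e' (p \<noteq> False) (q \<noteq> False)) \<noteq> (k p q \<noteq> k (p \<noteq> False) (q \<noteq> True))) = False"
      using c2[of p q] by simp
  qed
  then show "commutator signed_V4 (commutator signed_V4 g h) (False, True, e') = \<one>\<^bsub>signed_V4\<^esub>"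
    unfolding gh commutator_signed_V4[OF pk p(2)] by simp
qed

definition heis_2 :: "(bool \<times> bool \<times> bool \<times> bool) set" where
  "heis_2 = {(a, b, c, d). \<not> a \<and> \<not> b}"

lemma mem_heis_2 [simp]: "(a, b, c, d) \<in> heis_2 \<longleftrightarrow> \<not> a \<and> \<not> b"
  by (simp add: heis_2_def)

text \<open>The \<open>c\<close> corner of a commutator is zero because its two superdiagonal
  entries coincide; that corner detects squares instead.\<close>

lemma commutator_heis:
  "commutator heis (a, b, c, d) (a', b', c', d') = (False, False, False, (a \<and> b') \<noteq> (a' \<and> b))"
  by (auto simp: commutator_def)

section \<open>Continuous homomorphisms to finite groups\<close>

text \<open>The target is understood to be discrete, so every subset of it must have an open
  preimage.\<close>

definition continuous_hom ::
    "('a, 'm) monoid_scheme \<Rightarrow> 'a topology \<Rightarrow> ('b, 'n) monoid_scheme \<Rightarrow> ('a \<Rightarrow> 'b) \<Rightarrow> bool" where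
  "continuous_hom G T Q \<phi> \<longleftrightarrow> \<phi> \<in> hom G Q \<and> (\<forall>A. openin T {x \<in> carrier G. \<phi> x \<in> A})"

lemma continuous_homD:
  assumes "continuous_hom G T Q \<phi>" "group G" "group Q"
  shows "group_hom G Q \<phi>" "\<And>A. openin T {x \<in> carrier G. \<phi> x \<in> A}"
  using assms by (auto simp: continuous_hom_def group_hom_def group_hom_axioms_def)

lemma (in group_hom) hom_commutator:
  "x \<in> carrier G \<Longrightarrow> y \<in> carrier G \<Longrightarrow> h (commutator G x y) = commutator H (h x) (h y)"
  by (simp add: commutator_def)

lemma (in group) commutator_closed [simp, intro]:
  "x \<in> carrier G \<Longrightarrow> y \<in> carrier G \<Longrightarrow> commutator G x y \<in> carrier G"
  by (simp add: commutator_def)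

lemma continuous_hom_closedin:
  assumes "continuous_hom G T Q \<phi>" "topspace T = carrier G"
  shows "closedin T {x \<in> carrier G. \<phi> x \<in> A}"
proof -
  have "topspace T - {x \<in> carrier G. \<phi> x \<in> A} = {x \<in> carrier G. \<phi> x \<in> - A}"
    using assms(2) by auto
  moreover have "openin T {x \<in> carrier G. \<phi> x \<in> - A}"
    using assms(1) unfolding continuous_hom_def by blast
  ultimately show ?thesis
    using assms(2) by (auto simp: closedin_def)
qed

lemma closed_subgroup_generated_subset:
  assumes "continuous_hom G T Q \<phi>" "topspace T = carrier G" "group G" "group Q" "subgroup P Q"
    and "A \<subseteq> {x \<in> carrier G. \<phi> x \<in> P}"
  shows "closed_subgroup_generated G T A \<subseteq> {x \<in> carrier G. \<phi> x \<in> P}"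
proof -
  interpret group_hom G Q \<phi> using continuous_homD assms by blast
  have "subgroup {x \<in> carrier G. \<phi> x \<in> P} G"
    by (rule G.subgroupI)
      (use assms(5) subgroup.one_closed subgroup.m_closed subgroup.m_inv_closed in \<open>fastforce+\<close>)
  then show ?thesis
    unfolding closed_subgroup_generated_def
    using continuous_hom_closedin[OF assms(1,2)] assms(6) by blast
qed

lemma set_mult_preimage_subset:
  assumes "group_hom G Q \<phi>" "subgroup P Q"
    and "A \<subseteq> {x \<in> carrier G. \<phi> x \<in> P}" "B \<subseteq> {x \<in> carrier G. \<phi> x \<in> P}"
  shows "A <#>\<^bsub>G\<^esub> B \<subseteq> {x \<in> carrier G. \<phi> x \<in> P}"
proof -
  interpret group_hom G Q \<phi> by fact
  show ?thesis
    using assms(3,4) subgroup.m_closed[OF assms(2)] by (fastforce simp: set_mult_def)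
qed

text \<open>\<open>Q2\<close> and \<open>Q3\<close> bound the images of the second and third terms
  from above. Rounding up, 3/2 and 4/2 both give 2, so the third and fourth terms involve squares of
  the second term only. Commutators are needed in both orders because the defining product runs over
  all pairs of positive indices.\<close>

lemma zassenhaus_4_killed:
  assumes \<phi>: "continuous_hom G T Q \<phi>" and T: "topspace T = carrier G"
    and G: "group G" and Q: "group Q" and Q2: "subgroup Q2 Q" and Q3: "subgroup Q3 Q"
    and sq: "\<And>g. g \<in> carrier Q \<Longrightarrow> g \<otimes>\<^bsub>Q\<^esub> g \<in> Q2"
    and comm: "\<And>g h. g \<in> carrier Q \<Longrightarrow> h \<in> carrier Q \<Longrightarrow> commutator Q g h \<in> Q2"
    and sq2: "\<And>g. g \<in> Q2 \<Longrightarrow> g \<otimes>\<^bsub>Q\<^esub> g = \<one>\<^bsub>Q\<^esub>"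
    and comm2: "\<And>g h. g \<in> carrier Q \<Longrightarrow> h \<in> Q2 \<Longrightarrow> commutator Q g h \<in> Q3 \<and> commutator Q h g \<in> Q3"
    and comm22: "\<And>g h. g \<in> Q2 \<Longrightarrow> h \<in> Q2 \<Longrightarrow> commutator Q g h = \<one>\<^bsub>Q\<^esub>"
    and comm3: "\<And>g h. g \<in> carrier Q \<Longrightarrow> h \<in> Q3 \<Longrightarrow>
                  commutator Q g h = \<one>\<^bsub>Q\<^esub> \<and> commutator Q h g = \<one>\<^bsub>Q\<^esub>"
    and z: "z \<in> zassenhaus G T 4"
  shows "z \<in> carrier G \<and> \<phi> z = \<one>\<^bsub>Q\<^esub>"
proof -
  interpret group_hom G Q \<phi> using continuous_homD \<phi> G Q by blast
  have Q1: "subgroup {\<one>\<^bsub>Q\<^esub>} Q" by (rule H.triv_subgroup)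
  note csg = closed_subgroup_generated_subset[OF \<phi> T G Q]
  note smp = set_mult_preimage_subset[OF group_hom_axioms]
  have square: "closed_square_subgroup G T A \<subseteq> {x \<in> carrier G. \<phi> x \<in> P}"
    if "subgroup P Q" "A \<subseteq> carrier G" "\<And>g. g \<in> A \<Longrightarrow> \<phi> g \<otimes>\<^bsub>Q\<^esub> \<phi> g \<in> P" for A P
    unfolding closed_square_subgroup_def
    by (rule csg[OF that(1)]) (use that(2,3) in \<open>auto simp: numeral_2_eq_2\<close>)
  have comms: "closed_commutator_subgroup G T A B \<subseteq> {x \<in> carrier G. \<phi> x \<in> P}"
    if "subgroup P Q" "A \<subseteq> carrier G" "B \<subseteq> carrier G"
      "\<And>g h. g \<in> A \<Longrightarrow> h \<in> B \<Longrightarrow> commutator Q (\<phi> g) (\<phi> h) \<in> P" for A B P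
    unfolding closed_commutator_subgroup_def
    by (rule csg[OF that(1)]) (use that(2-4) in \<open>auto simp: hom_commutator subset_iff\<close>)
  have l3: "[Suc 0..<3] = [1, 2]" and l4: "[Suc 0..<4] = [1, 2, 3]" by (simp_all add: upt_rec)
  have Z1: "zassenhaus G T 1 = carrier G" by (subst zassenhaus.simps) simp
  have Z2: "zassenhaus G T 2 \<subseteq> {x \<in> carrier G. \<phi> x \<in> Q2}"
  proof -
    have "zassenhaus G T 2 = closed_square_subgroup G T (zassenhaus G T 1)
        <#>\<^bsub>G\<^esub> closed_commutator_subgroup G T (zassenhaus G T 1) (zassenhaus G T 1)"
      by (subst zassenhaus.simps) (simp add: upt_rec)
    also have "\<dots> \<subseteq> {x \<in> carrier G. \<phi> x \<in> Q2}"
      unfolding Z1 by (intro smp[OF Q2] square[OF Q2] comms[OF Q2]) (auto intro: sq comm)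
    finally show ?thesis .
  qed
  have Z2c: "g \<in> carrier G" and Z2q: "\<phi> g \<in> Q2" if "g \<in> zassenhaus G T 2" for g
    using that Z2 by auto
  have Z3: "zassenhaus G T 3 \<subseteq> {x \<in> carrier G. \<phi> x \<in> Q3}"
  proof -
    have "zassenhaus G T 3 = closed_square_subgroup G T (zassenhaus G T 2)
        <#>\<^bsub>G\<^esub> closed_commutator_subgroup G T (zassenhaus G T 1) (zassenhaus G T 2)
        <#>\<^bsub>G\<^esub> closed_commutator_subgroup G T (zassenhaus G T 2) (zassenhaus G T 1)"
      by (subst zassenhaus.simps) (simp add: l3)
    also have "\<dots> \<subseteq> {x \<in> carrier G. \<phi> x \<in> Q3}"
      unfolding Z1 by (intro smp[OF Q3] square[OF Q3] comms[OF Q3])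
        (auto simp: Z2c Z2q sq2 comm2 subgroup.one_closed[OF Q3])
    finally show ?thesis .
  qed
  have Z3c: "g \<in> carrier G" and Z3q: "\<phi> g \<in> Q3" if "g \<in> zassenhaus G T 3" for g
    using that Z3 by auto
  have "zassenhaus G T 4 = closed_square_subgroup G T (zassenhaus G T 2)
      <#>\<^bsub>G\<^esub> closed_commutator_subgroup G T (zassenhaus G T 1) (zassenhaus G T 3)
      <#>\<^bsub>G\<^esub> closed_commutator_subgroup G T (zassenhaus G T 2) (zassenhaus G T 2)
      <#>\<^bsub>G\<^esub> closed_commutator_subgroup G T (zassenhaus G T 3) (zassenhaus G T 1)"
    by (subst zassenhaus.simps) (simp add: l4)
  also have "\<dots> \<subseteq> {x \<in> carrier G. \<phi> x \<in> {\<one>\<^bsub>Q\<^esub>}}"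
    unfolding Z1 by (intro smp[OF Q1] square[OF Q1] comms[OF Q1])
      (auto simp: Z2c Z2q Z3c Z3q sq2 comm22 comm3)
  finally show ?thesis using z by blast
qed

text \<open>At most the factor at \<open>u\<close> has a nontrivial image, so the order of the
  factors does not affect the result. Linearity of \<open>L\<close> is what makes the sorted list in
  the definition exist uniquely.\<close>

lemma ordered_finite_product_image:
  assumes L: "irrefl L" "trans L" "total L" and F: "finite F" "F \<subseteq> A"
    and \<phi>: "group_hom G Q \<phi>" and f: "\<And>t. t \<in> A \<Longrightarrow> f t \<in> carrier G"
    and triv: "\<And>t. t \<in> A \<Longrightarrow> t \<noteq> u \<Longrightarrow> \<phi> (f t) = \<one>\<^bsub>Q\<^esub>"
  shows "\<phi> (ordered_finite_product G L f F) = (if u \<in> F then \<phi> (f u) else \<one>\<^bsub>Q\<^esub>)"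
proof -
  interpret group_hom G Q \<phi> by fact
  interpret lin: linorder "\<lambda>u v. u = v \<or> (u, v) \<in> L" "\<lambda>u v. (u, v) \<in> L"
    by unfold_locales (use L in \<open>auto simp: irrefl_def total_on_def dest: transD\<close>)
  let ?js = "THE js. set js = F \<and> sorted_wrt (\<lambda>u v. (u, v) \<in> L) js"
  have "\<exists>!js. set js = F \<and> sorted_wrt (\<lambda>u v. (u, v) \<in> L) js"
    using lin.finite_set_strict_sorted[OF F(1)] lin.strict_sorted_equal by metis
  then have js: "set ?js = F" "sorted_wrt (\<lambda>u v. (u, v) \<in> L) ?js"
    using theI'[of "\<lambda>js. set js = F \<and> sorted_wrt (\<lambda>u v. (u, v) \<in> L) js"] by blast+
  then have "distinct ?js" using lin.strict_sorted_iff by blast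
  have "foldr (\<lambda>j z. f j \<otimes>\<^bsub>G\<^esub> z) js \<one>\<^bsub>G\<^esub> \<in> carrier G \<and>
      \<phi> (foldr (\<lambda>j z. f j \<otimes>\<^bsub>G\<^esub> z) js \<one>\<^bsub>G\<^esub>) = (if u \<in> set js then \<phi> (f u) else \<one>\<^bsub>Q\<^esub>)"
    if "set js \<subseteq> A" "distinct js" for js
    using that
  proof (induction js)
    case (Cons a js)
    then show ?case using f[of a] f[of u] triv[of a] by (cases "a = u") (auto simp: subset_iff)
  qed simp
  from this[OF _ \<open>distinct ?js\<close>] show ?thesis
    unfolding ordered_finite_product_def js(1) using F(2) by simp
qed

text \<open>The subproducts eventually enter the open set where \<open>\<phi>\<close> takes the
  value \<open>\<phi> z\<close>. Adding \<open>u\<close> to a late finite stage makes that stage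
  compute the value.\<close>

lemma has_ordered_product_image:
  assumes prod: "has_ordered_product G T L f A z" and L: "irrefl L" "trans L" "total L"
    and \<phi>: "continuous_hom G T Q \<phi>" "group G" "group Q" "topspace T = carrier G"
    and f: "\<And>t. t \<in> A \<Longrightarrow> f t \<in> carrier G"
    and triv: "\<And>t. t \<in> A \<Longrightarrow> t \<noteq> u \<Longrightarrow> \<phi> (f t) = \<one>\<^bsub>Q\<^esub>"
  shows "z \<in> carrier G" and "\<phi> z = (if u \<in> A then \<phi> (f u) else \<one>\<^bsub>Q\<^esub>)"
proof -
  show z: "z \<in> carrier G"
    using prod \<phi>(4) by (simp add: has_ordered_product_def limitin_def)
  let ?U = "{x \<in> carrier G. \<phi> x \<in> {\<phi> z}}"
  have "openin T ?U" using continuous_homD(2)[OF \<phi>(1,2,3)] .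
  then have "eventually (\<lambda>F. ordered_finite_product G L f F \<in> ?U) (finite_subsets_at_top A)"
    using prod z unfolding has_ordered_product_def limitin_def by blast
  then have "\<exists>B. finite B \<and> B \<subseteq> A \<and>
      (\<forall>F. finite F \<and> B \<subseteq> F \<and> F \<subseteq> A \<longrightarrow> ordered_finite_product G L f F \<in> ?U)"
    by (simp only: eventually_finite_subsets_at_top)
  then obtain B where B: "finite B" "B \<subseteq> A"
    and B': "\<forall>F. finite F \<and> B \<subseteq> F \<and> F \<subseteq> A \<longrightarrow> ordered_finite_product G L f F \<in> ?U"
    by (elim exE conjE) (rule that)
  define F where "F = (if u \<in> A then insert u B else B)"
  have F: "finite F" "B \<subseteq> F" "F \<subseteq> A" "u \<in> F \<longleftrightarrow> u \<in> A"
    using B by (auto simp: F_def)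
  have "\<phi> z = \<phi> (ordered_finite_product G L f F)" using B'[THEN spec, of F] F(1-3) by simp
  also have "\<dots> = (if u \<in> F then \<phi> (f u) else \<one>\<^bsub>Q\<^esub>)"
    by (rule ordered_finite_product_image[OF L F(1,3) continuous_homD(1)[OF \<phi>(1-3)] f triv])
  finally show "\<phi> z = (if u \<in> A then \<phi> (f u) else \<one>\<^bsub>Q\<^esub>)" using F(4) by simp
qed

lemma less_rel_strict_linear: "irrefl (less_rel :: ('i::linorder \<times> 'i) set)"
  "trans (less_rel :: ('i \<times> 'i) set)" "total (less_rel :: ('i \<times> 'i) set)"
  by (auto simp: irrefl_def trans_def total_on_def)

lemma irrefl_lex_prod: "irrefl r \<Longrightarrow> irrefl s \<Longrightarrow> irrefl (r <*lex*> s)"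
  by (auto simp: irrefl_def)

text \<open>Evaluates a relation under a homomorphism for which all occurring factors die, except
  possibly the triple commutator at \<open>u\<close>.\<close>

lemma canonical_decomposition_image:
  fixes x :: "'i::wellorder \<Rightarrow> 's"
  assumes dec: "canonical_decomposition S T x s a b c"
    and \<phi>: "continuous_hom S T Q \<phi>" "group S" "group Q" "topspace T = carrier S"
    and x: "\<And>l. x l \<in> carrier S"
    and z4: "\<And>z. z \<in> zassenhaus S T 4 \<Longrightarrow> z \<in> carrier S \<and> \<phi> z = \<one>\<^bsub>Q\<^esub>"
    and t1: "\<And>l. a l = 1 \<Longrightarrow> \<phi> (x l) \<otimes>\<^bsub>Q\<^esub> \<phi> (x l) = \<one>\<^bsub>Q\<^esub>"
    and t2: "\<And>l m. l < m \<Longrightarrow> b l m = 1 \<Longrightarrow> commutator Q (\<phi> (x l)) (\<phi> (x m)) = \<one>\<^bsub>Q\<^esub>"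
    and t3: "\<And>l m k. l < m \<Longrightarrow> k \<le> m \<Longrightarrow> c l m k = 1 \<Longrightarrow> (l, m, k) \<noteq> u \<Longrightarrow>
      commutator Q (commutator Q (\<phi> (x l)) (\<phi> (x m))) (\<phi> (x k)) = \<one>\<^bsub>Q\<^esub>"
    and u: "u = (l0, m0, k0)" "l0 < m0" "k0 \<le> m0"
  shows "s \<in> carrier S" and "\<phi> s = (if c l0 m0 k0 = 1
    then commutator Q (commutator Q (\<phi> (x l0)) (\<phi> (x m0))) (\<phi> (x k0)) else \<one>\<^bsub>Q\<^esub>)"
proof -
  interpret group_hom S Q \<phi> using continuous_homD(1)[OF \<phi>(1-3)] .
  note lin = less_rel_strict_linear
  have pow: "g [^]\<^bsub>Q\<^esub> n = (if n = 1 then g else \<one>\<^bsub>Q\<^esub>)" if "g \<in> carrier Q" "n \<in> {0, 1}" for g and n :: nat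
    using that by auto
  have ab: "a l \<in> {0, 1}" "l < m \<Longrightarrow> b l m \<in> {0, 1}" "l < m \<Longrightarrow> k \<le> m \<Longrightarrow> c l m k \<in> {0, 1}" for l m k
    using dec by (auto simp: canonical_decomposition_def)
  obtain z1 z2 z3 r' where z:
    "has_ordered_product S T less_rel (\<lambda>i. x i [^]\<^bsub>S\<^esub> (2 * a i)) UNIV z1"
    "has_ordered_product S T (less_rel <*lex*> less_rel)
          (\<lambda>(i, j). commutator S (x i) (x j) [^]\<^bsub>S\<^esub> b i j) {(i, j). i < j} z2"
    "has_ordered_product S T (less_rel <*lex*> less_rel <*lex*> less_rel)
          (\<lambda>(i, j, k). commutator S (commutator S (x i) (x j)) (x k) [^]\<^bsub>S\<^esub> c i j k)
          {(i, j, k). i < j \<and> k \<le> j} z3"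
    "r' \<in> zassenhaus S T 4" "s = z1 \<otimes>\<^bsub>S\<^esub> z2 \<otimes>\<^bsub>S\<^esub> z3 \<otimes>\<^bsub>S\<^esub> r'"
    using dec unfolding canonical_decomposition_def by blast
  have f1: "\<phi> (x l [^]\<^bsub>S\<^esub> (2 * a l)) = \<one>\<^bsub>Q\<^esub>" for l
    using ab(1)[of l] t1[of l] x[of l] by (auto simp: hom_nat_pow numeral_2_eq_2)
  have f2: "\<phi> (commutator S (x l) (x m) [^]\<^bsub>S\<^esub> b l m) = \<one>\<^bsub>Q\<^esub>" if "l < m" for l m
    using ab(2)[of l m] t2[of l m] x that by (auto simp: hom_nat_pow hom_commutator)
  have f3: "\<phi> (commutator S (commutator S (x l) (x m)) (x k) [^]\<^bsub>S\<^esub> c l m k) =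
      (if c l m k = 1 then commutator Q (commutator Q (\<phi> (x l)) (\<phi> (x m))) (\<phi> (x k)) else \<one>\<^bsub>Q\<^esub>)"
    if "l < m" "k \<le> m" for l m k
    using ab(3)[of l m k] x that by (auto simp: hom_nat_pow hom_commutator)
  \<comment> \<open>In the first two products every factor dies, so the distinguished index passed
    there is arbitrary.\<close>
  have "z1 \<in> carrier S \<and> \<phi> z1 = \<one>\<^bsub>Q\<^esub>"
    using has_ordered_product_image[OF z(1) lin \<phi>, where u = l0] x f1 by auto
  moreover have "z2 \<in> carrier S \<and> \<phi> z2 = \<one>\<^bsub>Q\<^esub>"
    using has_ordered_product_image[OF z(2) _ _ _ \<phi>, where u = "(l0, m0)"] x f2 u
    by (auto simp: irrefl_lex_prod lin trans_lex_prod total_lex_prod split: prod.splits)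
  moreover have "z3 \<in> carrier S \<and> \<phi> z3 = (if c l0 m0 k0 = 1
    then commutator Q (commutator Q (\<phi> (x l0)) (\<phi> (x m0))) (\<phi> (x k0)) else \<one>\<^bsub>Q\<^esub>)"
    using has_ordered_product_image[OF z(3) _ _ _ \<phi>, where u = u] x f3 t3 u
    by (auto simp: irrefl_lex_prod lin trans_lex_prod total_lex_prod split: prod.splits)
  ultimately show "s \<in> carrier S" and "\<phi> s = (if c l0 m0 k0 = 1
    then commutator Q (commutator Q (\<phi> (x l0)) (\<phi> (x m0))) (\<phi> (x k0)) else \<one>\<^bsub>Q\<^esub>)"
    using z(4,5) z4[OF z(4)] x by auto
qed

lemma signed_V4_zassenhaus_4_killed:
  assumes "continuous_hom G T signed_V4 \<phi>" "topspace T = carrier G" "group G"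
    and "z \<in> zassenhaus G T 4"
  shows "z \<in> carrier G \<and> \<phi> z = \<one>\<^bsub>signed_V4\<^esub>"
proof (rule zassenhaus_4_killed[OF assms(1-3) group_signed_V4 signed_V4_2_3_subgroup])
  interpret group signed_V4 by (rule group_signed_V4)
  show "g \<otimes>\<^bsub>signed_V4\<^esub> g \<in> signed_V4_2" if "g \<in> carrier signed_V4" for g
    using m_closed[OF that that] by (cases g) auto
  show "commutator signed_V4 g h \<in> signed_V4_2"
    if "g \<in> carrier signed_V4" "h \<in> carrier signed_V4" for g h
    using commutator_closed[OF that] that by (cases g; cases h) (auto simp: commutator_signed_V4)
qed (use assms(4) in \<open>auto simp: signed_V4_2_square commutator_signed_V4_2 commutator_signed_V4_2_2
  commutator_signed_V4_3 simp del: one_signed_V4\<close>)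

text \<open>Squares and commutators lie in \<open>heis_2\<close>, which is central of exponent 2, so
  the trivial group already bounds the third term.\<close>

lemma heis_zassenhaus_4_killed:
  assumes "continuous_hom G T heis \<phi>" "topspace T = carrier G" "group G"
    and "z \<in> zassenhaus G T 4"
  shows "z \<in> carrier G \<and> \<phi> z = \<one>\<^bsub>heis\<^esub>"
proof (rule zassenhaus_4_killed[OF assms(1-3) group_heis])
  show "subgroup heis_2 heis"
    by (rule group.subgroupI[OF group_heis]) (auto simp: heis_2_def)
  show "subgroup {\<one>\<^bsub>heis\<^esub>} heis" by (rule group.triv_subgroup[OF group_heis])
qed (use assms(4) in \<open>auto simp: split_paired_all commutator_heis\<close>)

section \<open>Homomorphisms on quotients, generated normal subgroups and pro-p kernels\<close>

lemma topspace_quotient_group_topology: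
  assumes "group G" "N \<lhd> G" "topspace T = carrier G"
  shows "topspace (quotient_group_topology G T N) = carrier (G Mod N)"
proof -
  have "\<Union>(carrier (G Mod N)) = carrier G"
    using group.rcosets_part_G[OF assms(1) normal_imp_subgroup[OF assms(2)]]
    by (simp add: FactGroup_def)
  then have "openin (quotient_group_topology G T N) (carrier (G Mod N))"
    using openin_topspace[of T] assms(3)
    by (simp add: openin_quotient_group_topology[OF assms(1,2)])
  moreover have "topspace (quotient_group_topology G T N) \<subseteq> carrier (G Mod N)"
    using openin_topspace[of "quotient_group_topology G T N"]
    unfolding openin_quotient_group_topology[OF assms(1,2)] by blast
  ultimately show ?thesis by (simp add: openin_subset subset_antisym)
qed

text \<open>Factor \<open>\<phi>\<close> through \<open>G Mod N\<close>, precompose with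
  \<open>h\<close>, and inflate to \<open>G'\<close>. Coset conditions describe the result, since
  \<open>h\<close> is known only on quotients; the lemma serves both directions of the
  isomorphism.\<close>

lemma continuous_hom_transport:
  assumes G: "group G" "N \<lhd> G" "topspace T = carrier G"
    and G': "group G'" "N' \<lhd> G'" "topspace T' = carrier G'"
    and Q: "group Q" and \<phi>: "continuous_hom G T Q \<phi>" "N \<subseteq> kernel G Q \<phi>"
    and h: "h \<in> hom (G' Mod N') (G Mod N)"
      "continuous_map (quotient_group_topology G' T' N') (quotient_group_topology G T N) h"
  obtains \<phi>' where "continuous_hom G' T' Q \<phi>'" "\<And>n. n \<in> N' \<Longrightarrow> \<phi>' n = \<one>\<^bsub>Q\<^esub>"
    "\<And>g g'. g \<in> carrier G \<Longrightarrow> g' \<in> carrier G' \<Longrightarrow>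
       h (N' #>\<^bsub>G'\<^esub> g') = N #>\<^bsub>G\<^esub> g \<Longrightarrow> \<phi>' g' = \<phi> g"
proof -
  interpret group_hom G Q \<phi> by (rule continuous_homD(1)[OF \<phi>(1) G(1) Q])
  interpret N: normal N G by (rule G(2))
  interpret N': normal N' G' by (rule G'(2))
  obtain \<psi> where \<psi>: "\<psi> \<in> hom (G Mod N) Q" "\<And>x. x \<in> carrier G \<Longrightarrow> \<psi> (N #>\<^bsub>G\<^esub> x) = \<phi> x"
    using FactGroup_universal_kernel[OF G(2) \<phi>(2)] by blast
  define \<phi>' where "\<phi>' g = \<psi> (h (N' #>\<^bsub>G'\<^esub> g))" for g
  have hom: "\<phi>' \<in> hom G' Q"
  proof -
    have "\<psi> \<circ> (h \<circ> (\<lambda>g. N' #>\<^bsub>G'\<^esub> g)) \<in> hom G' Q"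
      by (rule Group.hom_compose[OF Group.hom_compose[OF N'.r_coset_hom_Mod h(1)] \<psi>(1)])
    then show ?thesis by (simp add: \<phi>'_def[abs_def] o_def)
  qed
  show ?thesis
  proof (rule that)
    show "continuous_hom G' T' Q \<phi>'"
      unfolding continuous_hom_def
    proof (intro conjI allI hom)
      fix A
      let ?V = "{D \<in> carrier (G Mod N). \<psi> D \<in> A}"
      have "\<Union>?V = {x \<in> carrier G. \<phi> x \<in> A}"
      proof (intro equalityI subsetI)
        fix y assume "y \<in> \<Union>?V"
        then obtain g where g: "g \<in> carrier G" "\<psi> (N #>\<^bsub>G\<^esub> g) \<in> A" "y \<in> N #>\<^bsub>G\<^esub> g"
          by (auto simp: carrier_FactGroup)
        then have y: "y \<in> carrier G"
          using G.r_coset_subset_G[OF N.subset] by blast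
        have "N #>\<^bsub>G\<^esub> y = N #>\<^bsub>G\<^esub> g"
          using G.repr_independence[OF g(3,1) N.is_subgroup] by simp
        then have "\<phi> y = \<psi> (N #>\<^bsub>G\<^esub> g)" using \<psi>(2)[OF y] by simp
        then show "y \<in> {x \<in> carrier G. \<phi> x \<in> A}" using g(2) y by simp
      next
        fix y assume y: "y \<in> {x \<in> carrier G. \<phi> x \<in> A}"
        then have "y \<in> N #>\<^bsub>G\<^esub> y" using G.rcos_self[OF _ N.is_subgroup] by blast
        then show "y \<in> \<Union>?V"
          using y \<psi>(2) by (auto simp: carrier_FactGroup intro!: bexI[of _ "N #>\<^bsub>G\<^esub> y"])
      qed
      then have "openin (quotient_group_topology G T N) ?V"
        using continuous_homD(2)[OF \<phi>(1) G(1) Q, of A]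
        by (simp add: openin_quotient_group_topology[OF G(1,2)])
      then have "openin (quotient_group_topology G' T' N')
          {C \<in> carrier (G' Mod N'). h C \<in> ?V}" (is "openin _ ?W")
        using openin_continuous_map_preimage[OF h(2), of ?V]
        by (simp only: topspace_quotient_group_topology[OF G'])
      then have "openin T' (\<Union>?W)"
        by (simp add: openin_quotient_group_topology[OF G'(1,2)])
      moreover have "\<Union>?W = {x \<in> carrier G'. \<phi>' x \<in> A}"
      proof (intro equalityI subsetI)
        fix y assume "y \<in> \<Union>?W"
        then obtain g where g: "g \<in> carrier G'" "\<psi> (h (N' #>\<^bsub>G'\<^esub> g)) \<in> A" "y \<in> N' #>\<^bsub>G'\<^esub> g"
          by (auto simp: carrier_FactGroup)
        then have y: "y \<in> carrier G'"
          using N'.r_coset_subset_G[OF N'.subset] by blast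
        have "N' #>\<^bsub>G'\<^esub> y = N' #>\<^bsub>G'\<^esub> g"
          using N'.repr_independence[OF g(3,1) N'.is_subgroup] by simp
        then show "y \<in> {x \<in> carrier G'. \<phi>' x \<in> A}" using g y by (simp add: \<phi>'_def)
      next
        fix y assume y: "y \<in> {x \<in> carrier G'. \<phi>' x \<in> A}"
        then have "y \<in> N' #>\<^bsub>G'\<^esub> y" using N'.rcos_self[OF _ N'.is_subgroup] by blast
        moreover have "N' #>\<^bsub>G'\<^esub> y \<in> ?W"
          using y hom_in_carrier[OF h(1), of "N' #>\<^bsub>G'\<^esub> y"] by (auto simp: carrier_FactGroup \<phi>'_def)
        ultimately show "y \<in> \<Union>?W" by blast
      qed
      ultimately show "openin T' {x \<in> carrier G'. \<phi>' x \<in> A}" by simp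
    qed
    show "\<phi>' n = \<one>\<^bsub>Q\<^esub>" if "n \<in> N'" for n
    proof -
      have one': "\<one>\<^bsub>G'\<^esub> \<in> N'" by (rule subgroup.one_closed[OF N'.is_subgroup])
      have "N' #>\<^bsub>G'\<^esub> n = N' #>\<^bsub>G'\<^esub> \<one>\<^bsub>G'\<^esub>"
        using N'.coset_join2[OF N'.mem_carrier[OF that] N'.is_subgroup that]
          N'.coset_join2[OF N'.mem_carrier N'.is_subgroup, OF one' one'] by simp
      then have "\<phi>' n = \<phi>' \<one>\<^bsub>G'\<^esub>" by (simp add: \<phi>'_def)
      then show ?thesis using Group.hom_one[OF hom G'(1) Q] by simp
    qed
    show "\<phi>' g' = \<phi> g" if "g \<in> carrier G" "h (N' #>\<^bsub>G'\<^esub> g') = N #>\<^bsub>G\<^esub> g" for g g'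
      using that \<psi>(2) by (simp add: \<phi>'_def)
  qed
qed

lemma normal_Inter_family:
  assumes "group G" "\<F> \<noteq> {}" "\<And>N. N \<in> \<F> \<Longrightarrow> N \<lhd> G"
  shows "\<Inter>\<F> \<lhd> G"
proof -
  interpret group G by fact
  have "subgroup (\<Inter>\<F>) G"
    by (rule subgroups_Inter) (use assms normal_imp_subgroup in auto)
  then show ?thesis
    unfolding normal_inv_iff using assms(3) by (auto simp: normal_inv_iff)
qed

lemma carrier_normal:
  assumes "group G" shows "carrier G \<lhd> G"
proof -
  interpret group G by fact
  show ?thesis by (simp add: normal_inv_iff subgroup_self)
qed

lemma closed_normal_subgroup_generated_normal:
  assumes "group G" "topspace T = carrier G" "R \<subseteq> carrier G"
  shows "closed_normal_subgroup_generated G T R \<lhd> G" "R \<subseteq> closed_normal_subgroup_generated G T R"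
proof -
  show "closed_normal_subgroup_generated G T R \<lhd> G"
    unfolding closed_normal_subgroup_generated_def
    by (rule normal_Inter_family[OF assms(1)])
      (use carrier_normal[OF assms(1)] closedin_topspace[of T] assms(2,3) in auto)
  show "R \<subseteq> closed_normal_subgroup_generated G T R"
    unfolding closed_normal_subgroup_generated_def by blast
qed

lemma closed_normal_subgroup_generated_kernel:
  assumes "continuous_hom G T Q \<phi>" "group G" "group Q" "topspace T = carrier G"
    and "R \<subseteq> kernel G Q \<phi>"
  shows "closed_normal_subgroup_generated G T R \<subseteq> kernel G Q \<phi>"
proof -
  interpret group_hom G Q \<phi> by (rule continuous_homD(1)[OF assms(1-3)])
  have "closedin T (kernel G Q \<phi>)"
    using continuous_hom_closedin[OF assms(1,4), of "{\<one>\<^bsub>Q\<^esub>}"] by (simp add: kernel_def)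
  then show ?thesis
    unfolding closed_normal_subgroup_generated_def using normal_kernel assms(5) by blast
qed

text \<open>The whole group, of index \<open>p ^ 0\<close>, belongs to the intersected family; an
  empty family would make the intersection the entire type.\<close>

lemma pro_p_kernel_normal:
  assumes "group G" "topspace T = carrier G"
  shows "pro_p_kernel p G T \<lhd> G"
  unfolding pro_p_kernel_def
proof (rule normal_Inter_family[OF assms(1)])
  interpret group G by fact
  have "rcosets\<^bsub>G\<^esub> (carrier G) = {carrier G}"
    using coset_join2[OF _ subgroup_self] one_closed unfolding RCOSETS_def by blast
  then have "card (rcosets\<^bsub>G\<^esub> (carrier G)) = p ^ 0" by simp
  moreover have "openin T (carrier G)" using openin_topspace[of T] assms(2) by simp
  ultimately have "carrier G \<in> {N. N \<lhd> G \<and> openin T N \<and> (\<exists>k. card (rcosets\<^bsub>G\<^esub> N) = p ^ k)}"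
    using carrier_normal[OF assms(1)] by (intro CollectI conjI exI[of _ 0])
  then show "{N. N \<lhd> G \<and> openin T N \<and> (\<exists>k. card (rcosets\<^bsub>G\<^esub> N) = p ^ k)} \<noteq> {}"
    by (metis empty_iff)
qed blast

text \<open>The kernel is open, and its index is the order of the image, a divisor of
  \<open>p ^ n\<close>. Hence the kernel is one of the intersected subgroups.\<close>

lemma pro_p_kernel_subset_kernel:
  assumes "continuous_hom G T Q \<phi>" "group G" "group Q"
    and Q: "card (carrier Q) = p ^ n" "Factorial_Ring.prime p"
  shows "pro_p_kernel p G T \<subseteq> kernel G Q \<phi>"
proof -
  interpret group_hom G Q \<phi> by (rule continuous_homD(1)[OF assms(1-3)])
  have op: "openin T (kernel G Q \<phi>)"
    using continuous_homD(2)[OF assms(1-3), of "{\<one>\<^bsub>Q\<^esub>}"] by (simp add: kernel_def)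
  have "card (carrier (G Mod kernel G Q \<phi>)) = card (\<phi> ` carrier G)"
  proof -
    obtain g where g: "\<And>x. x \<in> carrier G \<Longrightarrow> g (kernel G Q \<phi> #>\<^bsub>G\<^esub> x) = \<phi> x"
      using FactGroup_universal_kernel[OF normal_kernel subset_refl] by blast
    have "inj_on g (carrier (G Mod kernel G Q \<phi>))"
    proof (rule inj_onI)
      fix C D assume "C \<in> carrier (G Mod kernel G Q \<phi>)" "D \<in> carrier (G Mod kernel G Q \<phi>)"
        and eq: "g C = g D"
      then obtain x y where xy: "x \<in> carrier G" "y \<in> carrier G"
        "C = kernel G Q \<phi> #>\<^bsub>G\<^esub> x" "D = kernel G Q \<phi> #>\<^bsub>G\<^esub> y"
        unfolding carrier_FactGroup by blast
      then have "\<phi> x = \<phi> y" using eq g by simp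
      then show "C = D"
        unfolding xy(3,4) using xy(1,2) by (intro subset_antisym FactGroup_subset) auto
    qed
    moreover have "g ` carrier (G Mod kernel G Q \<phi>) = \<phi> ` carrier G"
      unfolding carrier_FactGroup image_image using g by (intro image_cong) auto
    ultimately show ?thesis using card_image by metis
  qed
  moreover have "card (\<phi> ` carrier G) dvd p ^ n"
    using H.lagrange[OF img_is_subgroup] Q(1)
    by (metis Coset.order_def dvd_triv_right)
  ultimately have "\<exists>k. card (rcosets\<^bsub>G\<^esub> (kernel G Q \<phi>)) = p ^ k"
    using divides_primepow_nat[OF Q(2)] by (auto simp: FactGroup_def)
  then show ?thesis
    unfolding pro_p_kernel_def using normal_kernel op by blast
qed

section \<open>The Krull topology\<close>

lemma absolute_galois_group_simps:
  "\<sigma> \<in> carrier (absolute_galois_group F) \<longleftrightarrow> \<sigma> \<in> extensional separable_closure \<and>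
     bij_betw \<sigma> separable_closure separable_closure \<and>
     (\<forall>y\<in>separable_closure. \<forall>z\<in>separable_closure. \<sigma> (y + z) = \<sigma> y + \<sigma> z \<and> \<sigma> (y * z) = \<sigma> y * \<sigma> z) \<and>
     (\<forall>c. \<sigma> (to_ac c) = to_ac c)"
  "\<sigma> \<otimes>\<^bsub>absolute_galois_group F\<^esub> \<tau> = compose separable_closure \<sigma> \<tau>"
  "\<one>\<^bsub>absolute_galois_group F\<^esub> = restrict (\<lambda>z. z) separable_closure"
  by (simp_all add: absolute_galois_group_def)

lemma absolute_galois_group_mem:
  assumes "\<sigma> \<in> carrier (absolute_galois_group F)"
  shows "\<sigma> \<in> extensional separable_closure"
    "\<And>z. z \<in> separable_closure \<Longrightarrow> \<sigma> z \<in> separable_closure"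
    "\<And>y z. y \<in> separable_closure \<Longrightarrow> z \<in> separable_closure \<Longrightarrow> \<sigma> (y + z) = \<sigma> y + \<sigma> z"
    "\<And>y z. y \<in> separable_closure \<Longrightarrow> z \<in> separable_closure \<Longrightarrow> \<sigma> (y * z) = \<sigma> y * \<sigma> z"
    "\<And>c. \<sigma> (to_ac c) = to_ac c"
  using assms by (auto simp: absolute_galois_group_simps dest: bij_betwE)

lemma group_absolute_galois_group: "group (absolute_galois_group F)"
proof (rule groupI)
  fix \<sigma> \<tau> assume s: "\<sigma> \<in> carrier (absolute_galois_group F)" "\<tau> \<in> carrier (absolute_galois_group F)"
  then have "bij_betw (compose separable_closure \<sigma> \<tau>) separable_closure separable_closure"
    by (auto simp: absolute_galois_group_simps intro: bij_betw_compose)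
  then show "\<sigma> \<otimes>\<^bsub>absolute_galois_group F\<^esub> \<tau> \<in> carrier (absolute_galois_group F)"
    using absolute_galois_group_mem[OF s(1)] absolute_galois_group_mem[OF s(2)]
    by (auto simp: absolute_galois_group_simps compose_def separable_closure_add separable_closure_mult
        separable_closure_to_ac)
next
  show "\<one>\<^bsub>absolute_galois_group F\<^esub> \<in> carrier (absolute_galois_group F)"
    by (auto simp: absolute_galois_group_simps bij_betw_def inj_on_def separable_closure_add
        separable_closure_mult separable_closure_to_ac)
next
  fix \<sigma> \<tau> \<rho> assume "\<tau> \<in> carrier (absolute_galois_group F)" "\<rho> \<in> carrier (absolute_galois_group F)"
  then show "\<sigma> \<otimes>\<^bsub>absolute_galois_group F\<^esub> \<tau> \<otimes>\<^bsub>absolute_galois_group F\<^esub> \<rho> =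
      \<sigma> \<otimes>\<^bsub>absolute_galois_group F\<^esub> (\<tau> \<otimes>\<^bsub>absolute_galois_group F\<^esub> \<rho>)"
    using absolute_galois_group_mem(2)[of \<rho> F]
    by (auto simp: absolute_galois_group_simps(2) compose_def fun_eq_iff)
next
  fix \<sigma> assume s: "\<sigma> \<in> carrier (absolute_galois_group F)"
  then show "\<one>\<^bsub>absolute_galois_group F\<^esub> \<otimes>\<^bsub>absolute_galois_group F\<^esub> \<sigma> = \<sigma>"
    using absolute_galois_group_mem(1,2)[OF s]
    by (auto simp: absolute_galois_group_simps(2,3) compose_def fun_eq_iff extensional_def)
  have bij: "bij_betw \<sigma> separable_closure separable_closure"
    using s by (simp add: absolute_galois_group_simps)
  define \<tau> where "\<tau> = restrict (inv_into separable_closure \<sigma>) separable_closure"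
  have \<tau>: "\<tau> z \<in> separable_closure" "\<sigma> (\<tau> z) = z" "\<tau> (\<sigma> z) = z" if "z \<in> separable_closure" for z
    using that bij absolute_galois_group_mem(2)[OF s]
    by (auto simp: \<tau>_def bij_betw_def inv_into_into f_inv_into_f)
  have inj: "y = z" if "\<sigma> y = \<sigma> z" "y \<in> separable_closure" "z \<in> separable_closure" for y z
    using bij that by (auto simp: bij_betw_def inj_on_def)
  have "\<tau> \<in> carrier (absolute_galois_group F)"
    unfolding absolute_galois_group_simps
  proof (intro conjI ballI allI)
    show "\<tau> \<in> extensional separable_closure" by (simp add: \<tau>_def)
    show "bij_betw \<tau> separable_closure separable_closure"
      unfolding \<tau>_def by (rule bij_betw_cong[THEN iffD2, OF _ bij_betw_inv_into[OF bij]]) simp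
    show "\<tau> (y + z) = \<tau> y + \<tau> z" "\<tau> (y * z) = \<tau> y * \<tau> z"
      if "y \<in> separable_closure" "z \<in> separable_closure" for y z
      by (rule inj; simp add: that \<tau> absolute_galois_group_mem(3,4)[OF s]
          separable_closure_add separable_closure_mult)+
    show "\<tau> (to_ac c) = to_ac c" for c
      using \<tau>(3)[OF separable_closure_to_ac[of c]] absolute_galois_group_mem(5)[OF s, of c] by simp
  qed
  moreover have "\<tau> \<otimes>\<^bsub>absolute_galois_group F\<^esub> \<sigma> = \<one>\<^bsub>absolute_galois_group F\<^esub>"
    using \<tau>(3) by (auto simp: absolute_galois_group_simps(2,3) compose_def fun_eq_iff)
  ultimately show "\<exists>\<tau>\<in>carrier (absolute_galois_group F).
      \<tau> \<otimes>\<^bsub>absolute_galois_group F\<^esub> \<sigma> = \<one>\<^bsub>absolute_galois_group F\<^esub>" by blast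
qed

lemma galois_action_absolute_galois_group:
  fixes F :: "'f::field itself"
  shows "galois_action (absolute_galois_group F) separable_closure"
proof -
  have one: "1 \<in> (separable_closure :: 'f alg_closure set)"
    using separable_closure_to_ac[of 1] by simp
  have ev: "ac_eval p u \<in> separable_closure \<and> \<sigma> (ac_eval p u) = ac_eval p (\<sigma> u)"
    if s: "\<sigma> \<in> carrier (absolute_galois_group F)" and u: "u \<in> separable_closure" for \<sigma> u p
  proof (induction p)
    case 0
    show ?case
      using separable_closure_to_ac[of 0] absolute_galois_group_mem(5)[OF s, of 0] by simp
  next
    case (pCons a p)
    then show ?case
      using u absolute_galois_group_mem(3-5)[OF s]
      by (simp add: separable_closure_add separable_closure_mult separable_closure_to_ac)
  qed
  \<comment> \<open>Conjugates of \<open>u\<close> are roots of one polynomial over the base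
    field.\<close>
  have orb: "finite ((\<lambda>\<sigma>. \<sigma> u) ` carrier (absolute_galois_group F))"
    if u: "u \<in> separable_closure" for u
  proof -
    obtain p where p: "p \<noteq> 0" "ac_eval p u = 0"
      using ex_has_min_degree[of u] has_min_degreeD(1,2) by blast
    have "(\<lambda>\<sigma>. \<sigma> u) ` carrier (absolute_galois_group F) \<subseteq> {z. poly (map_poly to_ac p) z = 0}"
    proof safe
      fix \<sigma> assume s: "\<sigma> \<in> carrier (absolute_galois_group F)"
      show "poly (map_poly to_ac p) (\<sigma> u) = 0"
        using ev[OF s u, of p] absolute_galois_group_mem(5)[OF s, of 0] p(2) by (simp add: ac_eval_def)
    qed
    moreover have "map_poly to_ac p \<noteq> 0" using p(1) by (simp add: map_poly_eq_0_iff)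
    ultimately show ?thesis using poly_roots_finite finite_subset by blast
  qed
  show ?thesis
    by (intro galois_action.intro galois_action_axioms.intro group_absolute_galois_group one orb)
      (simp_all add: separable_closure_add separable_closure_mult separable_closure_minus
        separable_closure_inverse absolute_galois_group_mem absolute_galois_group_simps(2,3) compose_def)
qed

lemma topspace_krull_topology: "topspace (krull_topology F) = carrier (absolute_galois_group F)"
  using absolute_galois_group_mem(1,2)[of _ F]
  by (auto simp: krull_topology_def PiE_def)

text \<open>A basic open set around the identity inside the kernel restricts finitely many
  coordinates, and these form \<open>A\<close>. If two automorphisms agree on \<open>A\<close>, the
  inverse of one times the other fixes \<open>A\<close> pointwise, so it lies in that set.\<close>

lemma continuous_hom_imp_locally_constant:
  fixes F :: "'f::field itself"
  assumes \<phi>: "continuous_hom (absolute_galois_group F) (krull_topology F) Q \<phi>" and Q: "group Q"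
  shows "galois_action.locally_constant (absolute_galois_group F) separable_closure \<phi>"
proof -
  let ?G = "absolute_galois_group F"
  interpret galois_action ?G separable_closure by (rule galois_action_absolute_galois_group)
  interpret hom: group_hom ?G Q \<phi> by (rule continuous_homD(1)[OF \<phi> group_absolute_galois_group Q])
  have "openin (krull_topology F) {x \<in> carrier ?G. \<phi> x \<in> {\<one>\<^bsub>Q\<^esub>}}"
    using continuous_homD(2)[OF \<phi> group_absolute_galois_group Q] .
  then obtain V where V: "openin (product_topology (\<lambda>_. discrete_topology separable_closure) separable_closure) V"
    "{x \<in> carrier ?G. \<phi> x \<in> {\<one>\<^bsub>Q\<^esub>}} = V \<inter> carrier ?G"
    unfolding krull_topology_def openin_subtopology by blast
  have "\<one>\<^bsub>?G\<^esub> \<in> V" using V(2) hom.hom_one one_closed by blast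
  then obtain U where U: "finite {i \<in> separable_closure. U i \<noteq> separable_closure}"
    "\<one>\<^bsub>?G\<^esub> \<in> PiE separable_closure U" "PiE separable_closure U \<subseteq> V"
    using V(1) unfolding openin_product_topology_alt by (auto simp del: one_closed)
  let ?A = "{i \<in> separable_closure. U i \<noteq> separable_closure}"
  show ?thesis
    unfolding locally_constant_def
  proof (intro exI[of _ ?A] conjI ballI impI U(1))
    fix \<sigma> \<tau> assume s: "\<sigma> \<in> carrier ?G" "\<tau> \<in> carrier ?G" and eq: "\<forall>z\<in>?A. \<sigma> z = \<tau> z"
    let ?\<rho> = "inv\<^bsub>?G\<^esub> \<sigma> \<otimes>\<^bsub>?G\<^esub> \<tau>"
    have \<rho>: "?\<rho> \<in> carrier ?G" using s by simp
    have "?\<rho> \<in> PiE separable_closure U"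
    proof (rule PiE_I)
      fix z assume z: "z \<in> (separable_closure :: 'f alg_closure set)"
      show "?\<rho> z \<in> U z"
      proof (cases "z \<in> ?A")
        case True
        have "?\<rho> z = (inv\<^bsub>?G\<^esub> \<sigma>) (\<sigma> z)"
          using eq True act_comp[OF inv_closed[OF s(1)] s(2) z] by simp
        then have "?\<rho> z = z" using act_inv_cancel[OF s(1) z] by simp
        moreover have "\<one>\<^bsub>?G\<^esub> z \<in> U z" using U(2) z by blast
        ultimately show ?thesis using act_one[OF z] by simp
      next
        case False
        then show ?thesis using z act_closed[OF \<rho> z] by auto
      qed
    next
      fix z assume "z \<notin> (separable_closure :: 'f alg_closure set)"
      then show "?\<rho> z = undefined"
        using absolute_galois_group_mem(1)[OF \<rho>] by (simp add: extensional_def)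
    qed
    then have "?\<rho> \<in> V \<inter> carrier ?G" using U(3) \<rho> by blast
    then have "\<phi> ?\<rho> = \<one>\<^bsub>Q\<^esub>" using V(2) by blast
    then have "inv\<^bsub>Q\<^esub> (\<phi> \<sigma>) \<otimes>\<^bsub>Q\<^esub> \<phi> \<tau> = \<one>\<^bsub>Q\<^esub>" using s by simp
    then show "\<phi> \<sigma> = \<phi> \<tau>"
      using s by (metis hom.H.inv_closed hom.H.inv_equality hom.H.inv_inv hom.hom_closed)
  qed auto
qed

text \<open>The preimage is cut out by the set \<open>V\<close> of maps agreeing on \<open>A\<close>
  with some suitable automorphism. Membership in \<open>V\<close> is decided on finitely many
  coordinates, which makes \<open>V\<close> open in the product.\<close>

lemma locally_constant_imp_continuous_hom:
  fixes F :: "'f::field itself"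
  assumes "galois_action.locally_constant (absolute_galois_group F) separable_closure \<phi>"
    and "\<phi> \<in> hom (absolute_galois_group F) Q"
  shows "continuous_hom (absolute_galois_group F) (krull_topology F) Q \<phi>"
  unfolding continuous_hom_def
proof (intro conjI allI assms(2))
  let ?G = "absolute_galois_group F"
  interpret galois_action ?G separable_closure by (rule galois_action_absolute_galois_group)
  fix B
  obtain A where A: "finite A" "A \<subseteq> separable_closure"
    "\<And>\<sigma> \<tau>. \<sigma> \<in> carrier ?G \<Longrightarrow> \<tau> \<in> carrier ?G \<Longrightarrow> (\<forall>z\<in>A. \<sigma> z = \<tau> z) \<Longrightarrow> \<phi> \<sigma> = \<phi> \<tau>"
    using assms(1) unfolding locally_constant_def by blast
  define V where "V = {g \<in> PiE separable_closure (\<lambda>_. separable_closure).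
    \<exists>\<sigma>\<in>carrier ?G. \<phi> \<sigma> \<in> B \<and> (\<forall>z\<in>A. g z = \<sigma> z)}"
  have "openin (product_topology (\<lambda>_. discrete_topology separable_closure) separable_closure) V"
    unfolding openin_product_topology_alt
  proof (intro ballI)
    fix g assume g: "g \<in> V"
    define U where "U i = (if i \<in> A then {g i} else separable_closure)" for i
    have "finite {i \<in> separable_closure. U i \<noteq> separable_closure}"
      by (rule finite_subset[OF _ A(1)]) (auto simp: U_def)
    moreover have "\<forall>i\<in>separable_closure. U i \<subseteq> separable_closure" "g \<in> PiE separable_closure U"
      using g by (auto simp: V_def U_def PiE_def Pi_def)
    moreover have "PiE separable_closure U \<subseteq> V"
    proof
      fix k assume k: "k \<in> PiE separable_closure U"
      have "k z = g z" if "z \<in> A" for z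
        using k that A(2) by (force simp: U_def PiE_def Pi_def)
      moreover have "k \<in> PiE separable_closure (\<lambda>_. separable_closure)"
        using k \<open>\<forall>i\<in>separable_closure. U i \<subseteq> separable_closure\<close> by (auto simp: PiE_def Pi_def)
      ultimately show "k \<in> V" using g by (auto simp: V_def)
    qed
    ultimately show "\<exists>U. finite {i \<in> separable_closure. U i \<noteq> topspace (discrete_topology separable_closure)} \<and>
        (\<forall>i\<in>separable_closure. openin (discrete_topology separable_closure) (U i)) \<and>
        g \<in> PiE separable_closure U \<and> PiE separable_closure U \<subseteq> V"
      by (intro exI[of _ U]) simp
  qed
  moreover have "{\<sigma> \<in> carrier ?G. \<phi> \<sigma> \<in> B} = V \<inter> carrier ?G"
  proof (intro equalityI subsetI)
    fix \<sigma> assume s: "\<sigma> \<in> {\<sigma> \<in> carrier ?G. \<phi> \<sigma> \<in> B}"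
    then have "\<sigma> \<in> PiE separable_closure (\<lambda>_. separable_closure)"
      using absolute_galois_group_mem(1,2)[of \<sigma> F] by (auto simp: PiE_def)
    with s show "\<sigma> \<in> V \<inter> carrier ?G" by (auto simp: V_def)
  next
    fix \<sigma> assume "\<sigma> \<in> V \<inter> carrier ?G"
    then obtain \<tau> where "\<sigma> \<in> carrier ?G" "\<tau> \<in> carrier ?G" "\<phi> \<tau> \<in> B" "\<forall>z\<in>A. \<sigma> z = \<tau> z"
      unfolding V_def by blast
    then show "\<sigma> \<in> {\<sigma> \<in> carrier ?G. \<phi> \<sigma> \<in> B}" using A(3)[of \<sigma> \<tau>] by simp
  qed
  ultimately show "openin (krull_topology F) {\<sigma> \<in> carrier ?G. \<phi> \<sigma> \<in> B}"
    unfolding krull_topology_def openin_subtopology by blast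
qed

text \<open>Only the superdiagonal of \<open>\<psi>\<close> survives in the lift. The corners act as
  trivializations of the two cup products.\<close>

lemma galois_signed_V4_lift:
  fixes F :: "'f::field itself"
  assumes \<psi>: "continuous_hom (absolute_galois_group F) (krull_topology F) heis \<psi>"
    and \<sigma>0: "\<sigma>0 \<in> carrier (absolute_galois_group F)" "fst (\<psi> \<sigma>0)" "\<not> fst (snd (\<psi> \<sigma>0))"
    and \<tau>0: "\<tau>0 \<in> carrier (absolute_galois_group F)" "fst (snd (\<psi> \<tau>0))"
  shows "\<exists>e. continuous_hom (absolute_galois_group F) (krull_topology F) signed_V4
    (\<lambda>\<sigma>. (fst (\<psi> \<sigma>), fst (snd (\<psi> \<sigma>)), e \<sigma>))"
proof -
  let ?G = "absolute_galois_group F"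
  interpret galois_action ?G separable_closure by (rule galois_action_absolute_galois_group)
  define \<alpha> where "\<alpha> \<sigma> = fst (\<psi> \<sigma>)" for \<sigma>
  define \<beta> where "\<beta> \<sigma> = fst (snd (\<psi> \<sigma>))" for \<sigma>
  define \<gamma> where "\<gamma> \<sigma> = fst (snd (snd (\<psi> \<sigma>)))" for \<sigma>
  define \<delta> where "\<delta> \<sigma> = snd (snd (snd (\<psi> \<sigma>)))" for \<sigma>
  have \<psi>_eq: "\<psi> \<sigma> = (\<alpha> \<sigma>, \<beta> \<sigma>, \<gamma> \<sigma>, \<delta> \<sigma>)" for \<sigma>
    by (simp add: \<alpha>_def \<beta>_def \<gamma>_def \<delta>_def)
  have lc: "locally_constant \<psi>" by (rule continuous_hom_imp_locally_constant[OF \<psi> group_heis])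
  have lcs: "locally_constant \<alpha>" "locally_constant \<beta>" "locally_constant \<gamma>" "locally_constant \<delta>"
    unfolding \<alpha>_def[abs_def] \<beta>_def[abs_def] \<gamma>_def[abs_def] \<delta>_def[abs_def]
    by (rule locally_constant_comp[OF lc, of fst] locally_constant_comp[OF lc, of "\<lambda>g. fst (snd g)"]
        locally_constant_comp[OF lc, of "\<lambda>g. fst (snd (snd g))"]
        locally_constant_comp[OF lc, of "\<lambda>g. snd (snd (snd g))"])+
  have homs: "\<alpha> (\<sigma> \<otimes>\<^bsub>?G\<^esub> \<tau>) = (\<alpha> \<sigma> \<noteq> \<alpha> \<tau>)" "\<beta> (\<sigma> \<otimes>\<^bsub>?G\<^esub> \<tau>) = (\<beta> \<sigma> \<noteq> \<beta> \<tau>)"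
    "\<gamma> (\<sigma> \<otimes>\<^bsub>?G\<^esub> \<tau>) = ((\<gamma> \<sigma> \<noteq> \<gamma> \<tau>) \<noteq> (\<alpha> \<sigma> \<and> \<alpha> \<tau>))"
    "\<delta> (\<sigma> \<otimes>\<^bsub>?G\<^esub> \<tau>) = ((\<delta> \<sigma> \<noteq> \<delta> \<tau>) \<noteq> (\<alpha> \<sigma> \<and> \<beta> \<tau>))"
    if "\<sigma> \<in> carrier ?G" "\<tau> \<in> carrier ?G" for \<sigma> \<tau>
  proof -
    have "\<psi> (\<sigma> \<otimes>\<^bsub>?G\<^esub> \<tau>) = \<psi> \<sigma> \<otimes>\<^bsub>heis\<^esub> \<psi> \<tau>"
      using \<psi> that by (auto simp: continuous_hom_def hom_def)
    then show "\<alpha> (\<sigma> \<otimes>\<^bsub>?G\<^esub> \<tau>) = (\<alpha> \<sigma> \<noteq> \<alpha> \<tau>)" "\<beta> (\<sigma> \<otimes>\<^bsub>?G\<^esub> \<tau>) = (\<beta> \<sigma> \<noteq> \<beta> \<tau>)"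
      "\<gamma> (\<sigma> \<otimes>\<^bsub>?G\<^esub> \<tau>) = ((\<gamma> \<sigma> \<noteq> \<gamma> \<tau>) \<noteq> (\<alpha> \<sigma> \<and> \<alpha> \<tau>))"
      "\<delta> (\<sigma> \<otimes>\<^bsub>?G\<^esub> \<tau>) = ((\<delta> \<sigma> \<noteq> \<delta> \<tau>) \<noteq> (\<alpha> \<sigma> \<and> \<beta> \<tau>))"
      unfolding \<psi>_eq mult_heis by blast+
  qed
  have "\<exists>e. locally_constant e \<and> (\<forall>\<sigma>\<in>carrier ?G. parity4 (e \<sigma>) = \<alpha> \<sigma>) \<and>
     (\<forall>\<sigma>\<in>carrier ?G. \<forall>\<tau>\<in>carrier ?G. \<forall>p q.
        e (\<sigma> \<otimes>\<^bsub>?G\<^esub> \<tau>) p q = (e \<tau> p q \<noteq> e \<sigma> (p \<noteq> \<alpha> \<tau>) (q \<noteq> \<beta> \<tau>)))"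
  proof (cases "CHAR('f) = 2")
    case True
    have two: "(2 :: 'f alg_closure) = 0"
      using of_nat_CHAR[where 'a = "'f alg_closure"] True by simp
    have AS: "\<exists>y\<in>separable_closure. y * y + y = z" if "z \<in> separable_closure" for z :: "'f alg_closure"
    proof -
      obtain y where "poly [:-z, 1, 1:] y = 0"
        using alg_closed_imp_poly_has_root[of "[:-z, 1, 1:]"] by auto
      then have "y * y + y = z" by (simp add: algebra_simps eq_neg_iff_add_eq_0)
      then show ?thesis
        using separable_closure_artin_schreier[OF True, of y] that by (auto simp: power2_eq_square)
    qed
    show ?thesis
      by (rule signed_permutation_lift_char_2[OF two AS homs(1,2) lcs(1,2)])
  next
    case False
    have two: "(2 :: 'f alg_closure) \<noteq> 0"
    proof
      assume "(2 :: 'f alg_closure) = 0"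
      then have "CHAR('f) dvd 2"
        using of_nat_eq_0_iff_char_dvd[where 'a = "'f alg_closure", of 2] by simp
      then have "CHAR('f) = 1" using False by (auto dest: prime_nat_iff[THEN iffD1, OF two_is_prime_nat, THEN conjunct2, rule_format])
      then show False using CHAR_not_1'[where 'a = 'f] by simp
    qed
    have sqrt: "\<exists>y\<in>separable_closure. y * y = z" if "z \<in> separable_closure" for z :: "'f alg_closure"
    proof -
      obtain y where "poly [:-z, 0, 1:] y = 0"
        using alg_closed_imp_poly_has_root[of "[:-z, 0, 1:]"] by auto
      then have "y * y = z" by (simp add: algebra_simps eq_neg_iff_add_eq_0)
      then show ?thesis
        using separable_closure_sqrt[OF False, of y] that by (auto simp: power2_eq_square)
    qed
    show ?thesis
      by (rule signed_permutation_lift_char_not_2[OF two sqrt homs lcs \<sigma>0(1) _ _ \<tau>0(1)])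
        (use \<sigma>0 \<tau>0 in \<open>simp_all add: \<alpha>_def \<beta>_def\<close>)
  qed
  then obtain e where e: "locally_constant e" "\<And>\<sigma>. \<sigma> \<in> carrier ?G \<Longrightarrow> parity4 (e \<sigma>) = \<alpha> \<sigma>"
    "\<And>\<sigma> \<tau> p q. \<sigma> \<in> carrier ?G \<Longrightarrow> \<tau> \<in> carrier ?G \<Longrightarrow>
        e (\<sigma> \<otimes>\<^bsub>?G\<^esub> \<tau>) p q = (e \<tau> p q \<noteq> e \<sigma> (p \<noteq> \<alpha> \<tau>) (q \<noteq> \<beta> \<tau>))"
    by blast
  have "locally_constant (\<lambda>\<sigma>. (\<alpha> \<sigma>, \<beta> \<sigma>, e \<sigma>))"
    by (intro locally_constant_Pair lcs e(1))
  moreover have "(\<lambda>\<sigma>. (\<alpha> \<sigma>, \<beta> \<sigma>, e \<sigma>)) \<in> hom ?G signed_V4"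
    using e(2,3) homs(1,2) by (intro homI) (auto simp: fun_eq_iff)
  ultimately have "continuous_hom ?G (krull_topology F) signed_V4 (\<lambda>\<sigma>. (\<alpha> \<sigma>, \<beta> \<sigma>, e \<sigma>))"
    by (rule locally_constant_imp_continuous_hom)
  then show ?thesis unfolding \<alpha>_def \<beta>_def by blast
qed

section \<open>Relations with a triple commutator\<close>

text \<open>The universal property speaks only of groups carried by \<open>('i + nat) set\<close>.
  The sixteen elements are therefore coded as subsets of the four points \<open>Inr 0\<close> to
  \<open>Inr 3\<close>, with the discrete topology.\<close>

lemma free_pro_2_heis_hom:
  fixes x :: "'i \<Rightarrow> 's" and y :: "'i \<Rightarrow> bool \<times> bool \<times> bool \<times> bool"
  assumes free: "free_pro_p_group 2 S T x" and y: "finite {l. y l \<noteq> \<one>\<^bsub>heis\<^esub>}"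
  shows "\<exists>\<phi>. continuous_hom S T heis \<phi> \<and> (\<forall>l. \<phi> (x l) = y l)"
proof -
  define enc :: "bool \<times> bool \<times> bool \<times> bool \<Rightarrow> ('i + nat) set"
    where "enc = (\<lambda>(a, b, c, d). Inr ` {n. n = 0 \<and> a \<or> n = 1 \<and> b \<or> n = 2 \<and> c \<or> n = 3 \<and> d})"
  have inj: "inj enc"
  proof (rule injI)
    fix g h assume eq: "enc g = enc h"
    obtain a b c d a' b' c' d' where gh: "g = (a, b, c, d)" "h = (a', b', c', d')"
      by (cases g; cases h)
    have "(Inr n \<in> enc g) = (Inr n \<in> enc h)" for n using eq by simp
    from this[of 0] this[of 1] this[of 2] this[of 3] show "g = h"
      by (simp add: gh enc_def image_iff)
  qed
  define dec where "dec = inv_into UNIV enc"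
  have dec_enc [simp]: "dec (enc g) = g" for g using inv_into_f_f[OF inj] by (simp add: dec_def)
  define H :: "('i + nat) set monoid"
    where "H = \<lparr>carrier = range enc, monoid.mult = (\<lambda>u v. enc (dec u \<otimes>\<^bsub>heis\<^esub> dec v)), one = enc \<one>\<^bsub>heis\<^esub>\<rparr>"
  have H [simp]: "carrier H = range enc" "u \<otimes>\<^bsub>H\<^esub> v = enc (dec u \<otimes>\<^bsub>heis\<^esub> dec v)"
    "\<one>\<^bsub>H\<^esub> = enc \<one>\<^bsub>heis\<^esub>" for u v
    by (simp_all add: H_def)
  interpret heis: group heis by (rule group_heis)
  have grp: "group H"
  proof (rule groupI)
    fix u assume "u \<in> carrier H"
    then obtain g where g: "u = enc g" by auto
    show "\<exists>v\<in>carrier H. v \<otimes>\<^bsub>H\<^esub> u = \<one>\<^bsub>H\<^esub>"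
      using heis.l_inv[of g] by (intro bexI[of _ "enc (inv\<^bsub>heis\<^esub> g)"]) (simp_all add: g del: one_heis)
  next
    fix u assume "u \<in> carrier H"
    then show "\<one>\<^bsub>H\<^esub> \<otimes>\<^bsub>H\<^esub> u = u"
      using heis.l_one by (auto simp del: one_heis)
  next
    fix u v w
    show "u \<otimes>\<^bsub>H\<^esub> v \<otimes>\<^bsub>H\<^esub> w = u \<otimes>\<^bsub>H\<^esub> (v \<otimes>\<^bsub>H\<^esub> w)"
      using heis.m_assoc[of "dec u" "dec v" "dec w"] by simp
  qed auto
  interpret H: group H by (rule grp)
  let ?D = "discrete_topology (carrier H)"
  have card: "card (carrier H) = 2 ^ 4"
    using card_image[OF inj] by simp
  have fin: "finite (carrier H)" by simp
  have "pro_p_group 2 H ?D"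
    unfolding pro_p_group_def profinite_group_def topological_group_def totally_disconnected_topology_def
  proof (intro conjI allI impI ballI)
    show "continuous_map (prod_topology ?D ?D) ?D (\<lambda>(u, v). u \<otimes>\<^bsub>H\<^esub> v)"
      unfolding prod_topology_discrete_topology[symmetric] continuous_map_from_discrete_topology
      using H.m_closed by auto
    show "continuous_map ?D ?D (\<lambda>u. inv\<^bsub>H\<^esub> u)"
      unfolding continuous_map_from_discrete_topology using H.inv_closed by auto
    show "compact_space ?D" using fin by (simp only: compact_space_discrete_topology)
    show "Hausdorff_space ?D" by (rule Hausdorff_space_discrete_topology)
    show "connected_component_of_set ?D u = {u}" if "u \<in> topspace ?D" for u
    proof (intro equalityI subsetI)
      fix v assume "v \<in> connected_component_of_set ?D u"
      then obtain C w where "C \<subseteq> {w}" "u \<in> C" "v \<in> C"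
        unfolding connected_component_of_def connectedin_discrete_topology by blast
      then show "v \<in> {u}" by blast
    next
      fix v assume "v \<in> {u}"
      then show "v \<in> connected_component_of_set ?D u"
        using that by (simp add: connected_component_of_refl del: topspace_discrete_topology)
    qed
    show "\<exists>k. card (rcosets\<^bsub>H\<^esub> N) = 2 ^ k" if "N \<lhd> H \<and> openin ?D N" for N
    proof -
      have "card (rcosets\<^bsub>H\<^esub> N) dvd 2 ^ 4"
        using H.lagrange[OF normal_imp_subgroup, of N] that card
        by (metis Coset.order_def dvd_triv_left)
      then show ?thesis using divides_primepow_nat[OF two_is_prime_nat] by blast
    qed
  qed (use grp in auto)
  moreover have "family_converges_to_one H ?D (\<lambda>l. enc (y l))"
    unfolding family_converges_to_one_def
  proof (intro conjI allI impI)
    fix U assume "openin ?D U \<and> \<one>\<^bsub>H\<^esub> \<in> U"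
    then show "finite {l. enc (y l) \<notin> U}"
      by (intro finite_subset[OF _ y]) auto
  qed simp
  ultimately obtain \<psi> where \<psi>: "\<psi> \<in> hom S H" "continuous_map T ?D \<psi>" "\<And>l. \<psi> (x l) = enc (y l)"
    using free unfolding free_pro_p_group_def by blast
  have T: "topspace T = carrier S"
    using free by (simp add: free_pro_p_group_def pro_p_group_def profinite_group_def topological_group_def)
  have "continuous_hom S T heis (\<lambda>s. dec (\<psi> s))"
    unfolding continuous_hom_def
  proof (intro conjI allI)
    show "(\<lambda>s. dec (\<psi> s)) \<in> hom S heis"
      using \<psi>(1) by (auto simp: hom_def)
    fix A
    have "openin T {s \<in> topspace T. \<psi> s \<in> enc ` A}"
      by (rule openin_continuous_map_preimage[OF \<psi>(2)]) auto
    moreover have "{s \<in> topspace T. \<psi> s \<in> enc ` A} = {s \<in> carrier S. dec (\<psi> s) \<in> A}"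
    proof (intro Collect_cong conj_cong)
      show "(s \<in> topspace T) = (s \<in> carrier S)" for s using T by simp
      fix s assume "s \<in> carrier S"
      then have "\<psi> s \<in> range enc" using hom_in_carrier[OF \<psi>(1)] by simp
      then show "(\<psi> s \<in> enc ` A) = (dec (\<psi> s) \<in> A)" by auto
    qed
    ultimately show "openin T {s \<in> carrier S. dec (\<psi> s) \<in> A}" by simp
  qed
  then show ?thesis using \<psi>(3) by (intro exI[of _ "\<lambda>s. dec (\<psi> s)"]) simp
qed

text \<open>The names \<open>p\<close> and \<open>q\<close> unite the two alternatives. The
  contradiction is that the lift \<open>\<rho>\<close> is trivial on \<open>r\<close> because
  \<open>r\<close> lies in \<open>M\<close>, but evaluates it to the central element with all signs
  negative.\<close>

lemma not_galois_of_triple_commutator: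
  fixes S :: "'s monoid" and x :: "'i::wellorder \<Rightarrow> 's" and F :: "'f::field itself"
  assumes free: "free_pro_p_group 2 S T x"
    and dec: "\<And>s. s \<in> R \<Longrightarrow> canonical_decomposition S T x s (a s) (b s) (c s)"
    and r: "r \<in> R" and ij: "i < j" and pq: "p = i \<and> q = j \<or> p = j \<and> q = i"
    and ar: "a r p = 0" "a r q = 0"
    and br: "\<And>l m. l < m \<Longrightarrow> l \<in> {i, j} \<or> m \<in> {i, j} \<Longrightarrow> b r l m = 0"
    and cr: "c r i j p = 1"
    and R: "\<And>s. s \<in> R \<Longrightarrow> b s i j = 0 \<and> a s p = 0"
  shows "\<not> topologically_isomorphic
           (S Mod closed_normal_subgroup_generated S T R)
           (quotient_group_topology S T (closed_normal_subgroup_generated S T R))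
           (galois_group_maximal_pro_p 2 F) (galois_group_maximal_pro_p_topology 2 F)"
proof
  let ?G = "absolute_galois_group F" and ?K = "krull_topology F"
  define M where "M = closed_normal_subgroup_generated S T R"
  define N where "N = pro_p_kernel 2 ?G ?K"
  assume "topologically_isomorphic
           (S Mod closed_normal_subgroup_generated S T R)
           (quotient_group_topology S T (closed_normal_subgroup_generated S T R))
           (galois_group_maximal_pro_p 2 F) (galois_group_maximal_pro_p_topology 2 F)"
  then obtain h where h: "h \<in> iso (S Mod M) (?G Mod N)"
    "homeomorphic_map (quotient_group_topology S T M) (quotient_group_topology ?G ?K N) h"
    unfolding topologically_isomorphic_def galois_group_maximal_pro_p_def
      galois_group_maximal_pro_p_topology_def maximal_pro_p_quotient_def
      maximal_pro_p_quotient_topology_def M_def N_def by blast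
  have pS: "pro_p_group 2 S T" and xS: "x l \<in> carrier S" for l
    using free by (auto simp: free_pro_p_group_def family_converges_to_one_def)
  have S: "group S" and T: "topspace T = carrier S"
    using pS by (simp_all add: pro_p_group_def profinite_group_def topological_group_def)
  have G: "group ?G" "topspace ?K = carrier ?G"
    by (rule group_absolute_galois_group, rule topspace_krull_topology)
  have nN: "N \<lhd> ?G" unfolding N_def by (rule pro_p_kernel_normal[OF G])
  have neq: "p \<noteq> q" using pq ij by auto
  have ij_pq: "{i, j} = {p, q}" using pq by auto

  obtain \<phi> where \<phi>: "continuous_hom S T heis \<phi>"
    "\<And>l. \<phi> (x l) = (l = p, l = q, False, False)"
    using free_pro_2_heis_hom[OF free, of "\<lambda>l. (l = p, l = q, False, False)"] by auto
  have killed: "s \<in> carrier S \<and> \<phi> s = \<one>\<^bsub>heis\<^esub>" if s: "s \<in> R" for s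
  proof -
    \<comment> \<open>In \<open>heis\<close> the image of \<open>x p\<close> has a nontrivial
      square, but that of \<open>x q\<close> does not. Hence the condition on squares in
      \<open>s\<close> concerns \<open>p\<close> alone.\<close>
    have t1: "\<phi> (x l) \<otimes>\<^bsub>heis\<^esub> \<phi> (x l) = \<one>\<^bsub>heis\<^esub>" if "a s l = 1" for l
      using that R[OF s] by (cases "l = p") (auto simp: \<phi>(2))
    have t2: "commutator heis (\<phi> (x l)) (\<phi> (x m)) = \<one>\<^bsub>heis\<^esub>" if "l < m" "b s l m = 1" for l m
    proof -
      have "\<not> (l = i \<and> m = j)" using R[OF s] that by auto
      then have "\<not> (l = p \<and> m = q)" "\<not> (l = q \<and> m = p)" using pq ij that by auto
      then show ?thesis by (auto simp: \<phi>(2) commutator_heis)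
    qed
    have t3: "commutator heis (commutator heis (\<phi> (x l)) (\<phi> (x m))) (\<phi> (x k)) = \<one>\<^bsub>heis\<^esub>" for l m k
      by (simp add: \<phi>(2) commutator_heis)
    have dec': "s \<in> carrier S" "\<phi> s = (if c s i j i = 1
        then commutator heis (commutator heis (\<phi> (x i)) (\<phi> (x j))) (\<phi> (x i)) else \<one>\<^bsub>heis\<^esub>)"
      by (rule canonical_decomposition_image[OF dec[OF s] \<phi>(1) S group_heis T xS
            heis_zassenhaus_4_killed[OF \<phi>(1) T S] t1 t2 t3 refl ij less_imp_le[OF ij]]; assumption)+
    then show ?thesis by (simp only: t3 if_cancel)
  qed
  have RS: "R \<subseteq> carrier S" and Rker: "R \<subseteq> kernel S heis \<phi>"
    using killed by (auto simp: kernel_def)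
  have nM: "M \<lhd> S" "R \<subseteq> M"
    unfolding M_def by (rule closed_normal_subgroup_generated_normal[OF S T RS])+
  have Mker: "M \<subseteq> kernel S heis \<phi>"
    unfolding M_def by (rule closed_normal_subgroup_generated_kernel[OF \<phi>(1) S group_heis T Rker])

  let ?A = "quotient_group_topology S T M" and ?B = "quotient_group_topology ?G ?K N"
  have tops: "topspace ?A = carrier (S Mod M)" "topspace ?B = carrier (?G Mod N)"
    by (rule topspace_quotient_group_topology[OF S nM(1) T],
        rule topspace_quotient_group_topology[OF G(1) nN G(2)])
  obtain k where k: "homeomorphic_maps ?A ?B h k"
    using h(2) homeomorphic_map_maps by blast
  have kh: "k (h C) = C" if "C \<in> carrier (S Mod M)" for C
    using k that tops by (simp add: homeomorphic_maps_def)
  have hk: "h (k D) = D" and kD: "k D \<in> carrier (S Mod M)" if "D \<in> carrier (?G Mod N)" for D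
    using k that tops unfolding homeomorphic_maps_def continuous_map_def by auto
  have hC: "h C \<in> carrier (?G Mod N)" if "C \<in> carrier (S Mod M)" for C
    using h(1) that by (auto simp: iso_def hom_def)
  have khom: "k \<in> hom (?G Mod N) (S Mod M)"
  proof (rule homI)
    fix C D assume CD: "C \<in> carrier (?G Mod N)" "D \<in> carrier (?G Mod N)"
    interpret SM: group "S Mod M" by (rule normal.factorgroup_is_group[OF nM(1)])
    have "h (k C \<otimes>\<^bsub>S Mod M\<^esub> k D) = C \<otimes>\<^bsub>?G Mod N\<^esub> D"
      using h(1) kD[OF CD(1)] kD[OF CD(2)] hk[OF CD(1)] hk[OF CD(2)] by (simp add: iso_def hom_def)
    then show "k (C \<otimes>\<^bsub>?G Mod N\<^esub> D) = k C \<otimes>\<^bsub>S Mod M\<^esub> k D"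
      using kh[OF SM.m_closed[OF kD[OF CD(1)] kD[OF CD(2)]]] by simp
  qed (rule kD)
  have hhom: "h \<in> hom (S Mod M) (?G Mod N)" using h(1) by (simp add: iso_def)
  have cont: "continuous_map ?A ?B h" "continuous_map ?B ?A k"
    using k by (simp_all add: homeomorphic_maps_def)

  \<comment> \<open>Crossing from \<open>S\<close> to the Galois group uses the inverse
    \<open>k\<close> of the isomorphism; the return crossing below uses \<open>h\<close>
    itself.\<close>
  obtain \<psi> where \<psi>: "continuous_hom ?G ?K heis \<psi>"
    "\<And>s \<sigma>. s \<in> carrier S \<Longrightarrow> \<sigma> \<in> carrier ?G \<Longrightarrow> k (N #>\<^bsub>?G\<^esub> \<sigma>) = M #>\<^bsub>S\<^esub> s \<Longrightarrow> \<psi> \<sigma> = \<phi> s"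
    by (rule continuous_hom_transport[OF S nM(1) T G(1) nN G(2) group_heis \<phi>(1) Mker khom cont(2)])
      (rule that)
  have lift: "\<exists>\<sigma>\<in>carrier ?G. h (M #>\<^bsub>S\<^esub> s) = N #>\<^bsub>?G\<^esub> \<sigma> \<and> \<psi> \<sigma> = \<phi> s" if s: "s \<in> carrier S" for s
  proof -
    have C: "M #>\<^bsub>S\<^esub> s \<in> carrier (S Mod M)" using s by (auto simp: carrier_FactGroup)
    then obtain \<sigma> where \<sigma>: "\<sigma> \<in> carrier ?G" "h (M #>\<^bsub>S\<^esub> s) = N #>\<^bsub>?G\<^esub> \<sigma>"
      using hC[OF C] by (auto simp: carrier_FactGroup)
    then have "\<psi> \<sigma> = \<phi> s" using \<psi>(2)[OF s \<sigma>(1)] kh[OF C] by simp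
    with \<sigma> show ?thesis by blast
  qed
  obtain \<sigma>0 where \<sigma>0: "\<sigma>0 \<in> carrier ?G" "\<psi> \<sigma>0 = \<phi> (x p)" using lift[OF xS] by blast
  obtain \<tau>0 where \<tau>0: "\<tau>0 \<in> carrier ?G" "\<psi> \<tau>0 = \<phi> (x q)" using lift[OF xS] by blast
  obtain e where e: "continuous_hom ?G ?K signed_V4 (\<lambda>\<sigma>. (fst (\<psi> \<sigma>), fst (snd (\<psi> \<sigma>)), e \<sigma>))"
    using galois_signed_V4_lift[OF \<psi>(1) \<sigma>0(1) _ _ \<tau>0(1)] \<sigma>0(2) \<tau>0(2) \<phi>(2) neq by auto
  have Nker: "N \<subseteq> kernel ?G signed_V4 (\<lambda>\<sigma>. (fst (\<psi> \<sigma>), fst (snd (\<psi> \<sigma>)), e \<sigma>))"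
    unfolding N_def
    by (rule pro_p_kernel_subset_kernel[OF e G(1) group_signed_V4, of 2 5])
      (simp_all add: card_signed_V4)
  obtain \<rho> where \<rho>: "continuous_hom S T signed_V4 \<rho>" "\<And>s. s \<in> M \<Longrightarrow> \<rho> s = \<one>\<^bsub>signed_V4\<^esub>"
    "\<And>\<sigma> s. \<sigma> \<in> carrier ?G \<Longrightarrow> s \<in> carrier S \<Longrightarrow> h (M #>\<^bsub>S\<^esub> s) = N #>\<^bsub>?G\<^esub> \<sigma> \<Longrightarrow>
       \<rho> s = (fst (\<psi> \<sigma>), fst (snd (\<psi> \<sigma>)), e \<sigma>)"
    by (rule continuous_hom_transport[OF G(1) nN G(2) S nM(1) T group_signed_V4 e Nker hhom cont(1)])
      (rule that)
  have "\<exists>e. \<rho> (x l) = (l = p, l = q, e)" for l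
  proof -
    obtain \<sigma> where \<sigma>: "\<sigma> \<in> carrier ?G" "h (M #>\<^bsub>S\<^esub> x l) = N #>\<^bsub>?G\<^esub> \<sigma>" "\<psi> \<sigma> = \<phi> (x l)"
      using lift[OF xS] by blast
    then show ?thesis using \<rho>(3)[OF \<sigma>(1) xS \<sigma>(2)] by (simp add: \<phi>(2))
  qed
  \<comment> \<open>Lifting forgets all but the superdiagonal, so \<open>E\<close> is unknown apart
    from its parity. The computations below hold for every such \<open>E\<close>.\<close>
  then obtain E where E: "\<And>l. \<rho> (x l) = (l = p, l = q, E l)" by metis
  have \<rho>C: "\<rho> (x l) \<in> carrier signed_V4" for l
    using \<rho>(1) xS by (auto simp: continuous_hom_def hom_def)
  interpret V: group signed_V4 by (rule group_signed_V4)
  have in2: "\<rho> (x l) \<in> signed_V4_2" if "l \<noteq> p" "l \<noteq> q" for l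
    using \<rho>C[of l] that by (simp add: E)
  let ?c = "commutator signed_V4"
  have Ep: "\<rho> (x p) = (True, False, E p)" and Eq: "\<rho> (x q) = (False, True, E q)"
    using E neq by auto
  have pqc: "\<rho> (x i) = (True, False, E p) \<and> \<rho> (x j) = (False, True, E q) \<or>
      \<rho> (x j) = (True, False, E p) \<and> \<rho> (x i) = (False, True, E q)"
    using pq Ep Eq by auto
  note triple = signed_V4_triple_commutator[OF \<rho>C[of p, unfolded Ep] \<rho>C[of q, unfolded Eq] pqc]
  \<comment> \<open>The images of \<open>x p\<close> and \<open>x q\<close> may have nontrivial
    squares here, so both exponents must vanish in \<open>r\<close>; all other generators land in
    \<open>signed_V4_2\<close>, of exponent 2.\<close>
  have t1: "\<rho> (x l) \<otimes>\<^bsub>signed_V4\<^esub> \<rho> (x l) = \<one>\<^bsub>signed_V4\<^esub>" if "a r l = 1" for l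
    using that ar in2[of l] signed_V4_2_square by (metis zero_neq_one)
  have t2: "?c (\<rho> (x l)) (\<rho> (x m)) = \<one>\<^bsub>signed_V4\<^esub>" if "l < m" "b r l m = 1" for l m
  proof -
    have "l \<notin> {p, q}" "m \<notin> {p, q}" using br[OF that(1)] that(2) unfolding ij_pq by auto
    then show ?thesis by (intro commutator_signed_V4_2_2 in2) auto
  qed
  have t3: "?c (?c (\<rho> (x l)) (\<rho> (x m))) (\<rho> (x n)) = \<one>\<^bsub>signed_V4\<^esub>"
    if "l < m" "n \<le> m" "c r l m n = 1" "(l, m, n) \<noteq> (i, j, p)" for l m n
  proof (cases "l \<in> {p, q} \<and> m \<in> {p, q}")
    case True
    then have lm: "l = i" "m = j" using \<open>l < m\<close> ij pq by auto
    have c2: "?c (\<rho> (x i)) (\<rho> (x j)) \<in> signed_V4_2"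
      using \<rho>C[of i] \<rho>C[of j] V.commutator_closed[OF \<rho>C[of i] \<rho>C[of j]] E[of i] E[of j]
      by (auto simp: commutator_signed_V4)
    show ?thesis
    proof (cases "n = q")
      case True
      then show ?thesis using triple(2) by (simp add: lm Eq)
    next
      case False
      then have "n \<noteq> p" using that(4) lm by auto
      then show ?thesis unfolding lm by (intro commutator_signed_V4_2_2 c2 in2 False)
    qed
  next
    \<comment> \<open>One entry of the inner commutator lies in \<open>signed_V4_2\<close>, which
      makes that commutator central.\<close>
    case False
    then have "?c (\<rho> (x l)) (\<rho> (x m)) \<in> signed_V4_3"
      using commutator_signed_V4_2[OF \<rho>C in2] by auto
    then show ?thesis by (rule commutator_signed_V4_3(2)[OF \<rho>C])
  qed
  have "p \<le> j" using pq ij by auto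
  have "\<rho> r = (if c r i j p = 1 then ?c (?c (\<rho> (x i)) (\<rho> (x j))) (\<rho> (x p)) else \<one>\<^bsub>signed_V4\<^esub>)"
    by (rule canonical_decomposition_image(2)[OF dec[OF r] \<rho>(1) S group_signed_V4 T xS
          signed_V4_zassenhaus_4_killed[OF \<rho>(1) T S] t1 t2 t3 refl ij \<open>p \<le> j\<close>]; assumption)
  also have "\<dots> = (False, False, \<lambda>_ _. True)"
    using triple(1) cr by (simp add: Ep)
  finally show False
    using \<rho>(2)[of r] r nM(2) by (auto simp: fun_eq_iff)
qed

theorem theorem1p4:
  fixes S :: "'s monoid" and T :: "'s topology"
    and x :: "'i::wellorder \<Rightarrow> 's"
    and R :: "'s set"
    and a :: "'s \<Rightarrow> 'i \<Rightarrow> nat"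
    and b :: "'s \<Rightarrow> 'i \<Rightarrow> 'i \<Rightarrow> nat"
    and c :: "'s \<Rightarrow> 'i \<Rightarrow> 'i \<Rightarrow> 'i \<Rightarrow> nat"
    and r :: 's and i j :: 'i
  assumes "free_pro_p_group 2 S T x"
    and "R \<subseteq> zassenhaus S T 2"
    and "\<And>s. s \<in> R \<Longrightarrow> canonical_decomposition S T x s (a s) (b s) (c s)"
    and "r \<in> R" and "i < j"
    and "a r i = 0" and "a r j = 0" and "sym_exponent (b r) i j = 0"
    and "\<And>l. l \<noteq> i \<Longrightarrow> l \<noteq> j \<Longrightarrow> sym_exponent (b r) i l = 0 \<and> sym_exponent (b r) j l = 0"
    and "(c r i j i \<noteq> 0 \<and> (\<forall>s\<in>R. s \<noteq> r \<longrightarrow> b s i j = 0 \<and> a s i = 0)) \<or>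
         (c r i j j \<noteq> 0 \<and> (\<forall>s\<in>R. s \<noteq> r \<longrightarrow> b s i j = 0 \<and> a s j = 0))"
  shows "\<not> topologically_isomorphic
           (S Mod closed_normal_subgroup_generated S T R)
           (quotient_group_topology S T (closed_normal_subgroup_generated S T R))
           (galois_group_maximal_pro_p 2 TYPE('f::field))
           (galois_group_maximal_pro_p_topology 2 TYPE('f))"
proof -
  note free = assms(1) and dec = assms(3) and r = assms(4) and ij = assms(5)
  have bij: "b r i j = 0" using assms(8) ij by (simp add: sym_exponent_def)
  have br: "b r l m = 0" if lm: "l < m" "l \<in> {i, j} \<or> m \<in> {i, j}" for l m
  proof (cases "l \<in> {i, j} \<and> m \<in> {i, j}")
    case True
    then show ?thesis using lm ij bij by auto
  next
    case False
    then show ?thesis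
      using lm assms(9)[of l] assms(9)[of m] by (auto simp: sym_exponent_def split: if_splits)
  qed
  \<comment> \<open>Exponents are natural numbers, and only the decomposition restricts them to 0
    and 1.\<close>
  have c01: "c r i j k = 1" if k: "c r i j k \<noteq> 0" "k \<le> j" for k
  proof -
    have "\<forall>i j k. i < j \<and> k \<le> j \<longrightarrow> c r i j k \<in> {0, 1}"
      using dec[OF r] unfolding canonical_decomposition_def by (elim conjE)
    then have "c r i j k \<in> {0, 1}" using ij k(2) by blast
    with k(1) show ?thesis by simp
  qed
  from assms(10) show ?thesis
  proof (elim disjE conjE)
    assume c: "c r i j i \<noteq> 0" and R: "\<forall>s\<in>R. s \<noteq> r \<longrightarrow> b s i j = 0 \<and> a s i = 0"
    show ?thesis
      by (rule not_galois_of_triple_commutator[OF free dec r ij, of i j])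
        (use assms(6,7) br c01[OF c] ij R bij in auto)
  next
    assume c: "c r i j j \<noteq> 0" and R: "\<forall>s\<in>R. s \<noteq> r \<longrightarrow> b s i j = 0 \<and> a s j = 0"
    show ?thesis
      by (rule not_galois_of_triple_commutator[OF free dec r ij, of j i])
        (use assms(6,7) br c01[OF c] R bij in auto)
  qed
qed

end
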